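(* 1) The set $\mathrm{Aut}(H_1^i)$ of automorphisms of $H_1^i$, coinciding with $\mathrm{Aut}(N_1^i)$, consists of elements of the following two types (whose respective sets are denoted $\mathrm{Aut}_I(H_1^i)$ and $\mathrm{Aut}_{II}(H_1^i)$). Type I: $$\varphi(e_0)=e_0+\beta E_0+\gamma F_0+\delta E_1+\eta F_1+(\beta\eta+\gamma\delta)(C_1-C_0),$$ $$\varphi(E_0)=\mu_0E_0+\nu_0F_0+(\delta\nu_0+\eta\mu_0)(C_1-C_0),$$ $$\varphi(F_0)=\sigma_0E_0+\tau_0F_0+(\delta\tau_0+\eta\sigma_0)(C_1-C_0),\qquad \varphi(C_0)=\lambda C_0,$$ $$\varphi(e_1)=e_1-\beta E_0-\gamma F_0-\delta E_1-\eta F_1-(\beta\eta+\gamma\delta)(C_1-C_0),$$ $$\varphi(E_1)=\mu_1E_1+\nu_1F_1+(\beta\nu_1+\gamma\mu_1)(C_1-C_0),$$ $$\varphi(F_1)=\sigma_1E_1+\tau_1F_1+(\beta\tau_1+\gamma\sigma_1)(C_1-C_0),\qquad \varphi(C_1)=\lambda C_1,$$ for constants $\beta,\gamma,\delta,\eta,\lambda,\mu_0,\nu_0,\sigma_0,\tau_0,\mu_1,\nu_1,\sigma_1,\tau_1\in\mathbb{C}$ constrained by (i) $\mu_0\nu_1+\nu_0\mu_1=0$; (ii) $\sigma_0\tau_1+\tau_0\sigma_1=0$; (iii) $\lambda=\mu_0\tau_1+\nu_0\sigma_1=\sigma_0\nu_1+\tau_0\mu_1$; (iv) $\mu_0\tau_0-\nu_0\sigma_0\neq0$;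 (v) $\mu_1\tau_1-\nu_1\sigma_1\neq0$; (vi) $\lambda\neq0$. Type II: the products $\varphi\kappa$ (or, for that matter, $\kappa\varphi$) with $\varphi$ of the preceding type I and $\kappa$ the flip; explicitly $$\varphi(e_0)=e_1+\beta E_1+\gamma F_1+\delta E_0+\eta F_0+(\beta\eta+\gamma\delta)(C_0-C_1),$$ $$\varphi(E_0)=\mu_0E_1+\nu_0F_1+(\delta\nu_0+\eta\mu_0)(C_0-C_1),$$ $$\varphi(F_0)=\sigma_0E_1+\tau_0F_1+(\delta\tau_0+\eta\sigma_0)(C_0-C_1),\qquad \varphi(C_0)=\lambda C_1,$$ $$\varphi(e_1)=e_0-\beta E_1-\gamma F_1-\delta E_0-\eta F_0-(\beta\eta+\gamma\delta)(C_0-C_1),$$ $$\varphi(E_1)=\mu_1E_0+\nu_1F_0+(\beta\nu_1+\gamma\mu_1)(C_0-C_1),$$ $$\varphi(F_1)=\sigma_1E_0+\tau_1F_0+(\beta\tau_1+\gamma\sigma_1)(C_0-C_1),\qquad \varphi(C_1)=\lambda C_0,$$ with constants constrained as in (i)-(vi). These constraints, as well as the whole structure of $H_1^i$, are invariant under the flip. 2) $\mathrm{Aut}_I(H_1^i)$ is a normal subgroup of $\mathrm{Aut}(H_1^i)$. 3) The subgroup of $\mathrm{Aut}_I(H_1^i)$ specified by $\beta=\gamma=\delta=\eta=0$ consists of the $4\times4$ matrices $$M=\begin{pmatrix} \mu_0 & \nu_0 & 0 & 0 \\ \sigma_0 & \tau_0 & 0 & 0 \\ 0 & 0 & \mu_1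 & \nu_1 \\ 0 & 0 & \sigma_1 & \tau_1 \end{pmatrix}\in M_2(\mathbb{C})\oplus M_2(\mathbb{C})$$ leaving stable the set of bilinear forms with vanishing sum of elements of their second diagonal. Specifically, for each matrix of the form $$G=\begin{pmatrix} 0 & 0 & a & b \\ 0 & 0 & -b & d \\ a & -b & 0 & 0 \\ b & d & 0 & 0 \end{pmatrix},\qquad a,b,d\in\mathbb{C},$$ $M^{t}GM$ is a matrix of the same type. 4) The constraints (i)-(vi) entail the relations $\nu_0\tau_1+\tau_0\nu_1=0$ and $\mu_0\sigma_1+\sigma_0\mu_1=0$. Two symmetries permute these formulae (either respecting or exchanging them): the flip ($0\leftrightarrow1$) and the symmetry ($E\leftrightarrow F$, $\mu\leftrightarrow\tau$, $\nu\leftrightarrow\sigma$).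
   Context: $H_1^i$ is the unital associative $\mathbb{C}$-algebra generated by $K,E,F$ with relations $KE=-EK$, $KF=-FK$, $EF=FE$, $E^2=F^2=0$, $K^2=\mathbf 1$. Put $e_0=\frac{\mathbf 1+K}{2}$, $e_1=\frac{\mathbf 1-K}{2}$, and for $j=0,1$: $E_j=e_jE$, $F_j=e_jF$, $C_j=e_jEF$; these eight elements form a basis of $H_1^i$. $N_1^i$ is the nilradical of $H_1^i$, spanned by $E_0,E_1,F_0,F_1,C_0,C_1$. $\mathrm{Aut}$ denotes the set of algebra automorphisms. The flip $\kappa$ is the algebra automorphism of $H_1^i$ with $\kappa(K)=-K$, $\kappa(E)=E$, $\kappa(F)=F$; it exchanges $e_0\leftrightarrow e_1$, $E_0\leftrightarrow E_1$, $F_0\leftrightarrow F_1$, $C_0\leftrightarrow C_1$. In part 3, an automorphism is identified with the matrix of its coefficients $\mu_j,\nu_j,\sigma_j,\tau_j$.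
   Formalization: "Coinciding with Aut(N)" is false (E0→E0+C0 on N does not extend to H). Proved instead: restriction maps Aut(H) bijectively onto the automorphisms of N preserving [H,H], and each automorphism of N agrees mod N² with one of H. In part 3 the matrices M are taken invertible. *)

theory Defs
  imports
    "HOL-Analysis.Determinants"
    "HOL-Algebra.Coset"
    "HOL-Library.Poly_Mapping"
    "HOL-Library.FuncSet"
begin

section \<open>Two-sided ideals and the nilradical\<close>

definition two_sided_ideal :: "'a::ring_1 set \<Rightarrow> bool" where
  "two_sided_ideal I \<longleftrightarrow>
     0 \<in> I \<and> (\<forall>x\<in>I. \<forall>y\<in>I. x + y \<in> I) \<and> (\<forall>a. \<forall>x\<in>I. a * x \<in> I \<and> x * a \<in> I)"

definition ideal_generated :: "'a::ring_1 set \<Rightarrow> 'a set" where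
  "ideal_generated S = \<Inter>{I. two_sided_ideal I \<and> S \<subseteq> I}"

text \<open>A sum of two nil two-sided ideals is nil, so the union of all of them is itself the
  largest nil two-sided ideal. In a finite-dimensional algebra it is also the largest nilpotent one.\<close>

definition nilradical :: "'a::ring_1 set" where
  "nilradical = \<Union>{I. two_sided_ideal I \<and> (\<forall>x\<in>I. \<exists>n. x ^ n = 0)}"

section \<open>The algebra \<open>H\<^sub>1\<^sup>i\<close> by generators and relations\<close>

datatype generator = GK | GE | GF

text \<open>The free monoid on the generators, written additively: the convolution product of
  \<^typ>\<open>'a \<Rightarrow>\<^sub>0 'b\<close> is based on addition of exponents, so that \<open>word \<Rightarrow>\<^sub>0 complex\<close> is the free
  associative algebra.\<close>

datatype word = Word "generator list"

instantiation word :: monoid_add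
begin

definition zero_word :: word where "zero_word = Word []"

fun plus_word :: "word \<Rightarrow> word \<Rightarrow> word" where "Word u + Word v = Word (u @ v)"

instance
proof
  fix a b c :: word
  show "a + b + c = a + (b + c)" by (cases a; cases b; cases c) simp
  show "0 + a = a" by (cases a) (simp add: zero_word_def)
  show "a + 0 = a" by (cases a) (simp add: zero_word_def)
qed

end

type_synonym free_algebra = "word \<Rightarrow>\<^sub>0 complex"

definition free_gen :: "generator \<Rightarrow> free_algebra" where
  "free_gen g = Poly_Mapping.single (Word [g]) 1"

definition relators :: "free_algebra set" where
  "relators =
    (let K = free_gen GK; E = free_gen GE; F = free_gen GF in
      {K * E + E * K, K * F + F * K, E * F - F * E, E * E, F * F, K * K - 1})"

lemma two_sided_ideal_ideal_generated: "two_sided_ideal (ideal_generated S)"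
  by (auto simp: two_sided_ideal_def ideal_generated_def)

lemma two_sided_ideal_uminus: "two_sided_ideal I \<Longrightarrow> x \<in> I \<Longrightarrow> - x \<in> I"
  by (metis mult_minus1 two_sided_ideal_def)

lemma two_sided_ideal_diff: "two_sided_ideal I \<Longrightarrow> x \<in> I \<Longrightarrow> y \<in> I \<Longrightarrow> x - y \<in> I"
  by (metis diff_conv_add_uminus two_sided_ideal_def two_sided_ideal_uminus)

definition h1i_rel :: "free_algebra \<Rightarrow> free_algebra \<Rightarrow> bool" where
  "h1i_rel x y \<longleftrightarrow> x - y \<in> ideal_generated relators"

lemma equivp_h1i_rel: "equivp h1i_rel"
proof (rule equivpI)
  note I = two_sided_ideal_ideal_generated[of relators]
  show "reflp h1i_rel"
    using I by (simp add: reflp_def h1i_rel_def two_sided_ideal_def)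
  show "symp h1i_rel"
    unfolding symp_def h1i_rel_def using two_sided_ideal_uminus[OF I] by fastforce
  show "transp h1i_rel"
  proof (rule transpI)
    fix x y z assume "h1i_rel x y" "h1i_rel y z"
    then have "(x - y) + (y - z) \<in> ideal_generated relators"
      using I unfolding two_sided_ideal_def h1i_rel_def by blast
    then show "h1i_rel x z" by (simp add: h1i_rel_def)
  qed
qed

quotient_type h1i = free_algebra / h1i_rel
  by (rule equivp_h1i_rel)

text \<open>The class \<open>ring_1\<close> includes \<open>0 \<noteq> 1\<close>, so its instance has to exclude that the relations
  collapse the algebra. The character \<open>K \<mapsto> 1\<close>, \<open>E, F \<mapsto> 0\<close> of the free algebra does this.\<close>

fun word_weight :: "word \<Rightarrow> complex" where
  "word_weight (Word w) = (if set w \<subseteq> {GK} then 1 else 0)"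

definition character :: "free_algebra \<Rightarrow> complex" where
  "character x = (\<Sum>w\<in>Poly_Mapping.keys x. Poly_Mapping.lookup x w * word_weight w)"

lemma character_supset:
  "finite A \<Longrightarrow> Poly_Mapping.keys x \<subseteq> A \<Longrightarrow> character x = (\<Sum>w\<in>A. Poly_Mapping.lookup x w * word_weight w)"
  unfolding character_def by (rule sum.mono_neutral_left) (auto simp: in_keys_iff)

lemma character_add: "character (x + y) = character x + character y"
proof -
  let ?A = "Poly_Mapping.keys x \<union> Poly_Mapping.keys y"
  have "character (x + y) = (\<Sum>w\<in>?A. Poly_Mapping.lookup (x + y) w * word_weight w)"
    by (rule character_supset) (simp_all add: Poly_Mapping.keys_add)
  also have "\<dots> = (\<Sum>w\<in>?A. Poly_Mapping.lookup x w * word_weight w) + (\<Sum>w\<in>?A. Poly_Mapping.lookup y w * word_weight w)"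
    by (simp add: lookup_add ring_distribs sum.distrib)
  also have "\<dots> = character x + character y"
    by (subst (1 2) character_supset[of ?A]) auto
  finally show ?thesis .
qed

lemma character_single: "character (Poly_Mapping.single w c) = c * word_weight w"
  by (simp add: character_def)

lemma word_weight_add: "word_weight (u + v) = word_weight u * word_weight v"
  by (cases u; cases v) auto

lemma character_zero: "character 0 = 0"
  by (simp add: character_def)

lemma character_one: "character 1 = 1"
proof -
  have "character (Poly_Mapping.single 0 1) = word_weight 0"
    by (simp only: character_single mult_1)
  then show ?thesis by (simp add: zero_word_def flip: single_one)
qed

lemma free_algebra_induct [case_names zero add]:
  fixes x :: free_algebra
  assumes "P 0" and "\<And>x w c. P x \<Longrightarrow> P (x + Poly_Mapping.single w c)"
  shows "P x"
proof (induction x rule: update_induct)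
  case const
  then show ?case by (rule assms(1))
next
  case (update f w c)
  then have "Poly_Mapping.update w c f = f + Poly_Mapping.single w c"
    by (intro poly_mapping_eqI)
      (auto simp: lookup_add lookup_single lookup_update in_keys_iff when_def)
  with update show ?case using assms(2) by simp
qed

lemma character_mult: "character (x * y) = character x * character y"
proof (induction x rule: free_algebra_induct)
  case zero
  show ?case by (simp add: character_zero)
next
  case (add x u c)
  have "character (Poly_Mapping.single u c * y) = character (Poly_Mapping.single u c) * character y"
    by (induction y rule: free_algebra_induct)
      (simp_all add: character_zero character_add character_single mult_single word_weight_add
        distrib_left)
  with add show ?case by (simp add: distrib_right character_add)
qed

lemma character_ideal: "x \<in> ideal_generated relators \<Longrightarrow> character x = 0"
proof -
  assume x: "x \<in> ideal_generated relators"
  have diff: "character (a - b) = character a - character b" for a b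
    using character_add[of "a - b" b] by simp
  have "two_sided_ideal {x. character x = 0}"
    by (simp add: two_sided_ideal_def character_zero character_add character_mult)
  moreover have "relators \<subseteq> {x. character x = 0}"
    by (simp add: relators_def Let_def free_gen_def diff character_one character_add character_mult
        character_single)
  ultimately show ?thesis using x unfolding ideal_generated_def by blast
qed

instantiation h1i :: ring_1
begin

lift_definition zero_h1i :: h1i is 0 .
lift_definition one_h1i :: h1i is 1 .

lift_definition plus_h1i :: "h1i \<Rightarrow> h1i \<Rightarrow> h1i" is "(+)"
proof -
  fix x x' y y' assume "h1i_rel x x'" "h1i_rel y y'"
  then have "(x - x') + (y - y') \<in> ideal_generated relators"
    using two_sided_ideal_ideal_generated[of relators]
    unfolding two_sided_ideal_def h1i_rel_def by blast
  then show "h1i_rel (x + y) (x' + y')" by (simp add: h1i_rel_def algebra_simps)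
qed

lift_definition uminus_h1i :: "h1i \<Rightarrow> h1i" is uminus
proof -
  fix x x' assume "h1i_rel x x'"
  then have "- (x - x') \<in> ideal_generated relators"
    unfolding h1i_rel_def
    by (rule two_sided_ideal_uminus[OF two_sided_ideal_ideal_generated])
  then show "h1i_rel (- x) (- x')" by (simp add: h1i_rel_def)
qed

lift_definition minus_h1i :: "h1i \<Rightarrow> h1i \<Rightarrow> h1i" is "(-)"
proof -
  fix x x' y y' assume "h1i_rel x x'" "h1i_rel y y'"
  then have "(x - x') - (y - y') \<in> ideal_generated relators"
    unfolding h1i_rel_def
    by (rule two_sided_ideal_diff[OF two_sided_ideal_ideal_generated])
  then show "h1i_rel (x - y) (x' - y')" by (simp add: h1i_rel_def algebra_simps)
qed

lift_definition times_h1i :: "h1i \<Rightarrow> h1i \<Rightarrow> h1i" is "(*)"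
proof -
  fix x x' y y' assume "h1i_rel x x'" "h1i_rel y y'"
  then have "(x - x') * y + x' * (y - y') \<in> ideal_generated relators"
    using two_sided_ideal_ideal_generated[of relators]
    unfolding two_sided_ideal_def h1i_rel_def by blast
  then show "h1i_rel (x * y) (x' * y')" by (simp add: h1i_rel_def algebra_simps)
qed

lemma h1i_rel_refl: "h1i_rel x x"
  using equivp_h1i_rel by (rule equivp_reflp)

instance
proof
  fix a b c :: h1i
  show "a + b + c = a + (b + c)" by transfer (simp add: h1i_rel_refl add.assoc)
  show "a + b = b + a" by transfer (simp add: h1i_rel_refl add.commute)
  show "0 + a = a" by transfer (simp add: h1i_rel_refl)
  show "- a + a = 0" by transfer (simp add: h1i_rel_refl)
  show "a - b = a + - b" by transfer (simp add: h1i_rel_refl)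
  show "a * b * c = a * (b * c)" by transfer (simp add: h1i_rel_refl mult.assoc)
  show "1 * a = a" by transfer (simp add: h1i_rel_refl)
  show "a * 1 = a" by transfer (simp add: h1i_rel_refl)
  show "(a + b) * c = a * c + b * c" by transfer (simp add: h1i_rel_refl distrib_right)
  show "a * (b + c) = a * b + a * c" by transfer (simp add: h1i_rel_refl distrib_left)
  show "(0::h1i) \<noteq> 1"
  proof transfer
    show "\<not> h1i_rel 0 1"
    proof
      assume "h1i_rel 0 1"
      then have "character (0 - 1) = 0"
        unfolding h1i_rel_def by (rule character_ideal)
      moreover have "character (0 - 1) + character 1 = character 0"
        unfolding character_add[symmetric] by simp
      ultimately show False by (simp add: character_zero character_one)
    qed
  qed
qed

end

lift_definition of_cplx :: "complex \<Rightarrow> h1i" is "\<lambda>c. Poly_Mapping.single 0 c" .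

definition scaleH :: "complex \<Rightarrow> h1i \<Rightarrow> h1i" (infixr "*\<^sub>H" 75) where
  "c *\<^sub>H x = of_cplx c * x"

lemma of_cplx_simps:
  "of_cplx (c + d) = of_cplx c + of_cplx d" "of_cplx (c * d) = of_cplx c * of_cplx d"
  "of_cplx 1 = 1"
  by (transfer; simp add: h1i_rel_refl single_add mult_single)+

global_interpretation H: vector_space scaleH
  by standard (simp_all add: scaleH_def of_cplx_simps ring_distribs mult.assoc)

lift_definition genK :: h1i is "free_gen GK" .
lift_definition genE :: h1i is "free_gen GE" .
lift_definition genF :: h1i is "free_gen GF" .

definition e\<^sub>0 :: h1i where "e\<^sub>0 = (1/2) *\<^sub>H (1 + genK)"
definition e\<^sub>1 :: h1i where "e\<^sub>1 = (1/2) *\<^sub>H (1 - genK)"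
definition E\<^sub>0 :: h1i where "E\<^sub>0 = e\<^sub>0 * genE"
definition E\<^sub>1 :: h1i where "E\<^sub>1 = e\<^sub>1 * genE"
definition F\<^sub>0 :: h1i where "F\<^sub>0 = e\<^sub>0 * genF"
definition F\<^sub>1 :: h1i where "F\<^sub>1 = e\<^sub>1 * genF"
definition C\<^sub>0 :: h1i where "C\<^sub>0 = e\<^sub>0 * genE * genF"
definition C\<^sub>1 :: h1i where "C\<^sub>1 = e\<^sub>1 * genE * genF"

section \<open>Automorphisms\<close>

definition Aut_H :: "(h1i \<Rightarrow> h1i) set" where
  "Aut_H = {\<phi>. Vector_Spaces.linear scaleH scaleH \<phi> \<and> bij \<phi> \<and>
                \<phi> 1 = 1 \<and> (\<forall>x y. \<phi> (x * y) = \<phi> x * \<phi> y)}"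

definition Aut_H_group :: "(h1i \<Rightarrow> h1i) monoid" where
  "Aut_H_group = \<lparr>carrier = Aut_H, monoid.mult = (\<circ>), one = id\<rparr>"

abbreviation N_H :: "h1i set" where "N_H \<equiv> nilradical"

text \<open>Automorphisms of the non-unital algebra \<open>N\<close>; \<open>extensional\<close> fixes their values off \<open>N\<close>.\<close>

definition Aut_N :: "(h1i \<Rightarrow> h1i) set" where
  "Aut_N = {\<psi> \<in> extensional N_H. bij_betw \<psi> N_H N_H \<and>
     (\<forall>c. \<forall>x\<in>N_H. \<psi> (c *\<^sub>H x) = c *\<^sub>H \<psi> x) \<and>
     (\<forall>x\<in>N_H. \<forall>y\<in>N_H. \<psi> (x + y) = \<psi> x + \<psi> y \<and> \<psi> (x * y) = \<psi> x * \<psi> y)}"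

definition N_H_squared :: "h1i set" where
  "N_H_squared = H.span {x * y | x y. x \<in> N_H \<and> y \<in> N_H}"

text \<open>\<open>N\<close> has automorphisms that are not restrictions of automorphisms of \<open>H\<close>, for example
  \<open>E\<^sub>0 \<mapsto> E\<^sub>0 + C\<^sub>0\<close> with the other five basis vectors fixed: the products in \<open>N\<close> do not see terms in
  \<open>N\<^sup>2 = \<langle>C\<^sub>0, C\<^sub>1\<rangle>\<close>. The subspace \<open>[H, H] = \<langle>E\<^sub>0, E\<^sub>1, F\<^sub>0, F\<^sub>1, C\<^sub>0 - C\<^sub>1\<rangle>\<close> of \<open>N\<close> singles out the
  restrictions.\<close>

definition commutator_space :: "h1i set" where
  "commutator_space = H.span {x * y - y * x | x y. True}"

definition flip :: "h1i \<Rightarrow> h1i" ("\<kappa>") where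
  "\<kappa> = (THE \<phi>. \<phi> \<in> Aut_H \<and> \<phi> genK = - genK \<and> \<phi> genE = genE \<and> \<phi> genF = genF)"

definition swap_EF :: "h1i \<Rightarrow> h1i" ("\<epsilon>") where
  "\<epsilon> = (THE \<phi>. \<phi> \<in> Aut_H \<and> \<phi> genK = genK \<and> \<phi> genE = genF \<and> \<phi> genF = genE)"

section \<open>The two families\<close>

record aut_params =
  \<beta> :: complex
  \<gamma> :: complex
  \<delta> :: complex
  \<eta> :: complex
  lam :: complex
  \<mu>\<^sub>0 :: complex
  \<nu>\<^sub>0 :: complex
  \<sigma>\<^sub>0 :: complex
  \<tau>\<^sub>0 :: complex
  \<mu>\<^sub>1 :: complex
  \<nu>\<^sub>1 :: complex
  \<sigma>\<^sub>1 :: complex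
  \<tau>\<^sub>1 :: complex

definition constr_i :: "aut_params \<Rightarrow> bool" where
  "constr_i p \<longleftrightarrow> \<mu>\<^sub>0 p * \<nu>\<^sub>1 p + \<nu>\<^sub>0 p * \<mu>\<^sub>1 p = 0"

definition constr_ii :: "aut_params \<Rightarrow> bool" where
  "constr_ii p \<longleftrightarrow> \<sigma>\<^sub>0 p * \<tau>\<^sub>1 p + \<tau>\<^sub>0 p * \<sigma>\<^sub>1 p = 0"

text \<open>The two equalities of (iii) are kept apart because both symmetries exchange them.\<close>

definition constr_iii_a :: "aut_params \<Rightarrow> bool" where
  "constr_iii_a p \<longleftrightarrow> lam p = \<mu>\<^sub>0 p * \<tau>\<^sub>1 p + \<nu>\<^sub>0 p * \<sigma>\<^sub>1 p"

definition constr_iii_b :: "aut_params \<Rightarrow> bool" where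
  "constr_iii_b p \<longleftrightarrow> lam p = \<sigma>\<^sub>0 p * \<nu>\<^sub>1 p + \<tau>\<^sub>0 p * \<mu>\<^sub>1 p"

definition constr_iv :: "aut_params \<Rightarrow> bool" where
  "constr_iv p \<longleftrightarrow> \<mu>\<^sub>0 p * \<tau>\<^sub>0 p - \<nu>\<^sub>0 p * \<sigma>\<^sub>0 p \<noteq> 0"

definition constr_v :: "aut_params \<Rightarrow> bool" where
  "constr_v p \<longleftrightarrow> \<mu>\<^sub>1 p * \<tau>\<^sub>1 p - \<nu>\<^sub>1 p * \<sigma>\<^sub>1 p \<noteq> 0"

definition constr_vi :: "aut_params \<Rightarrow> bool" where
  "constr_vi p \<longleftrightarrow> lam p \<noteq> 0"

definition constraints :: "aut_params \<Rightarrow> bool" where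
  "constraints p \<longleftrightarrow> constr_i p \<and> constr_ii p \<and> constr_iii_a p \<and> constr_iii_b p \<and>
     constr_iv p \<and> constr_v p \<and> constr_vi p"

definition relation_\<nu>\<tau> :: "aut_params \<Rightarrow> bool" where
  "relation_\<nu>\<tau> p \<longleftrightarrow> \<nu>\<^sub>0 p * \<tau>\<^sub>1 p + \<tau>\<^sub>0 p * \<nu>\<^sub>1 p = 0"

definition relation_\<mu>\<sigma> :: "aut_params \<Rightarrow> bool" where
  "relation_\<mu>\<sigma> p \<longleftrightarrow> \<mu>\<^sub>0 p * \<sigma>\<^sub>1 p + \<sigma>\<^sub>0 p * \<mu>\<^sub>1 p = 0"

definition is_type_I :: "aut_params \<Rightarrow> (h1i \<Rightarrow> h1i) \<Rightarrow> bool" where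
  "is_type_I p \<phi> \<longleftrightarrow>
     constraints p \<and> Vector_Spaces.linear scaleH scaleH \<phi> \<and>
     \<phi> e\<^sub>0 = e\<^sub>0 + \<beta> p *\<^sub>H E\<^sub>0 + \<gamma> p *\<^sub>H F\<^sub>0 + \<delta> p *\<^sub>H E\<^sub>1 + \<eta> p *\<^sub>H F\<^sub>1
             + (\<beta> p * \<eta> p + \<gamma> p * \<delta> p) *\<^sub>H (C\<^sub>1 - C\<^sub>0) \<and>
     \<phi> E\<^sub>0 = \<mu>\<^sub>0 p *\<^sub>H E\<^sub>0 + \<nu>\<^sub>0 p *\<^sub>H F\<^sub>0 + (\<delta> p * \<nu>\<^sub>0 p + \<eta> p * \<mu>\<^sub>0 p) *\<^sub>H (C\<^sub>1 - C\<^sub>0) \<and>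
     \<phi> F\<^sub>0 = \<sigma>\<^sub>0 p *\<^sub>H E\<^sub>0 + \<tau>\<^sub>0 p *\<^sub>H F\<^sub>0 + (\<delta> p * \<tau>\<^sub>0 p + \<eta> p * \<sigma>\<^sub>0 p) *\<^sub>H (C\<^sub>1 - C\<^sub>0) \<and>
     \<phi> C\<^sub>0 = lam p *\<^sub>H C\<^sub>0 \<and>
     \<phi> e\<^sub>1 = e\<^sub>1 - \<beta> p *\<^sub>H E\<^sub>0 - \<gamma> p *\<^sub>H F\<^sub>0 - \<delta> p *\<^sub>H E\<^sub>1 - \<eta> p *\<^sub>H F\<^sub>1
             - (\<beta> p * \<eta> p + \<gamma> p * \<delta> p) *\<^sub>H (C\<^sub>1 - C\<^sub>0) \<and>
     \<phi> E\<^sub>1 = \<mu>\<^sub>1 p *\<^sub>H E\<^sub>1 + \<nu>\<^sub>1 p *\<^sub>H F\<^sub>1 + (\<beta> p * \<nu>\<^sub>1 p + \<gamma> p * \<mu>\<^sub>1 p) *\<^sub>H (C\<^sub>1 - C\<^sub>0) \<and>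
     \<phi> F\<^sub>1 = \<sigma>\<^sub>1 p *\<^sub>H E\<^sub>1 + \<tau>\<^sub>1 p *\<^sub>H F\<^sub>1 + (\<beta> p * \<tau>\<^sub>1 p + \<gamma> p * \<sigma>\<^sub>1 p) *\<^sub>H (C\<^sub>1 - C\<^sub>0) \<and>
     \<phi> C\<^sub>1 = lam p *\<^sub>H C\<^sub>1"

definition is_type_II :: "aut_params \<Rightarrow> (h1i \<Rightarrow> h1i) \<Rightarrow> bool" where
  "is_type_II p \<phi> \<longleftrightarrow>
     constraints p \<and> Vector_Spaces.linear scaleH scaleH \<phi> \<and>
     \<phi> e\<^sub>0 = e\<^sub>1 + \<beta> p *\<^sub>H E\<^sub>1 + \<gamma> p *\<^sub>H F\<^sub>1 + \<delta> p *\<^sub>H E\<^sub>0 + \<eta> p *\<^sub>H F\<^sub>0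
             + (\<beta> p * \<eta> p + \<gamma> p * \<delta> p) *\<^sub>H (C\<^sub>0 - C\<^sub>1) \<and>
     \<phi> E\<^sub>0 = \<mu>\<^sub>0 p *\<^sub>H E\<^sub>1 + \<nu>\<^sub>0 p *\<^sub>H F\<^sub>1 + (\<delta> p * \<nu>\<^sub>0 p + \<eta> p * \<mu>\<^sub>0 p) *\<^sub>H (C\<^sub>0 - C\<^sub>1) \<and>
     \<phi> F\<^sub>0 = \<sigma>\<^sub>0 p *\<^sub>H E\<^sub>1 + \<tau>\<^sub>0 p *\<^sub>H F\<^sub>1 + (\<delta> p * \<tau>\<^sub>0 p + \<eta> p * \<sigma>\<^sub>0 p) *\<^sub>H (C\<^sub>0 - C\<^sub>1) \<and>
     \<phi> C\<^sub>0 = lam p *\<^sub>H C\<^sub>1 \<and>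
     \<phi> e\<^sub>1 = e\<^sub>0 - \<beta> p *\<^sub>H E\<^sub>1 - \<gamma> p *\<^sub>H F\<^sub>1 - \<delta> p *\<^sub>H E\<^sub>0 - \<eta> p *\<^sub>H F\<^sub>0
             - (\<beta> p * \<eta> p + \<gamma> p * \<delta> p) *\<^sub>H (C\<^sub>0 - C\<^sub>1) \<and>
     \<phi> E\<^sub>1 = \<mu>\<^sub>1 p *\<^sub>H E\<^sub>0 + \<nu>\<^sub>1 p *\<^sub>H F\<^sub>0 + (\<beta> p * \<nu>\<^sub>1 p + \<gamma> p * \<mu>\<^sub>1 p) *\<^sub>H (C\<^sub>0 - C\<^sub>1) \<and>
     \<phi> F\<^sub>1 = \<sigma>\<^sub>1 p *\<^sub>H E\<^sub>0 + \<tau>\<^sub>1 p *\<^sub>H F\<^sub>0 + (\<beta> p * \<tau>\<^sub>1 p + \<gamma> p * \<sigma>\<^sub>1 p) *\<^sub>H (C\<^sub>0 - C\<^sub>1) \<and>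
     \<phi> C\<^sub>1 = lam p *\<^sub>H C\<^sub>0"

definition Aut_I :: "(h1i \<Rightarrow> h1i) set" where
  "Aut_I = {\<phi>. \<exists>p. is_type_I p \<phi>}"

definition Aut_II :: "(h1i \<Rightarrow> h1i) set" where
  "Aut_II = {\<phi> \<circ> \<kappa> | \<phi>. \<phi> \<in> Aut_I}"

text \<open>In the two reparametrisations below, only the action on the last eight parameters is forced by
  the index rules \<open>0 \<leftrightarrow> 1\<close> and \<open>\<mu> \<leftrightarrow> \<tau>\<close>, \<open>\<nu> \<leftrightarrow> \<sigma>\<close>. The signs are those for which conjugation by the flip carries the type I automorphism of
  \<open>p\<close> to that of \<open>flip_params p\<close>: exchanging \<open>0\<close> and \<open>1\<close> in \<open>\<phi>(e\<^sub>1) = e\<^sub>1 - \<beta> E\<^sub>0 - \<dots>\<close> gives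
  \<open>e\<^sub>0 - \<beta> E\<^sub>1 - \<dots>\<close>.\<close>

definition flip_params :: "aut_params \<Rightarrow> aut_params" where
  "flip_params p = \<lparr>\<beta> = - \<delta> p, \<gamma> = - \<eta> p, \<delta> = - \<beta> p, \<eta> = - \<gamma> p, lam = lam p,
     \<mu>\<^sub>0 = \<mu>\<^sub>1 p, \<nu>\<^sub>0 = \<nu>\<^sub>1 p, \<sigma>\<^sub>0 = \<sigma>\<^sub>1 p, \<tau>\<^sub>0 = \<tau>\<^sub>1 p,
     \<mu>\<^sub>1 = \<mu>\<^sub>0 p, \<nu>\<^sub>1 = \<nu>\<^sub>0 p, \<sigma>\<^sub>1 = \<sigma>\<^sub>0 p, \<tau>\<^sub>1 = \<tau>\<^sub>0 p\<rparr>"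

definition swap_params :: "aut_params \<Rightarrow> aut_params" where
  "swap_params p = \<lparr>\<beta> = \<gamma> p, \<gamma> = \<beta> p, \<delta> = \<eta> p, \<eta> = \<delta> p, lam = lam p,
     \<mu>\<^sub>0 = \<tau>\<^sub>0 p, \<nu>\<^sub>0 = \<sigma>\<^sub>0 p, \<sigma>\<^sub>0 = \<nu>\<^sub>0 p, \<tau>\<^sub>0 = \<mu>\<^sub>0 p,
     \<mu>\<^sub>1 = \<tau>\<^sub>1 p, \<nu>\<^sub>1 = \<sigma>\<^sub>1 p, \<sigma>\<^sub>1 = \<nu>\<^sub>1 p, \<tau>\<^sub>1 = \<mu>\<^sub>1 p\<rparr>"

section \<open>Matrices\<close>

definition Aut_I_diag :: "(h1i \<Rightarrow> h1i) set" where
  "Aut_I_diag = {\<phi>. \<exists>p. is_type_I p \<phi> \<and> \<beta> p = 0 \<and> \<gamma> p = 0 \<and> \<delta> p = 0 \<and> \<eta> p = 0}"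

definition block_matrix ::
  "complex \<Rightarrow> complex \<Rightarrow> complex \<Rightarrow> complex \<Rightarrow> complex \<Rightarrow> complex \<Rightarrow> complex \<Rightarrow> complex \<Rightarrow> complex^4^4"
  where
  "block_matrix m\<^sub>0 n\<^sub>0 s\<^sub>0 t\<^sub>0 m\<^sub>1 n\<^sub>1 s\<^sub>1 t\<^sub>1 =
     vector [vector [m\<^sub>0, n\<^sub>0, 0, 0],
             vector [s\<^sub>0, t\<^sub>0, 0, 0],
             vector [0, 0, m\<^sub>1, n\<^sub>1],
             vector [0, 0, s\<^sub>1, t\<^sub>1]]"

definition params_matrix :: "aut_params \<Rightarrow> complex^4^4" where
  "params_matrix p =
     block_matrix (\<mu>\<^sub>0 p) (\<nu>\<^sub>0 p) (\<sigma>\<^sub>0 p) (\<tau>\<^sub>0 p) (\<mu>\<^sub>1 p) (\<nu>\<^sub>1 p) (\<sigma>\<^sub>1 p) (\<tau>\<^sub>1 p)"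

definition aut_matrix :: "(h1i \<Rightarrow> h1i) \<Rightarrow> complex^4^4" where
  "aut_matrix \<phi> = params_matrix (THE p. is_type_I p \<phi>)"

definition block_matrices :: "(complex^4^4) set" where
  "block_matrices = {M. \<exists>m\<^sub>0 n\<^sub>0 s\<^sub>0 t\<^sub>0 m\<^sub>1 n\<^sub>1 s\<^sub>1 t\<^sub>1. M = block_matrix m\<^sub>0 n\<^sub>0 s\<^sub>0 t\<^sub>0 m\<^sub>1 n\<^sub>1 s\<^sub>1 t\<^sub>1}"

definition form_matrix :: "complex \<Rightarrow> complex \<Rightarrow> complex \<Rightarrow> complex^4^4" where
  "form_matrix a b d =
     vector [vector [0, 0, a, b],
             vector [0, 0, - b, d],
             vector [a, - b, 0, 0],
             vector [b, d, 0, 0]]"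

definition special_forms :: "(complex^4^4) set" where
  "special_forms = {G. \<exists>a b d. G = form_matrix a b d}"

text \<open>All bilinear forms on \<open>\<complex>\<^sup>4\<close> whose second diagonal has sum zero, without the block shape of
  \<^const>\<open>special_forms\<close>.\<close>

definition antitraceless_forms :: "(complex^4^4) set" where
  "antitraceless_forms = {G. G $ 1 $ 4 + G $ 2 $ 3 + G $ 3 $ 2 + G $ 4 $ 1 = 0}"

definition leaves_stable :: "complex^4^4 \<Rightarrow> (complex^4^4) set \<Rightarrow> bool" where
  "leaves_stable M S \<longleftrightarrow> (\<forall>G\<in>S. transpose M ** G ** M \<in> S)"

end

theory Submission
  imports Defs
begin

text \<open>With respect to the Peirce decomposition for \<open>e\<^sub>0\<close>, \<open>e\<^sub>1\<close>, the algebra is given by one nondegenerate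
  symmetric form \<open>b\<close>: for \<open>u \<in> \<langle>E\<^sub>0, F\<^sub>0\<rangle>\<close> and \<open>v \<in> \<langle>E\<^sub>1, F\<^sub>1\<rangle>\<close>, \<open>uv = b(u, v) C\<^sub>0\<close> and \<open>vu = b(u, v) C\<^sub>1\<close>.
  An automorphism sends \<open>e\<^sub>0\<close> into \<open>e\<^sub>0 + N\<close> or \<open>e\<^sub>1 + N\<close>; in the first case idempotency and the Peirce
  relations force the type I formulae, and the constraints say that \<open>b\<close> is multiplied by \<open>\<lambda>\<close>. The second
  case is reduced to the first by the flip.

  An automorphism of \<open>N\<close> preserves or exchanges the two planes \<open>\<langle>E\<^sub>j, F\<^sub>j\<rangle> + N\<^sup>2\<close>, because their elements
  are those that generate at most a line under multiplication by \<open>N\<close>. It then scales \<open>b\<close>, hence agrees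
  modulo \<open>N\<^sup>2\<close> with a type I automorphism up to the flip; if it preserves \<open>[H, H]\<close>, the remaining
  \<open>C\<close>-coordinates are matched by solving for \<open>\<beta>\<close>, \<open>\<gamma>\<close>, \<open>\<delta>\<close>, \<open>\<eta>\<close>.\<close>

section \<open>Coordinates\<close>

text \<open>Linear independence of the eight spanning elements is read off a homomorphism onto this
  concrete algebra, in which a product \<open>X\<^sub>i Y\<^sub>j\<close> of two odd basis elements vanishes unless \<open>i \<noteq> j\<close>.\<close>

datatype model = Model (m_e0: complex) (m_e1: complex) (m_E0: complex) (m_E1: complex)
  (m_F0: complex) (m_F1: complex) (m_C0: complex) (m_C1: complex)

instantiation model :: ring_1
begin

definition "0 = Model 0 0 0 0 0 0 0 0"
definition "1 = Model 1 1 0 0 0 0 0 0"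
definition "x + y = Model (m_e0 x + m_e0 y) (m_e1 x + m_e1 y) (m_E0 x + m_E0 y) (m_E1 x + m_E1 y)
  (m_F0 x + m_F0 y) (m_F1 x + m_F1 y) (m_C0 x + m_C0 y) (m_C1 x + m_C1 y)"
definition "x - y = Model (m_e0 x - m_e0 y) (m_e1 x - m_e1 y) (m_E0 x - m_E0 y) (m_E1 x - m_E1 y)
  (m_F0 x - m_F0 y) (m_F1 x - m_F1 y) (m_C0 x - m_C0 y) (m_C1 x - m_C1 y)"
definition "- x = Model (- m_e0 x) (- m_e1 x) (- m_E0 x) (- m_E1 x)
  (- m_F0 x) (- m_F1 x) (- m_C0 x) (- m_C1 x)"
text \<open>Peirce multiplication: \<open>E\<^sub>0\<close> and \<open>F\<^sub>0\<close> lie in the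
  corner from \<open>e\<^sub>0\<close> to \<open>e\<^sub>1\<close>, \<open>E\<^sub>1\<close> and
  \<open>F\<^sub>1\<close> in the opposite one, and \<open>C\<^sub>j\<close> in the diagonal corner
  of \<open>e\<^sub>j\<close>.\<close>

definition "x * y = Model (m_e0 x * m_e0 y) (m_e1 x * m_e1 y)
  (m_e0 x * m_E0 y + m_E0 x * m_e1 y) (m_e1 x * m_E1 y + m_E1 x * m_e0 y)
  (m_e0 x * m_F0 y + m_F0 x * m_e1 y) (m_e1 x * m_F1 y + m_F1 x * m_e0 y)
  (m_e0 x * m_C0 y + m_C0 x * m_e0 y + m_E0 x * m_F1 y + m_F0 x * m_E1 y)
  (m_e1 x * m_C1 y + m_C1 x * m_e1 y + m_E1 x * m_F0 y + m_F1 x * m_E0 y)"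

instance
  by standard (simp_all add: zero_model_def one_model_def plus_model_def minus_model_def
      uminus_model_def times_model_def algebra_simps)

end

lemmas model_defs = zero_model_def one_model_def plus_model_def minus_model_def
  uminus_model_def times_model_def

section \<open>Evaluation of the free algebra in the model\<close>

text \<open>The values are forced by \<open>K = e\<^sub>0 - e\<^sub>1\<close>,
  \<open>E = E\<^sub>0 + E\<^sub>1\<close> and \<open>F = F\<^sub>0 + F\<^sub>1\<close>.\<close>

fun model_gen :: "generator \<Rightarrow> model" where
  "model_gen GK = Model 1 (-1) 0 0 0 0 0 0"
| "model_gen GE = Model 0 0 1 1 0 0 0 0"
| "model_gen GF = Model 0 0 0 0 1 1 0 0"

fun model_word :: "word \<Rightarrow> model" where
  "model_word (Word w) = prod_list (map model_gen w)"

text \<open>The model carries a ring structure only, so scaling is expressed as multiplication by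
  the central element \<open>c\<close> times \<open>e\<^sub>0 + e\<^sub>1 = 1\<close>.\<close>

definition model_scalar :: "complex \<Rightarrow> model" where
  "model_scalar c = Model c c 0 0 0 0 0 0"

definition model_eval :: "free_algebra \<Rightarrow> model" where
  "model_eval x = (\<Sum>w\<in>Poly_Mapping.keys x. model_scalar (Poly_Mapping.lookup x w) * model_word w)"

lemma model_word_add: "model_word (u + v) = model_word u * model_word v"
  by (cases u; cases v) simp

lemma model_word_zero: "model_word 0 = 1"
  by (simp add: zero_word_def)

lemma model_scalar_simps:
  "model_scalar 0 = 0" "model_scalar 1 = 1"
  "model_scalar (c + d) = model_scalar c + model_scalar d"
  "model_scalar (c * d) = model_scalar c * model_scalar d"
  by (simp_all add: model_scalar_def model_defs)

lemma model_scalar_commute: "x * model_scalar c = model_scalar c * x"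
  by (simp add: model_scalar_def model_defs)

text \<open>Allows two elements and their sum to be summed over one common index set, which makes
  additivity a termwise matter.\<close>

lemma model_eval_supset:
  "finite A \<Longrightarrow> Poly_Mapping.keys x \<subseteq> A \<Longrightarrow>
    model_eval x = (\<Sum>w\<in>A. model_scalar (Poly_Mapping.lookup x w) * model_word w)"
  unfolding model_eval_def
  by (rule sum.mono_neutral_left) (auto simp: in_keys_iff model_scalar_simps)

lemma model_eval_add: "model_eval (x + y) = model_eval x + model_eval y"
proof -
  let ?A = "Poly_Mapping.keys x \<union> Poly_Mapping.keys y"
  have "model_eval (x + y) = (\<Sum>w\<in>?A. model_scalar (Poly_Mapping.lookup (x + y) w) * model_word w)"
    by (rule model_eval_supset) (simp_all add: Poly_Mapping.keys_add)
  also have "\<dots> = (\<Sum>w\<in>?A. model_scalar (Poly_Mapping.lookup x w) * model_word w)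
      + (\<Sum>w\<in>?A. model_scalar (Poly_Mapping.lookup y w) * model_word w)"
    by (simp add: lookup_add model_scalar_simps distrib_right sum.distrib)
  also have "\<dots> = model_eval x + model_eval y"
    by (subst (1 2) model_eval_supset[of ?A]) auto
  finally show ?thesis .
qed

lemma model_eval_zero: "model_eval 0 = 0"
  by (simp add: model_eval_def)

lemma model_eval_single: "model_eval (Poly_Mapping.single w c) = model_scalar c * model_word w"
  by (simp add: model_eval_def model_scalar_simps)

lemma model_eval_one: "model_eval 1 = 1"
  using model_eval_single[of 0 1] by (simp add: model_word_zero model_scalar_simps)

lemma model_eval_mult: "model_eval (x * y) = model_eval x * model_eval y"
proof (induction x rule: free_algebra_induct)
  case zero
  show ?case by (simp add: model_eval_zero)
next
  case (add x u c)
  have comm: "model_scalar d * (model_word u * v) = model_word u * (model_scalar d * v)" for d v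
    by (metis model_scalar_commute mult.assoc)
  have "model_eval (Poly_Mapping.single u c * y) = model_eval (Poly_Mapping.single u c) * model_eval y"
    by (induction y rule: free_algebra_induct)
      (simp_all add: model_eval_zero model_eval_add model_eval_single mult_single model_word_add
        model_scalar_simps distrib_left mult.assoc comm)
  with add show ?case by (simp add: distrib_right model_eval_add)
qed

lemma model_eval_diff: "model_eval (x - y) = model_eval x - model_eval y"
  using model_eval_add[of "x - y" y] by simp

lemma model_eval_free_gen: "model_eval (free_gen g) = model_gen g"
  by (simp add: free_gen_def model_eval_single model_scalar_simps)

text \<open>The kernel of the evaluation is a two-sided ideal containing the relators, hence
  contains the ideal that they generate. This lets the evaluation descend to the quotient.\<close>

lemma model_eval_ideal:
  assumes "x \<in> ideal_generated relators"
  shows "model_eval x = 0"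
proof -
  have "two_sided_ideal {x. model_eval x = 0}"
    by (simp add: two_sided_ideal_def model_eval_zero model_eval_add model_eval_mult)
  moreover have "relators \<subseteq> {x. model_eval x = 0}"
    by (simp add: relators_def Let_def model_eval_diff model_eval_one model_eval_add model_eval_mult
        model_eval_free_gen)
      (simp add: model_defs)
  ultimately show ?thesis using assms unfolding ideal_generated_def by blast
qed

lift_definition to_model :: "h1i \<Rightarrow> model" is model_eval
  using model_eval_ideal by (fastforce simp: h1i_rel_def model_eval_diff)

lemma to_model_simps:
  "to_model 0 = 0" "to_model 1 = 1" "to_model (x + y) = to_model x + to_model y"
  "to_model (x - y) = to_model x - to_model y" "to_model (- x) = - to_model x"
  "to_model (x * y) = to_model x * to_model y" "to_model (of_cplx c) = model_scalar c"
  "to_model genK = model_gen GK" "to_model genE = model_gen GE" "to_model genF = model_gen GF"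
proof -
  show "to_model 0 = 0" by transfer (rule model_eval_zero)
  show "to_model 1 = 1" by transfer (rule model_eval_one)
  show add: "to_model (x + y) = to_model x + to_model y" for x y by transfer (rule model_eval_add)
  show diff: "to_model (x - y) = to_model x - to_model y" for x y by transfer (rule model_eval_diff)
  show "to_model (- x) = - to_model x" using diff[of 0 x] \<open>to_model 0 = 0\<close> by simp
  show "to_model (x * y) = to_model x * to_model y" by transfer (rule model_eval_mult)
  show "to_model (of_cplx c) = model_scalar c"
    by transfer (simp add: model_eval_single model_word_zero)
  show "to_model genK = model_gen GK" "to_model genE = model_gen GE" "to_model genF = model_gen GF"
    by (transfer, rule model_eval_free_gen)+
qed

section \<open>Coordinate functionals\<close>

text \<open>Taken from the model, the eight functionals are available before the basis theorem;
  \<open>comb_co\<close> later shows that they are the coordinates.\<close>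

definition coe0 :: "h1i \<Rightarrow> complex" where "coe0 x = m_e0 (to_model x)"
definition coe1 :: "h1i \<Rightarrow> complex" where "coe1 x = m_e1 (to_model x)"
definition coE0 :: "h1i \<Rightarrow> complex" where "coE0 x = m_E0 (to_model x)"
definition coE1 :: "h1i \<Rightarrow> complex" where "coE1 x = m_E1 (to_model x)"
definition coF0 :: "h1i \<Rightarrow> complex" where "coF0 x = m_F0 (to_model x)"
definition coF1 :: "h1i \<Rightarrow> complex" where "coF1 x = m_F1 (to_model x)"
definition coC0 :: "h1i \<Rightarrow> complex" where "coC0 x = m_C0 (to_model x)"
definition coC1 :: "h1i \<Rightarrow> complex" where "coC1 x = m_C1 (to_model x)"

lemmas co_defs = coe0_def coe1_def coE0_def coE1_def coF0_def coF1_def coC0_def coC1_def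
lemmas basis_defs = e\<^sub>0_def e\<^sub>1_def E\<^sub>0_def E\<^sub>1_def F\<^sub>0_def F\<^sub>1_def C\<^sub>0_def C\<^sub>1_def

lemma co_zero [simp]:
  "coe0 0 = 0" "coe1 0 = 0" "coE0 0 = 0" "coE1 0 = 0" "coF0 0 = 0" "coF1 0 = 0" "coC0 0 = 0" "coC1 0 = 0"
  by (simp_all add: co_defs to_model_simps model_defs)

lemma co_one [simp]:
  "coe0 1 = 1" "coe1 1 = 1" "coE0 1 = 0" "coE1 1 = 0" "coF0 1 = 0" "coF1 1 = 0" "coC0 1 = 0" "coC1 1 = 0"
  by (simp_all add: co_defs to_model_simps model_defs)

lemma co_add [simp]:
  "coe0 (x + y) = coe0 x + coe0 y" "coe1 (x + y) = coe1 x + coe1 y"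
  "coE0 (x + y) = coE0 x + coE0 y" "coE1 (x + y) = coE1 x + coE1 y"
  "coF0 (x + y) = coF0 x + coF0 y" "coF1 (x + y) = coF1 x + coF1 y"
  "coC0 (x + y) = coC0 x + coC0 y" "coC1 (x + y) = coC1 x + coC1 y"
  by (simp_all add: co_defs to_model_simps model_defs)

lemma co_diff [simp]:
  "coe0 (x - y) = coe0 x - coe0 y" "coe1 (x - y) = coe1 x - coe1 y"
  "coE0 (x - y) = coE0 x - coE0 y" "coE1 (x - y) = coE1 x - coE1 y"
  "coF0 (x - y) = coF0 x - coF0 y" "coF1 (x - y) = coF1 x - coF1 y"
  "coC0 (x - y) = coC0 x - coC0 y" "coC1 (x - y) = coC1 x - coC1 y"
  by (simp_all add: co_defs to_model_simps model_defs)

lemma co_uminus [simp]: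
  "coe0 (- x) = - coe0 x" "coe1 (- x) = - coe1 x" "coE0 (- x) = - coE0 x" "coE1 (- x) = - coE1 x"
  "coF0 (- x) = - coF0 x" "coF1 (- x) = - coF1 x" "coC0 (- x) = - coC0 x" "coC1 (- x) = - coC1 x"
  by (simp_all add: co_defs to_model_simps model_defs)

lemma co_mult [simp]:
  "coe0 (x * y) = coe0 x * coe0 y"
  "coe1 (x * y) = coe1 x * coe1 y"
  "coE0 (x * y) = coe0 x * coE0 y + coE0 x * coe1 y"
  "coE1 (x * y) = coe1 x * coE1 y + coE1 x * coe0 y"
  "coF0 (x * y) = coe0 x * coF0 y + coF0 x * coe1 y"
  "coF1 (x * y) = coe1 x * coF1 y + coF1 x * coe0 y"
  "coC0 (x * y) = coe0 x * coC0 y + coC0 x * coe0 y + coE0 x * coF1 y + coF0 x * coE1 y"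
  "coC1 (x * y) = coe1 x * coC1 y + coC1 x * coe1 y + coE1 x * coF0 y + coF1 x * coE0 y"
  by (simp_all add: co_defs to_model_simps model_defs)

lemma co_scale [simp]:
  "coe0 (c *\<^sub>H x) = c * coe0 x" "coe1 (c *\<^sub>H x) = c * coe1 x"
  "coE0 (c *\<^sub>H x) = c * coE0 x" "coE1 (c *\<^sub>H x) = c * coE1 x"
  "coF0 (c *\<^sub>H x) = c * coF0 x" "coF1 (c *\<^sub>H x) = c * coF1 x"
  "coC0 (c *\<^sub>H x) = c * coC0 x" "coC1 (c *\<^sub>H x) = c * coC1 x"
  by (simp_all add: co_defs to_model_simps model_defs scaleH_def model_scalar_def)

lemma co_gen [simp]:
  "coe0 genK = 1" "coe1 genK = -1" "coE0 genK = 0" "coE1 genK = 0"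
  "coF0 genK = 0" "coF1 genK = 0" "coC0 genK = 0" "coC1 genK = 0"
  "coe0 genE = 0" "coe1 genE = 0" "coE0 genE = 1" "coE1 genE = 1"
  "coF0 genE = 0" "coF1 genE = 0" "coC0 genE = 0" "coC1 genE = 0"
  "coe0 genF = 0" "coe1 genF = 0" "coE0 genF = 0" "coE1 genF = 0"
  "coF0 genF = 1" "coF1 genF = 1" "coC0 genF = 0" "coC1 genF = 0"
  by (simp_all add: co_defs to_model_simps)

lemma co_basis [simp]:
  "coe0 e\<^sub>0 = 1" "coe1 e\<^sub>0 = 0" "coE0 e\<^sub>0 = 0" "coE1 e\<^sub>0 = 0" "coF0 e\<^sub>0 = 0" "coF1 e\<^sub>0 = 0" "coC0 e\<^sub>0 = 0" "coC1 e\<^sub>0 = 0"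
  "coe0 e\<^sub>1 = 0" "coe1 e\<^sub>1 = 1" "coE0 e\<^sub>1 = 0" "coE1 e\<^sub>1 = 0" "coF0 e\<^sub>1 = 0" "coF1 e\<^sub>1 = 0" "coC0 e\<^sub>1 = 0" "coC1 e\<^sub>1 = 0"
  "coe0 E\<^sub>0 = 0" "coe1 E\<^sub>0 = 0" "coE0 E\<^sub>0 = 1" "coE1 E\<^sub>0 = 0" "coF0 E\<^sub>0 = 0" "coF1 E\<^sub>0 = 0" "coC0 E\<^sub>0 = 0" "coC1 E\<^sub>0 = 0"
  "coe0 E\<^sub>1 = 0" "coe1 E\<^sub>1 = 0" "coE0 E\<^sub>1 = 0" "coE1 E\<^sub>1 = 1" "coF0 E\<^sub>1 = 0" "coF1 E\<^sub>1 = 0" "coC0 E\<^sub>1 = 0" "coC1 E\<^sub>1 = 0"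
  "coe0 F\<^sub>0 = 0" "coe1 F\<^sub>0 = 0" "coE0 F\<^sub>0 = 0" "coE1 F\<^sub>0 = 0" "coF0 F\<^sub>0 = 1" "coF1 F\<^sub>0 = 0" "coC0 F\<^sub>0 = 0" "coC1 F\<^sub>0 = 0"
  "coe0 F\<^sub>1 = 0" "coe1 F\<^sub>1 = 0" "coE0 F\<^sub>1 = 0" "coE1 F\<^sub>1 = 0" "coF0 F\<^sub>1 = 0" "coF1 F\<^sub>1 = 1" "coC0 F\<^sub>1 = 0" "coC1 F\<^sub>1 = 0"
  "coe0 C\<^sub>0 = 0" "coe1 C\<^sub>0 = 0" "coE0 C\<^sub>0 = 0" "coE1 C\<^sub>0 = 0" "coF0 C\<^sub>0 = 0" "coF1 C\<^sub>0 = 0" "coC0 C\<^sub>0 = 1" "coC1 C\<^sub>0 = 0"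
  "coe0 C\<^sub>1 = 0" "coe1 C\<^sub>1 = 0" "coE0 C\<^sub>1 = 0" "coE1 C\<^sub>1 = 0" "coF0 C\<^sub>1 = 0" "coF1 C\<^sub>1 = 0" "coC0 C\<^sub>1 = 0" "coC1 C\<^sub>1 = 1"
  by (simp_all add: basis_defs)

section \<open>The eight elements span the algebra\<close>

lemma h1i_relations:
  "genK * genE = - (genE * genK)" "genK * genF = - (genF * genK)" "genF * genE = genE * genF"
  "genE * genE = 0" "genF * genF = 0" "genK * genK = 1"
proof -
  have "genK * genE + genE * genK = 0" by transfer (auto simp: h1i_rel_def relators_def Let_def ideal_generated_def)
  then show "genK * genE = - (genE * genK)" by (simp add: eq_neg_iff_add_eq_0)
  have "genK * genF + genF * genK = 0" by transfer (auto simp: h1i_rel_def relators_def Let_def ideal_generated_def)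
  then show "genK * genF = - (genF * genK)" by (simp add: eq_neg_iff_add_eq_0)
  have "genE * genF - genF * genE = 0" by transfer (auto simp: h1i_rel_def relators_def Let_def ideal_generated_def)
  then show "genF * genE = genE * genF" by simp
  have "genK * genK - 1 = 0" by transfer (auto simp: h1i_rel_def relators_def Let_def ideal_generated_def)
  then show "genK * genK = 1" by simp
  show "genE * genE = 0" by transfer (auto simp: h1i_rel_def relators_def Let_def ideal_generated_def)
  show "genF * genF = 0" by transfer (auto simp: h1i_rel_def relators_def Let_def ideal_generated_def)
qed

text \<open>Scalars are multiples of the empty word, hence central; so the ring is an algebra for
  \<open>scaleH\<close>.\<close>

lemma of_cplx_commute: "x * of_cplx c = of_cplx c * x"
proof transfer
  fix x :: free_algebra and c
  have "x * Poly_Mapping.single 0 c = Poly_Mapping.single 0 c * x"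
    by (induction x rule: free_algebra_induct)
      (simp_all add: distrib_left distrib_right mult_single mult.commute)
  then show "h1i_rel (x * Poly_Mapping.single 0 c) (Poly_Mapping.single 0 c * x)"
    by (simp add: h1i_rel_refl)
qed

lemma scaleH_mult: "x * (c *\<^sub>H y) = c *\<^sub>H (x * y)" "(c *\<^sub>H x) * y = c *\<^sub>H (x * y)"
  by (simp_all add: scaleH_def mult.assoc flip: of_cplx_commute)

text \<open>\<open>E\<close> and \<open>F\<close> anticommute with \<open>K\<close>, so moving them
  past an idempotent changes the sign of \<open>K\<close> in it and exchanges
  \<open>e\<^sub>0\<close> with \<open>e\<^sub>1\<close>.\<close>

lemma gen_commute_idempotents:
  "genK * e\<^sub>0 = e\<^sub>0" "genK * e\<^sub>1 = - e\<^sub>1"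
  "genE * e\<^sub>0 = e\<^sub>1 * genE" "genE * e\<^sub>1 = e\<^sub>0 * genE"
  "genF * e\<^sub>0 = e\<^sub>1 * genF" "genF * e\<^sub>1 = e\<^sub>0 * genF"
  by (simp_all add: e\<^sub>0_def e\<^sub>1_def scaleH_mult ring_distribs h1i_relations H.scale_minus_right[symmetric])

lemma gen_mult_basis:
  "genK * e\<^sub>0 = e\<^sub>0" "genK * e\<^sub>1 = - e\<^sub>1" "genK * E\<^sub>0 = E\<^sub>0" "genK * E\<^sub>1 = - E\<^sub>1"
  "genK * F\<^sub>0 = F\<^sub>0" "genK * F\<^sub>1 = - F\<^sub>1" "genK * C\<^sub>0 = C\<^sub>0" "genK * C\<^sub>1 = - C\<^sub>1"
  "genE * e\<^sub>0 = E\<^sub>1" "genE * e\<^sub>1 = E\<^sub>0" "genE * E\<^sub>0 = 0" "genE * E\<^sub>1 = 0"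
  "genE * F\<^sub>0 = C\<^sub>1" "genE * F\<^sub>1 = C\<^sub>0" "genE * C\<^sub>0 = 0" "genE * C\<^sub>1 = 0"
  "genF * e\<^sub>0 = F\<^sub>1" "genF * e\<^sub>1 = F\<^sub>0" "genF * E\<^sub>0 = C\<^sub>1" "genF * E\<^sub>1 = C\<^sub>0"
  "genF * F\<^sub>0 = 0" "genF * F\<^sub>1 = 0" "genF * C\<^sub>0 = 0" "genF * C\<^sub>1 = 0"
proof -
  note assoc = mult.assoc[of genE genE, symmetric] mult.assoc[of genF genF, symmetric]
    mult.assoc[of genF genE, symmetric]
  \<comment> \<open>The relations are restated with a trailing factor, here and in
    \<open>left\<close>, so that they rewrite right-nested products.\<close>
  have sq: "genE * (genE * x) = 0" "genF * (genF * x) = 0"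
    "genF * (genE * x) = genE * (genF * x)" for x
    by (simp_all add: assoc h1i_relations) (simp add: mult.assoc)
  have left: "genK * (e\<^sub>0 * x) = e\<^sub>0 * x" "genK * (e\<^sub>1 * x) = - (e\<^sub>1 * x)"
    "genE * (e\<^sub>0 * x) = e\<^sub>1 * (genE * x)" "genE * (e\<^sub>1 * x) = e\<^sub>0 * (genE * x)"
    "genF * (e\<^sub>0 * x) = e\<^sub>1 * (genF * x)" "genF * (e\<^sub>1 * x) = e\<^sub>0 * (genF * x)" for x
    by (metis gen_commute_idempotents mult.assoc mult_minus_left)+
  show "genK * e\<^sub>0 = e\<^sub>0" "genK * e\<^sub>1 = - e\<^sub>1" "genK * E\<^sub>0 = E\<^sub>0" "genK * E\<^sub>1 = - E\<^sub>1"
    "genK * F\<^sub>0 = F\<^sub>0" "genK * F\<^sub>1 = - F\<^sub>1" "genK * C\<^sub>0 = C\<^sub>0" "genK * C\<^sub>1 = - C\<^sub>1"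
    "genE * e\<^sub>0 = E\<^sub>1" "genE * e\<^sub>1 = E\<^sub>0" "genE * E\<^sub>0 = 0" "genE * E\<^sub>1 = 0"
    "genE * F\<^sub>0 = C\<^sub>1" "genE * F\<^sub>1 = C\<^sub>0" "genE * C\<^sub>0 = 0" "genE * C\<^sub>1 = 0"
    "genF * e\<^sub>0 = F\<^sub>1" "genF * e\<^sub>1 = F\<^sub>0" "genF * E\<^sub>0 = C\<^sub>1" "genF * E\<^sub>1 = C\<^sub>0"
    "genF * F\<^sub>0 = 0" "genF * F\<^sub>1 = 0" "genF * C\<^sub>0 = 0" "genF * C\<^sub>1 = 0"
    unfolding E\<^sub>0_def E\<^sub>1_def F\<^sub>0_def F\<^sub>1_def C\<^sub>0_def C\<^sub>1_def mult.assoc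
    by (simp_all add: gen_commute_idempotents left sq h1i_relations)
qed

definition comb :: "complex \<Rightarrow> complex \<Rightarrow> complex \<Rightarrow> complex \<Rightarrow> complex \<Rightarrow> complex \<Rightarrow> complex \<Rightarrow> complex \<Rightarrow> h1i" where
  "comb a b c d e f g h = a *\<^sub>H e\<^sub>0 + b *\<^sub>H e\<^sub>1 + c *\<^sub>H E\<^sub>0 + d *\<^sub>H E\<^sub>1
     + e *\<^sub>H F\<^sub>0 + f *\<^sub>H F\<^sub>1 + g *\<^sub>H C\<^sub>0 + h *\<^sub>H C\<^sub>1"

lemma co_comb [simp]:
  "coe0 (comb a b c d e f g h) = a" "coe1 (comb a b c d e f g h) = b"
  "coE0 (comb a b c d e f g h) = c" "coE1 (comb a b c d e f g h) = d"
  "coF0 (comb a b c d e f g h) = e" "coF1 (comb a b c d e f g h) = f"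
  "coC0 (comb a b c d e f g h) = g" "coC1 (comb a b c d e f g h) = h"
  by (simp_all add: comb_def)

lemma comb_add:
  "comb a b c d e f g h + comb a' b' c' d' e' f' g' h' =
    comb (a + a') (b + b') (c + c') (d + d') (e + e') (f + f') (g + g') (h + h')"
  by (simp add: comb_def H.scale_left_distrib)

lemma comb_scale:
  "k *\<^sub>H comb a b c d e f g h = comb (k * a) (k * b) (k * c) (k * d) (k * e) (k * f) (k * g) (k * h)"
  by (simp add: comb_def H.scale_right_distrib)

lemma gen_mult_comb:
  "genK * comb a b c d e f g h = comb a (-b) c (-d) e (-f) g (-h)"
  "genE * comb a b c d e f g h = comb 0 0 b a 0 0 f e"
  "genF * comb a b c d e f g h = comb 0 0 0 0 b a d c"
  by (simp_all add: comb_def distrib_left scaleH_mult gen_mult_basis)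

text \<open>The span of the eight elements contains 1 and is stable under left multiplication by the
  generators. Hence it contains every word, and words span the free algebra.\<close>

lemma ex_comb: "\<exists>a b c d e f g h. x = comb a b c d e f g h"
proof -
  define T where "T = {x. \<exists>a b c d e f g h. x = comb a b c d e f g h}"
  have add: "x + y \<in> T" if "x \<in> T" "y \<in> T" for x y
    using that unfolding T_def by (blast intro: comb_add)
  have scale: "k *\<^sub>H x \<in> T" if "x \<in> T" for k x
    using that unfolding T_def by (blast intro: comb_scale)
  have gens: "genK * x \<in> T" "genE * x \<in> T" "genF * x \<in> T" if "x \<in> T" for x
    using that unfolding T_def by (blast intro: gen_mult_comb)+
  have one: "1 \<in> T"
  proof -
    have "e\<^sub>0 + e\<^sub>1 = (1/2) *\<^sub>H 1 + (1/2) *\<^sub>H 1"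
      by (simp add: e\<^sub>0_def e\<^sub>1_def flip: H.scale_right_distrib)
    also have "\<dots> = 1"
      by (simp flip: H.scale_left_distrib)
    finally have "1 = e\<^sub>0 + e\<^sub>1" by simp
    also have "\<dots> = comb 1 1 0 0 0 0 0 0" by (simp add: comb_def)
    finally show ?thesis unfolding T_def by blast
  qed
  \<comment> \<open>A word grows by a letter on its left, so stability under left multiplication
    suffices.\<close>
  have word: "abs_h1i (Poly_Mapping.single (Word w) 1) \<in> T" for w
  proof (induction w)
    case Nil
    have "abs_h1i (Poly_Mapping.single (Word []) 1) = 1"
      by (simp add: one_h1i.abs_eq flip: zero_word_def)
    then show ?case using one by simp
  next
    case (Cons g w)
    have "Poly_Mapping.single (Word (g # w)) 1 = free_gen g * Poly_Mapping.single (Word w) 1"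
      by (simp add: free_gen_def mult_single)
    then have "abs_h1i (Poly_Mapping.single (Word (g # w)) 1)
        = abs_h1i (free_gen g) * abs_h1i (Poly_Mapping.single (Word w) 1)"
      by (simp add: times_h1i.abs_eq)
    then show ?case using gens[OF Cons] by (cases g) (simp_all add: genK_def genE_def genF_def)
  qed
  have "abs_h1i y \<in> T" for y
  proof (induction y rule: free_algebra_induct)
    case zero
    show ?case using scale[OF one, of 0] by (simp add: zero_h1i.abs_eq)
  next
    case (add x w c)
    have "Poly_Mapping.single w c = Poly_Mapping.single 0 c * Poly_Mapping.single w 1"
      by (simp add: mult_single)
    then have "abs_h1i (Poly_Mapping.single w c) = c *\<^sub>H abs_h1i (Poly_Mapping.single w 1)"
      by (simp add: scaleH_def of_cplx.abs_eq times_h1i.abs_eq)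
    then have "abs_h1i (Poly_Mapping.single w c) \<in> T"
      using scale[OF word] by (cases w) simp
    with add show ?case by (simp add: \<open>\<And>y x. \<lbrakk>x \<in> T; y \<in> T\<rbrakk> \<Longrightarrow> x + y \<in> T\<close> flip: plus_h1i.abs_eq)
  qed
  then have "x \<in> T" by (induction x rule: h1i.abs_induct)
  then show ?thesis by (simp add: T_def)
qed

text \<open>Spanning provides some coefficients, and the model recovers them from the element;
  together they give the basis.\<close>

lemma comb_co: "comb (coe0 x) (coe1 x) (coE0 x) (coE1 x) (coF0 x) (coF1 x) (coC0 x) (coC1 x) = x"
  using ex_comb[of x] by auto

text \<open>With the simp rules for coordinates, this turns an identity in the algebra into eight
  equations between complex numbers, which is how most later computations run.\<close>

lemma h1i_eq_iff:
  "x = y \<longleftrightarrow> coe0 x = coe0 y \<and> coe1 x = coe1 y \<and> coE0 x = coE0 y \<and> coE1 x = coE1 y \<and>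
    coF0 x = coF0 y \<and> coF1 x = coF1 y \<and> coC0 x = coC0 y \<and> coC1 x = coC1 y"
  by (metis comb_co)

section \<open>Distinguished subspaces\<close>

lemma h1i_expand:
  "x = coe0 x *\<^sub>H e\<^sub>0 + coe1 x *\<^sub>H e\<^sub>1 + coE0 x *\<^sub>H E\<^sub>0 + coE1 x *\<^sub>H E\<^sub>1
    + coF0 x *\<^sub>H F\<^sub>0 + coF1 x *\<^sub>H F\<^sub>1 + coC0 x *\<^sub>H C\<^sub>0 + coC1 x *\<^sub>H C\<^sub>1"
  by (simp add: h1i_eq_iff)

text \<open>\<open>coe0\<close> and \<open>coe1\<close> are multiplicative, so they vanish on
  nilpotent elements. Conversely their common kernel is an ideal in which every cube is
  zero.\<close>

lemma nilradical_iff: "x \<in> N_H \<longleftrightarrow> coe0 x = 0 \<and> coe1 x = 0"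
proof
  assume "x \<in> N_H"
  then obtain n where n: "x ^ n = 0" unfolding nilradical_def by blast
  have "coe0 (x ^ m) = coe0 x ^ m" "coe1 (x ^ m) = coe1 x ^ m" for m by (induction m) simp_all
  from this[of n] show "coe0 x = 0 \<and> coe1 x = 0" using n by simp
next
  assume x: "coe0 x = 0 \<and> coe1 x = 0"
  define I where "I = {x. coe0 x = 0 \<and> coe1 x = 0}"
  have "two_sided_ideal I" by (simp add: I_def two_sided_ideal_def)
  moreover have "y ^ 3 = 0" if "y \<in> I" for y
    using that by (simp add: I_def power3_eq_cube h1i_eq_iff)
  ultimately show "x \<in> N_H" using x unfolding nilradical_def I_def by blast
qed

text \<open>\<open>coC0 + coC1\<close> behaves as a trace: it vanishes on commutators. Conversely
  each odd basis element is its own commutator with an idempotent, and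
  \<open>C\<^sub>0 - C\<^sub>1\<close> is the commutator of \<open>E\<^sub>0\<close> and
  \<open>F\<^sub>1\<close>.\<close>

lemma commutator_space_iff:
  "x \<in> commutator_space \<longleftrightarrow> coe0 x = 0 \<and> coe1 x = 0 \<and> coC0 x + coC1 x = 0"
proof
  assume "x \<in> commutator_space"
  moreover have "commutator_space \<subseteq> {x. coe0 x = 0 \<and> coe1 x = 0 \<and> coC0 x + coC1 x = 0}"
    unfolding commutator_space_def
  proof (rule H.span_minimal)
    have "coe0 (y * z - z * y) = 0 \<and> coe1 (y * z - z * y) = 0 \<and>
        coC0 (y * z - z * y) + coC1 (y * z - z * y) = 0" for y z
      by (simp add: algebra_simps)
    then show "{y * z - z * y |y z. True} \<subseteq> {x. coe0 x = 0 \<and> coe1 x = 0 \<and> coC0 x + coC1 x = 0}"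
      by blast
    have "c * coC0 x + c * coC1 x = 0" if "coC0 x + coC1 x = 0" for c x
      using that by (simp flip: distrib_left)
    moreover have "coC0 x + coC0 y + (coC1 x + coC1 y) = 0"
      if "coC0 x + coC1 x = 0" "coC0 y + coC1 y = 0" for x y
      using that by algebra
    ultimately show "H.subspace {x. coe0 x = 0 \<and> coe1 x = 0 \<and> coC0 x + coC1 x = 0}"
      by (auto intro!: H.subspaceI)
  qed
  ultimately show "coe0 x = 0 \<and> coe1 x = 0 \<and> coC0 x + coC1 x = 0" by blast
next
  assume x: "coe0 x = 0 \<and> coe1 x = 0 \<and> coC0 x + coC1 x = 0"
  have comm: "y * z - z * y \<in> commutator_space" for y z
    unfolding commutator_space_def by (rule H.span_base) blast
  have "x = coE0 x *\<^sub>H (e\<^sub>0 * E\<^sub>0 - E\<^sub>0 * e\<^sub>0) + coE1 x *\<^sub>H (e\<^sub>1 * E\<^sub>1 - E\<^sub>1 * e\<^sub>1)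
      + coF0 x *\<^sub>H (e\<^sub>0 * F\<^sub>0 - F\<^sub>0 * e\<^sub>0) + coF1 x *\<^sub>H (e\<^sub>1 * F\<^sub>1 - F\<^sub>1 * e\<^sub>1)
      + coC0 x *\<^sub>H (E\<^sub>0 * F\<^sub>1 - F\<^sub>1 * E\<^sub>0)"
    using x by (simp add: h1i_eq_iff eq_neg_iff_add_eq_0 add.commute)
  also have "\<dots> \<in> commutator_space"
    using comm unfolding commutator_space_def by (intro H.span_add H.span_scale)
  finally show "x \<in> commutator_space" .
qed

text \<open>The odd coordinates of a product involve the \<open>e\<close>-coordinates of a factor,
  which vanish on N. Conversely \<open>C\<^sub>0 = E\<^sub>0 * F\<^sub>1\<close> and
  \<open>C\<^sub>1 = E\<^sub>1 * F\<^sub>0\<close>.\<close>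

lemma N_H_squared_iff:
  "x \<in> N_H_squared \<longleftrightarrow> coe0 x = 0 \<and> coe1 x = 0 \<and> coE0 x = 0 \<and> coE1 x = 0 \<and> coF0 x = 0 \<and> coF1 x = 0"
  (is "_ \<longleftrightarrow> ?P x")
proof
  assume "x \<in> N_H_squared"
  moreover have "N_H_squared \<subseteq> Collect ?P"
    unfolding N_H_squared_def
    by (rule H.span_minimal) (auto intro!: H.subspaceI simp: nilradical_iff)
  ultimately show "?P x" by blast
next
  assume x: "?P x"
  have base: "y * z \<in> N_H_squared" if "y \<in> N_H" "z \<in> N_H" for y z
    unfolding N_H_squared_def by (rule H.span_base) (use that in blast)
  have "x = coC0 x *\<^sub>H (E\<^sub>0 * F\<^sub>1) + coC1 x *\<^sub>H (E\<^sub>1 * F\<^sub>0)"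
    using x by (simp add: h1i_eq_iff)
  also have "\<dots> \<in> N_H_squared"
    using base[of E\<^sub>0 F\<^sub>1] base[of E\<^sub>1 F\<^sub>0] unfolding N_H_squared_def
    by (intro H.span_add H.span_scale) (simp_all add: nilradical_iff)
  finally show "x \<in> N_H_squared" .
qed

section \<open>Linear maps and automorphisms\<close>

lemma linear_H_iff:
  "Vector_Spaces.linear scaleH scaleH f \<longleftrightarrow>
    (\<forall>x y. f (x + y) = f x + f y) \<and> (\<forall>c x. f (c *\<^sub>H x) = c *\<^sub>H f x)"
  by (simp add: Vector_Spaces.linear_iff H.vector_space_axioms)

lemma linear_H_expand:
  assumes "Vector_Spaces.linear scaleH scaleH f"
  shows "f x = coe0 x *\<^sub>H f e\<^sub>0 + coe1 x *\<^sub>H f e\<^sub>1 + coE0 x *\<^sub>H f E\<^sub>0 + coE1 x *\<^sub>H f E\<^sub>1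
    + coF0 x *\<^sub>H f F\<^sub>0 + coF1 x *\<^sub>H f F\<^sub>1 + coC0 x *\<^sub>H f C\<^sub>0 + coC1 x *\<^sub>H f C\<^sub>1"
  using assms by (subst h1i_expand) (simp only: linear_H_iff)

text \<open>The universal property of the basis, with the images listed in the order of
  \<open>is_type_I_def\<close> and \<open>is_type_II_def\<close> so that it applies to them after
  unfolding.\<close>

lemma ex1_linear_H:
  "\<exists>!f. Vector_Spaces.linear scaleH scaleH f \<and> f e\<^sub>0 = v\<^sub>0 \<and> f E\<^sub>0 = v\<^sub>1 \<and> f F\<^sub>0 = v\<^sub>2 \<and> f C\<^sub>0 = v\<^sub>3 \<and>
    f e\<^sub>1 = v\<^sub>4 \<and> f E\<^sub>1 = v\<^sub>5 \<and> f F\<^sub>1 = v\<^sub>6 \<and> f C\<^sub>1 = v\<^sub>7"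
  (is "\<exists>!f. ?P f")
proof (rule ex_ex1I)
  have "?P (\<lambda>x. coe0 x *\<^sub>H v\<^sub>0 + coe1 x *\<^sub>H v\<^sub>4 + coE0 x *\<^sub>H v\<^sub>1 + coE1 x *\<^sub>H v\<^sub>5
    + coF0 x *\<^sub>H v\<^sub>2 + coF1 x *\<^sub>H v\<^sub>6 + coC0 x *\<^sub>H v\<^sub>3 + coC1 x *\<^sub>H v\<^sub>7)"
    by (simp add: linear_H_iff H.scale_left_distrib H.scale_right_distrib)
  then show "\<exists>f. ?P f" by blast
  show "f = g" if "?P f" "?P g" for f g
    using that linear_H_expand[of f] linear_H_expand[of g] by (metis (no_types, lifting) ext)
qed

lemma Aut_H_iff:
  "\<phi> \<in> Aut_H \<longleftrightarrow> (\<forall>x y. \<phi> (x + y) = \<phi> x + \<phi> y) \<and> (\<forall>c x. \<phi> (c *\<^sub>H x) = c *\<^sub>H \<phi> x) \<and> bij \<phi> \<and>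
    \<phi> 1 = 1 \<and> (\<forall>x y. \<phi> (x * y) = \<phi> x * \<phi> y)"
  by (auto simp: Aut_H_def linear_H_iff)

lemma Aut_H_simps:
  assumes "\<phi> \<in> Aut_H"
  shows "\<phi> (x + y) = \<phi> x + \<phi> y" "\<phi> (c *\<^sub>H x) = c *\<^sub>H \<phi> x" "\<phi> 1 = 1" "\<phi> (x * y) = \<phi> x * \<phi> y"
    "\<phi> 0 = 0" "\<phi> (x - y) = \<phi> x - \<phi> y" "\<phi> (- x) = - \<phi> x"
proof -
  have add: "\<phi> (x + y) = \<phi> x + \<phi> y" for x y using assms by (simp add: Aut_H_iff)
  have zero: "\<phi> 0 = 0" using add[of 0 0] by simp
  have diff: "\<phi> (x - y) = \<phi> x - \<phi> y" for x y using add[of "x - y" y] by simp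
  show "\<phi> (x + y) = \<phi> x + \<phi> y" "\<phi> 0 = 0" "\<phi> (x - y) = \<phi> x - \<phi> y"
    by (rule add zero diff)+
  show "\<phi> (c *\<^sub>H x) = c *\<^sub>H \<phi> x" "\<phi> 1 = 1" "\<phi> (x * y) = \<phi> x * \<phi> y"
    using assms by (simp_all add: Aut_H_iff)
  show "\<phi> (- x) = - \<phi> x" using diff[of 0 x] zero by simp
qed

text \<open>The basis elements are polynomials in the generators.\<close>

lemma Aut_H_eqI:
  assumes "\<phi> \<in> Aut_H" "\<psi> \<in> Aut_H" "\<phi> genK = \<psi> genK" "\<phi> genE = \<psi> genE" "\<phi> genF = \<psi> genF"
  shows "\<phi> = \<psi>"
proof
  fix x
  show "\<phi> x = \<psi> x"
    by (subst (1 2) h1i_expand)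
      (simp add: basis_defs assms Aut_H_simps[OF assms(1)] Aut_H_simps[OF assms(2)])
qed

lemma Aut_H_comp: "\<phi> \<in> Aut_H \<Longrightarrow> \<psi> \<in> Aut_H \<Longrightarrow> \<phi> \<circ> \<psi> \<in> Aut_H"
  by (simp add: Aut_H_iff bij_comp)

lemma Aut_H_inv_into:
  assumes "\<phi> \<in> Aut_H"
  shows "inv_into UNIV \<phi> \<in> Aut_H"
proof -
  have "bij \<phi>" using assms by (simp add: Aut_H_iff)
  then have f: "\<phi> (inv_into UNIV \<phi> x) = x" and g: "inv_into UNIV \<phi> (\<phi> x) = x" for x
    by (simp_all add: bij_is_surj bij_is_inj surj_f_inv_f)
  have "inv_into UNIV \<phi> x = y \<longleftrightarrow> x = \<phi> y" for x y using f g by metis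
  then show ?thesis
    using \<open>bij \<phi>\<close> by (simp add: Aut_H_iff Aut_H_simps[OF assms] f bij_imp_bij_inv)
qed

section \<open>The flip and the exchange of \<open>E\<close> and \<open>F\<close>\<close>

lemma comb_flip:
  "comb (coe1 x) (coe0 x) (coE1 x) (coE0 x) (coF1 x) (coF0 x) (coC1 x) (coC0 x) = \<kappa> x"
  and flip_Aut_H: "\<kappa> \<in> Aut_H"
  and flip_gen: "\<kappa> genK = - genK" "\<kappa> genE = genE" "\<kappa> genF = genF"
proof -
  \<comment> \<open>An explicit candidate for the definite description, bijective because it is an
    involution; \<open>Aut_H_eqI\<close> gives uniqueness.\<close>
  define f where "f x = comb (coe1 x) (coe0 x) (coE1 x) (coE0 x) (coF1 x) (coF0 x) (coC1 x) (coC0 x)" for x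
  have "bij f" by (rule involuntory_imp_bij) (simp add: f_def h1i_eq_iff)
  then have f: "f \<in> Aut_H" "f genK = - genK" "f genE = genE" "f genF = genF"
    by (simp_all add: Aut_H_iff) (simp_all add: f_def h1i_eq_iff)
  then have "\<kappa> = f" unfolding flip_def by (intro the_equality) (auto intro: Aut_H_eqI)
  with f f_def show "comb (coe1 x) (coe0 x) (coE1 x) (coE0 x) (coF1 x) (coF0 x) (coC1 x) (coC0 x) = \<kappa> x"
    "\<kappa> \<in> Aut_H" "\<kappa> genK = - genK" "\<kappa> genE = genE" "\<kappa> genF = genF" by simp_all
qed

lemma co_flip [simp]:
  "coe0 (\<kappa> x) = coe1 x" "coe1 (\<kappa> x) = coe0 x" "coE0 (\<kappa> x) = coE1 x" "coE1 (\<kappa> x) = coE0 x"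
  "coF0 (\<kappa> x) = coF1 x" "coF1 (\<kappa> x) = coF0 x" "coC0 (\<kappa> x) = coC1 x" "coC1 (\<kappa> x) = coC0 x"
  by (simp_all flip: comb_flip)

lemma flip_basis:
  "\<kappa> e\<^sub>0 = e\<^sub>1" "\<kappa> e\<^sub>1 = e\<^sub>0" "\<kappa> E\<^sub>0 = E\<^sub>1" "\<kappa> E\<^sub>1 = E\<^sub>0"
  "\<kappa> F\<^sub>0 = F\<^sub>1" "\<kappa> F\<^sub>1 = F\<^sub>0" "\<kappa> C\<^sub>0 = C\<^sub>1" "\<kappa> C\<^sub>1 = C\<^sub>0"
  by (simp_all add: h1i_eq_iff)

lemma comb_swap_EF:
  "comb (coe0 x) (coe1 x) (coF0 x) (coF1 x) (coE0 x) (coE1 x) (coC0 x) (coC1 x) = \<epsilon> x"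
  and swap_EF_Aut_H: "\<epsilon> \<in> Aut_H"
  and swap_EF_gen: "\<epsilon> genK = genK" "\<epsilon> genE = genF" "\<epsilon> genF = genE"
proof -
  \<comment> \<open>The \<open>C\<close>-coordinates stay in place because \<open>E\<close> and
    \<open>F\<close> commute.\<close>
  define f where "f x = comb (coe0 x) (coe1 x) (coF0 x) (coF1 x) (coE0 x) (coE1 x) (coC0 x) (coC1 x)" for x
  have "bij f" by (rule involuntory_imp_bij) (simp add: f_def h1i_eq_iff)
  then have f: "f \<in> Aut_H" "f genK = genK" "f genE = genF" "f genF = genE"
    by (simp_all add: Aut_H_iff) (simp_all add: f_def h1i_eq_iff)
  then have "\<epsilon> = f" unfolding swap_EF_def by (intro the_equality) (auto intro: Aut_H_eqI)
  with f f_def show "comb (coe0 x) (coe1 x) (coF0 x) (coF1 x) (coE0 x) (coE1 x) (coC0 x) (coC1 x) = \<epsilon> x"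
    "\<epsilon> \<in> Aut_H" "\<epsilon> genK = genK" "\<epsilon> genE = genF" "\<epsilon> genF = genE" by simp_all
qed

lemma co_swap_EF [simp]:
  "coe0 (\<epsilon> x) = coe0 x" "coe1 (\<epsilon> x) = coe1 x" "coE0 (\<epsilon> x) = coF0 x" "coE1 (\<epsilon> x) = coF1 x"
  "coF0 (\<epsilon> x) = coE0 x" "coF1 (\<epsilon> x) = coE1 x" "coC0 (\<epsilon> x) = coC0 x" "coC1 (\<epsilon> x) = coC1 x"
  by (simp_all flip: comb_swap_EF)

lemma flip_flip: "\<kappa> \<circ> \<kappa> = id" and swap_EF_swap_EF: "\<epsilon> \<circ> \<epsilon> = id"
  by (simp_all add: fun_eq_iff h1i_eq_iff)

section \<open>The two types\<close>

text \<open>The coordinate form on which the later computations rest, with linearity visible from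
  the formulae. The images of \<open>e\<^sub>0\<close> and \<open>e\<^sub>1\<close> have opposite
  nilpotent parts, hence the factor \<open>coe0 x - coe1 x\<close>.\<close>

lemma is_type_I_iff:
  "is_type_I p \<phi> \<longleftrightarrow> constraints p \<and> (\<forall>x.
    coe0 (\<phi> x) = coe0 x \<and> coe1 (\<phi> x) = coe1 x \<and>
    coE0 (\<phi> x) = \<beta> p * (coe0 x - coe1 x) + \<mu>\<^sub>0 p * coE0 x + \<sigma>\<^sub>0 p * coF0 x \<and>
    coF0 (\<phi> x) = \<gamma> p * (coe0 x - coe1 x) + \<nu>\<^sub>0 p * coE0 x + \<tau>\<^sub>0 p * coF0 x \<and>
    coE1 (\<phi> x) = \<delta> p * (coe0 x - coe1 x) + \<mu>\<^sub>1 p * coE1 x + \<sigma>\<^sub>1 p * coF1 x \<and>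
    coF1 (\<phi> x) = \<eta> p * (coe0 x - coe1 x) + \<nu>\<^sub>1 p * coE1 x + \<tau>\<^sub>1 p * coF1 x \<and>
    coC1 (\<phi> x) = (\<beta> p * \<eta> p + \<gamma> p * \<delta> p) * (coe0 x - coe1 x)
      + (\<delta> p * \<nu>\<^sub>0 p + \<eta> p * \<mu>\<^sub>0 p) * coE0 x + (\<delta> p * \<tau>\<^sub>0 p + \<eta> p * \<sigma>\<^sub>0 p) * coF0 x
      + (\<beta> p * \<nu>\<^sub>1 p + \<gamma> p * \<mu>\<^sub>1 p) * coE1 x + (\<beta> p * \<tau>\<^sub>1 p + \<gamma> p * \<sigma>\<^sub>1 p) * coF1 x + lam p * coC1 x \<and>
    coC0 (\<phi> x) = - ((\<beta> p * \<eta> p + \<gamma> p * \<delta> p) * (coe0 x - coe1 x)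
      + (\<delta> p * \<nu>\<^sub>0 p + \<eta> p * \<mu>\<^sub>0 p) * coE0 x + (\<delta> p * \<tau>\<^sub>0 p + \<eta> p * \<sigma>\<^sub>0 p) * coF0 x
      + (\<beta> p * \<nu>\<^sub>1 p + \<gamma> p * \<mu>\<^sub>1 p) * coE1 x + (\<beta> p * \<tau>\<^sub>1 p + \<gamma> p * \<sigma>\<^sub>1 p) * coF1 x) + lam p * coC0 x)"
  (is "_ \<longleftrightarrow> constraints p \<and> (\<forall>x. ?R x)")
proof
  assume I: "is_type_I p \<phi>"
  show "constraints p \<and> (\<forall>x. ?R x)"
  proof (intro conjI[of "constraints p"] allI)
    show "constraints p" using I by (simp add: is_type_I_def)
    have lin: "Vector_Spaces.linear scaleH scaleH \<phi>" using I by (simp add: is_type_I_def)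
    show "?R x" for x
      by (simp only: linear_H_expand[OF lin, of x] I[unfolded is_type_I_def], simp add: algebra_simps)
  qed
next
  assume R: "constraints p \<and> (\<forall>x. ?R x)"
  note co = R[THEN conjunct2, rule_format]
  show "is_type_I p \<phi>"
    unfolding is_type_I_def linear_H_iff
    by (simp add: h1i_eq_iff co R[THEN conjunct1]) (simp add: algebra_simps)
qed

lemma ex1_type_I: "constraints p \<Longrightarrow> \<exists>!\<phi>. is_type_I p \<phi>"
  unfolding is_type_I_def by (simp add: ex1_linear_H)

lemma ex1_type_II: "constraints p \<Longrightarrow> \<exists>!\<phi>. is_type_II p \<phi>"
  unfolding is_type_II_def by (simp add: ex1_linear_H)

text \<open>Every parameter is a coordinate of the image of a basis element. This makes the
  description in \<open>aut_matrix\<close> well defined.\<close>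

lemma is_type_I_unique:
  assumes "is_type_I p \<phi>" "is_type_I q \<phi>"
  shows "p = q"
proof (rule aut_params.equality)
  note P = assms[unfolded is_type_I_iff, THEN conjunct2, rule_format]
  show "\<beta> p = \<beta> q" "\<gamma> p = \<gamma> q" "\<delta> p = \<delta> q" "\<eta> p = \<eta> q"
    using P(1)[of e\<^sub>0] P(2)[of e\<^sub>0] by simp_all
  show "lam p = lam q" using P(1)[of C\<^sub>0] P(2)[of C\<^sub>0] by simp
  show "\<mu>\<^sub>0 p = \<mu>\<^sub>0 q" "\<nu>\<^sub>0 p = \<nu>\<^sub>0 q" using P(1)[of E\<^sub>0] P(2)[of E\<^sub>0] by simp_all
  show "\<sigma>\<^sub>0 p = \<sigma>\<^sub>0 q" "\<tau>\<^sub>0 p = \<tau>\<^sub>0 q" using P(1)[of F\<^sub>0] P(2)[of F\<^sub>0] by simp_all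
  show "\<mu>\<^sub>1 p = \<mu>\<^sub>1 q" "\<nu>\<^sub>1 p = \<nu>\<^sub>1 q" using P(1)[of E\<^sub>1] P(2)[of E\<^sub>1] by simp_all
  show "\<sigma>\<^sub>1 p = \<sigma>\<^sub>1 q" "\<tau>\<^sub>1 p = \<tau>\<^sub>1 q" using P(1)[of F\<^sub>1] P(2)[of F\<^sub>1] by simp_all
qed simp

section \<open>Relations among the parameters\<close>

lemma constraints_iff:
  "constraints p \<longleftrightarrow>
    \<mu>\<^sub>0 p * \<nu>\<^sub>1 p + \<nu>\<^sub>0 p * \<mu>\<^sub>1 p = 0 \<and> \<sigma>\<^sub>0 p * \<tau>\<^sub>1 p + \<tau>\<^sub>0 p * \<sigma>\<^sub>1 p = 0 \<and>
    lam p = \<mu>\<^sub>0 p * \<tau>\<^sub>1 p + \<nu>\<^sub>0 p * \<sigma>\<^sub>1 p \<and> lam p = \<sigma>\<^sub>0 p * \<nu>\<^sub>1 p + \<tau>\<^sub>0 p * \<mu>\<^sub>1 p \<and>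
    \<mu>\<^sub>0 p * \<tau>\<^sub>0 p - \<nu>\<^sub>0 p * \<sigma>\<^sub>0 p \<noteq> 0 \<and> \<mu>\<^sub>1 p * \<tau>\<^sub>1 p - \<nu>\<^sub>1 p * \<sigma>\<^sub>1 p \<noteq> 0 \<and> lam p \<noteq> 0"
  by (simp add: constraints_def constr_i_def constr_ii_def constr_iii_a_def constr_iii_b_def
      constr_iv_def constr_v_def constr_vi_def)

text \<open>This is the determinant of \<open>M\<^sub>0 P M\<^sub>1\<^sup>t = \<lambda>P\<close>, where \<open>P = (0, 1; 1, 0)\<close>.\<close>

lemma lam_squared:
  assumes "\<mu>\<^sub>0 p * \<nu>\<^sub>1 p + \<nu>\<^sub>0 p * \<mu>\<^sub>1 p = 0" "\<sigma>\<^sub>0 p * \<tau>\<^sub>1 p + \<tau>\<^sub>0 p * \<sigma>\<^sub>1 p = 0"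
    "lam p = \<mu>\<^sub>0 p * \<tau>\<^sub>1 p + \<nu>\<^sub>0 p * \<sigma>\<^sub>1 p" "lam p = \<sigma>\<^sub>0 p * \<nu>\<^sub>1 p + \<tau>\<^sub>0 p * \<mu>\<^sub>1 p"
  shows "lam p * lam p = (\<mu>\<^sub>0 p * \<tau>\<^sub>0 p - \<nu>\<^sub>0 p * \<sigma>\<^sub>0 p) * (\<mu>\<^sub>1 p * \<tau>\<^sub>1 p - \<nu>\<^sub>1 p * \<sigma>\<^sub>1 p)"
  using assms by algebra

text \<open>By \<open>lam_squared\<close> the square of \<open>lam p\<close> is the product of the
  two determinants, so \<open>lam p \<noteq> 0\<close> yields (iv) and (v).\<close>

lemma constraintsI:
  assumes "\<mu>\<^sub>0 p * \<nu>\<^sub>1 p + \<nu>\<^sub>0 p * \<mu>\<^sub>1 p = 0" "\<sigma>\<^sub>0 p * \<tau>\<^sub>1 p + \<tau>\<^sub>0 p * \<sigma>\<^sub>1 p = 0"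
    "lam p = \<mu>\<^sub>0 p * \<tau>\<^sub>1 p + \<nu>\<^sub>0 p * \<sigma>\<^sub>1 p" "lam p = \<sigma>\<^sub>0 p * \<nu>\<^sub>1 p + \<tau>\<^sub>0 p * \<mu>\<^sub>1 p" "lam p \<noteq> 0"
  shows "constraints p"
  unfolding constraints_iff using assms lam_squared[OF assms(1-4)] by (metis mult_eq_0_iff)

text \<open>Solving \<open>M\<^sub>0 P M\<^sub>1\<^sup>t = \<lambda>P\<close> for \<open>M\<^sub>1\<close> expresses its entries by those of \<open>M\<^sub>0\<close>.\<close>

lemma constraints_imp_relations:
  assumes "constraints p"
  shows "relation_\<nu>\<tau> p" "relation_\<mu>\<sigma> p"
proof -
  note c = assms[unfolded constraints_iff]
  define D where "D = \<mu>\<^sub>0 p * \<tau>\<^sub>0 p - \<nu>\<^sub>0 p * \<sigma>\<^sub>0 p"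
  have D: "D \<noteq> 0" using c by (simp add: D_def)
  have "D * \<mu>\<^sub>1 p = lam p * \<mu>\<^sub>0 p" "D * \<sigma>\<^sub>1 p = - (lam p * \<sigma>\<^sub>0 p)"
    "D * \<nu>\<^sub>1 p = - (lam p * \<nu>\<^sub>0 p)" "D * \<tau>\<^sub>1 p = lam p * \<tau>\<^sub>0 p"
    using c unfolding D_def by algebra+
  then have "D * (\<nu>\<^sub>0 p * \<tau>\<^sub>1 p + \<tau>\<^sub>0 p * \<nu>\<^sub>1 p) = 0" "D * (\<mu>\<^sub>0 p * \<sigma>\<^sub>1 p + \<sigma>\<^sub>0 p * \<mu>\<^sub>1 p) = 0"
    by algebra+
  with D show "relation_\<nu>\<tau> p" "relation_\<mu>\<sigma> p"
    by (simp_all add: relation_\<nu>\<tau>_def relation_\<mu>\<sigma>_def)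
qed

lemma cramer_ex:
  fixes a b c d r s :: complex
  assumes "a * d - b * c \<noteq> 0"
  obtains u v where "a * u + b * v = r" "c * u + d * v = s"
proof
  show "a * ((d * r - b * s) / (a * d - b * c)) + b * ((a * s - c * r) / (a * d - b * c)) = r"
    "c * ((d * r - b * s) / (a * d - b * c)) + d * ((a * s - c * r) / (a * d - b * c)) = s"
    using assms by (simp_all add: divide_simps) (simp_all add: algebra_simps)
qed

lemma cramer_unique:
  fixes a b c d u v :: complex
  assumes "a * d - b * c \<noteq> 0" "a * u + b * v = 0" "c * u + d * v = 0"
  shows "u = 0" "v = 0"
proof -
  have "(a * d - b * c) * u = 0" "(a * d - b * c) * v = 0"
    using assms(2,3) by algebra+
  with assms(1) show "u = 0" "v = 0" by simp_all
qed

section \<open>Type I maps and automorphisms fixing \<open>e\<^sub>0\<close> modulo N\<close>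

text \<open>Ordered by \<open>e\<close>-, odd and \<open>C\<close>-coordinates, the map is block
  triangular. Its diagonal blocks are an identity, two 2 by 2 matrices and multiplication by
  \<open>lam p\<close>, and (iv)-(vi) make them invertible.\<close>

lemma type_I_Aut_H:
  assumes "is_type_I p \<phi>"
  shows "\<phi> \<in> Aut_H"
proof -
  note co = assms[unfolded is_type_I_iff, THEN conjunct2, rule_format]
  note c = assms[unfolded is_type_I_iff, THEN conjunct1, unfolded constraints_iff]
  have add: "\<phi> (x + y) = \<phi> x + \<phi> y" and scale: "\<phi> (k *\<^sub>H x) = k *\<^sub>H \<phi> x" for x y k
    using assms by (simp_all add: is_type_I_def linear_H_iff)
  have one: "\<phi> 1 = 1" by (simp add: h1i_eq_iff co)
  have mult: "\<phi> (x * y) = \<phi> x * \<phi> y" for x y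
  proof -
    \<comment> \<open>Here (i)-(iii) enter: they say that the pairing of odd elements of index 0
      with those of index 1 is multiplied by \<open>lam p\<close>.\<close>
    have "coC0 (\<phi> (x * y)) = coC0 (\<phi> x * \<phi> y)" "coC1 (\<phi> (x * y)) = coC1 (\<phi> x * \<phi> y)"
      by (simp_all only: co co_mult) (use c in algebra)+
    moreover have "coE0 (\<phi> (x * y)) = coE0 (\<phi> x * \<phi> y)" "coE1 (\<phi> (x * y)) = coE1 (\<phi> x * \<phi> y)"
      "coF0 (\<phi> (x * y)) = coF0 (\<phi> x * \<phi> y)" "coF1 (\<phi> (x * y)) = coF1 (\<phi> x * \<phi> y)"
      by (simp_all add: co algebra_simps)
    ultimately show ?thesis by (simp add: h1i_eq_iff co del: co_mult(3-))
  qed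
  have "inj \<phi>"
  proof (rule injI)
    fix x y assume "\<phi> x = \<phi> y"
    define z where "z = x - y"
    have "\<phi> z + \<phi> y = \<phi> x" by (simp add: z_def flip: add)
    then have z: "\<phi> z = 0" using \<open>\<phi> x = \<phi> y\<close> by simp
    have e: "coe0 z = 0" "coe1 z = 0" using co[of z] z by simp_all
    have "\<mu>\<^sub>0 p * coE0 z + \<sigma>\<^sub>0 p * coF0 z = 0" "\<nu>\<^sub>0 p * coE0 z + \<tau>\<^sub>0 p * coF0 z = 0"
      "\<mu>\<^sub>1 p * coE1 z + \<sigma>\<^sub>1 p * coF1 z = 0" "\<nu>\<^sub>1 p * coE1 z + \<tau>\<^sub>1 p * coF1 z = 0"
      using co[of z] z e by simp_all
    moreover have "\<mu>\<^sub>0 p * \<tau>\<^sub>0 p - \<sigma>\<^sub>0 p * \<nu>\<^sub>0 p \<noteq> 0" "\<mu>\<^sub>1 p * \<tau>\<^sub>1 p - \<sigma>\<^sub>1 p * \<nu>\<^sub>1 p \<noteq> 0"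
      using c by (simp_all add: mult.commute)
    ultimately have EF: "coE0 z = 0" "coF0 z = 0" "coE1 z = 0" "coF1 z = 0"
      using cramer_unique by blast+
    have "lam p \<noteq> 0" using c by blast
    then have "coC0 z = 0" "coC1 z = 0" using co[of z] z e EF by simp_all
    with e EF have "z = 0" by (simp add: h1i_eq_iff)
    then show "x = y" by (simp add: z_def)
  qed
  moreover have "surj \<phi>"
  proof (rule surjI)
    fix y
    define d where "d = coe0 y - coe1 y"
    have det: "\<mu>\<^sub>0 p * \<tau>\<^sub>0 p - \<sigma>\<^sub>0 p * \<nu>\<^sub>0 p \<noteq> 0" "\<mu>\<^sub>1 p * \<tau>\<^sub>1 p - \<sigma>\<^sub>1 p * \<nu>\<^sub>1 p \<noteq> 0"
      using c by (simp_all add: mult.commute)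
    obtain u v where uv: "\<mu>\<^sub>0 p * u + \<sigma>\<^sub>0 p * v = coE0 y - \<beta> p * d" "\<nu>\<^sub>0 p * u + \<tau>\<^sub>0 p * v = coF0 y - \<gamma> p * d"
      using cramer_ex[OF det(1)] by blast
    obtain u' v' where uv': "\<mu>\<^sub>1 p * u' + \<sigma>\<^sub>1 p * v' = coE1 y - \<delta> p * d" "\<nu>\<^sub>1 p * u' + \<tau>\<^sub>1 p * v' = coF1 y - \<eta> p * d"
      using cramer_ex[OF det(2)] by blast
    \<comment> \<open>The amount that the \<open>e\<close>- and odd coordinates of the preimage
      contribute to \<open>coC1\<close>; \<open>coC0\<close> receives its negative. The
      \<open>C\<close>-coordinates of \<open>x\<close> compensate for it.\<close>
    define s where "s = (\<beta> p * \<eta> p + \<gamma> p * \<delta> p) * d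
      + (\<delta> p * \<nu>\<^sub>0 p + \<eta> p * \<mu>\<^sub>0 p) * u + (\<delta> p * \<tau>\<^sub>0 p + \<eta> p * \<sigma>\<^sub>0 p) * v
      + (\<beta> p * \<nu>\<^sub>1 p + \<gamma> p * \<mu>\<^sub>1 p) * u' + (\<beta> p * \<tau>\<^sub>1 p + \<gamma> p * \<sigma>\<^sub>1 p) * v'"
    define x where "x = comb (coe0 y) (coe1 y) u u' v v' ((coC0 y + s) / lam p) ((coC1 y - s) / lam p)"
    have x: "coe0 x = coe0 y" "coe1 x = coe1 y" "coE0 x = u" "coE1 x = u'" "coF0 x = v" "coF1 x = v'"
      "lam p * coC0 x = coC0 y + s" "lam p * coC1 x = coC1 y - s"
      using c[THEN conjunct2, THEN conjunct2, THEN conjunct2, THEN conjunct2] by (simp_all add: x_def)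
    have "\<phi> x = y"
      by (simp only: h1i_eq_iff co x d_def[symmetric] s_def[symmetric]) (simp add: add.assoc uv uv')
    then show "\<phi> (SOME x. \<phi> x = y) = y" by (rule someI)
  qed
  ultimately show ?thesis by (simp add: Aut_H_iff add scale one mult bij_def)
qed

text \<open>An automorphism with \<open>\<phi>(e\<^sub>0) \<in> e\<^sub>0 + N\<close> is of type I: the idempotent \<open>\<phi>(e\<^sub>0)\<close> has its \<open>C\<close>-part
  determined by \<open>\<beta>, \<gamma>, \<delta>, \<eta>\<close>, and the Peirce relations \<open>X\<^sub>0 = e\<^sub>0 X\<^sub>0 = X\<^sub>0 e\<^sub>1\<close>, \<open>X\<^sub>1 = e\<^sub>1 X\<^sub>1 = X\<^sub>1 e\<^sub>0\<close>
  determine the remaining coordinates.\<close>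

lemma Aut_H_type_I:
  assumes A: "\<phi> \<in> Aut_H" and e: "coe0 (\<phi> e\<^sub>0) = 1" "coe1 (\<phi> e\<^sub>0) = 0"
  shows "\<exists>p. is_type_I p \<phi>"
proof -
  note simps = Aut_H_simps[OF A]
  have inj: "\<phi> x = 0 \<Longrightarrow> x = 0" for x
    using A simps(5) by (metis Aut_H_iff bij_is_inj injD)
  have "e\<^sub>1 = 1 - e\<^sub>0" by (simp add: h1i_eq_iff)
  then have sum1: "\<phi> e\<^sub>1 = 1 - \<phi> e\<^sub>0" by (metis simps(3,6))
  have "\<phi> e\<^sub>0 * \<phi> e\<^sub>0 = \<phi> e\<^sub>0"
    unfolding simps(4)[symmetric] by (rule arg_cong[of _ _ \<phi>]) (simp add: h1i_eq_iff)
  then have "coC0 (\<phi> e\<^sub>0 * \<phi> e\<^sub>0) = coC0 (\<phi> e\<^sub>0)" "coC1 (\<phi> e\<^sub>0 * \<phi> e\<^sub>0) = coC1 (\<phi> e\<^sub>0)" by simp_all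
  \<comment> \<open>With \<open>q\<close> the sum of products on the right, squaring turns a
    \<open>C\<^sub>0\<close>-coordinate \<open>c\<close> into \<open>2 * c + q\<close>, and the
    \<open>C\<^sub>1\<close>-coordinate becomes \<open>q\<close>.\<close>
  then have C: "coC1 (\<phi> e\<^sub>0) = coE0 (\<phi> e\<^sub>0) * coF1 (\<phi> e\<^sub>0) + coF0 (\<phi> e\<^sub>0) * coE1 (\<phi> e\<^sub>0)"
    "coC0 (\<phi> e\<^sub>0) = - (coE0 (\<phi> e\<^sub>0) * coF1 (\<phi> e\<^sub>0) + coF0 (\<phi> e\<^sub>0) * coE1 (\<phi> e\<^sub>0))"
    using e by (simp_all, algebra+)
  have peirce0: "coe0 (\<phi> x) = 0" "coe1 (\<phi> x) = 0" "coE1 (\<phi> x) = 0" "coF1 (\<phi> x) = 0"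
    "coC1 (\<phi> x) = coE1 (\<phi> e\<^sub>0) * coF0 (\<phi> x) + coF1 (\<phi> e\<^sub>0) * coE0 (\<phi> x)"
    "coC0 (\<phi> x) = - (coE1 (\<phi> e\<^sub>0) * coF0 (\<phi> x) + coF1 (\<phi> e\<^sub>0) * coE0 (\<phi> x))"
    if "e\<^sub>0 * x = x" "x * e\<^sub>1 = x" for x
  proof -
    \<comment> \<open>The left relation determines the \<open>C\<^sub>1\<close>-coordinate and the
      right one the \<open>C\<^sub>0\<close>-coordinate; the minus sign in
      \<open>1 - \<phi> e\<^sub>0\<close> makes the two opposite.\<close>
    have l: "\<phi> x = \<phi> e\<^sub>0 * \<phi> x" and r: "\<phi> x = \<phi> x * (1 - \<phi> e\<^sub>0)"
      using simps(4)[of e\<^sub>0 x] simps(4)[of x e\<^sub>1] that sum1 by simp_all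
    show z: "coe0 (\<phi> x) = 0" "coe1 (\<phi> x) = 0"
      by (subst r, simp add: e) (subst l, simp add: e)
    show "coE1 (\<phi> x) = 0" "coF1 (\<phi> x) = 0"
      "coC1 (\<phi> x) = coE1 (\<phi> e\<^sub>0) * coF0 (\<phi> x) + coF1 (\<phi> e\<^sub>0) * coE0 (\<phi> x)"
      by (subst l, simp add: e z)+
    show "coC0 (\<phi> x) = - (coE1 (\<phi> e\<^sub>0) * coF0 (\<phi> x) + coF1 (\<phi> e\<^sub>0) * coE0 (\<phi> x))"
      by (subst r, simp add: e z)
  qed
  have peirce1: "coe0 (\<phi> x) = 0" "coe1 (\<phi> x) = 0" "coE0 (\<phi> x) = 0" "coF0 (\<phi> x) = 0"
    "coC1 (\<phi> x) = coE0 (\<phi> e\<^sub>0) * coF1 (\<phi> x) + coF0 (\<phi> e\<^sub>0) * coE1 (\<phi> x)"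
    "coC0 (\<phi> x) = - (coE0 (\<phi> e\<^sub>0) * coF1 (\<phi> x) + coF0 (\<phi> e\<^sub>0) * coE1 (\<phi> x))"
    if "e\<^sub>1 * x = x" "x * e\<^sub>0 = x" for x
  proof -
    have l: "\<phi> x = (1 - \<phi> e\<^sub>0) * \<phi> x" and r: "\<phi> x = \<phi> x * \<phi> e\<^sub>0"
      using simps(4)[of e\<^sub>1 x] simps(4)[of x e\<^sub>0] that sum1 by simp_all
    show z: "coe0 (\<phi> x) = 0" "coe1 (\<phi> x) = 0"
      by (subst l, simp add: e) (subst r, simp add: e)
    show "coE0 (\<phi> x) = 0" "coF0 (\<phi> x) = 0"
      "coC0 (\<phi> x) = - (coE0 (\<phi> e\<^sub>0) * coF1 (\<phi> x) + coF0 (\<phi> e\<^sub>0) * coE1 (\<phi> x))"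
      by (subst l, simp add: e z)+
    show "coC1 (\<phi> x) = coE0 (\<phi> e\<^sub>0) * coF1 (\<phi> x) + coF0 (\<phi> e\<^sub>0) * coE1 (\<phi> x)"
      by (subst r, simp add: e z)
  qed
  have "e\<^sub>0 * E\<^sub>0 = E\<^sub>0" "E\<^sub>0 * e\<^sub>1 = E\<^sub>0" "e\<^sub>0 * F\<^sub>0 = F\<^sub>0" "F\<^sub>0 * e\<^sub>1 = F\<^sub>0"
    "e\<^sub>1 * E\<^sub>1 = E\<^sub>1" "E\<^sub>1 * e\<^sub>0 = E\<^sub>1" "e\<^sub>1 * F\<^sub>1 = F\<^sub>1" "F\<^sub>1 * e\<^sub>0 = F\<^sub>1"
    by (simp_all add: h1i_eq_iff)
  note E0 = peirce0[OF this(1,2)] and F0 = peirce0[OF this(3,4)]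
    and E1 = peirce1[OF this(5,6)] and F1 = peirce1[OF this(7,8)]
  have prods: "\<phi> E\<^sub>0 * \<phi> E\<^sub>1 = 0" "\<phi> F\<^sub>0 * \<phi> F\<^sub>1 = 0" "\<phi> E\<^sub>0 * \<phi> F\<^sub>1 = \<phi> C\<^sub>0" "\<phi> F\<^sub>0 * \<phi> E\<^sub>1 = \<phi> C\<^sub>0"
    "\<phi> F\<^sub>1 * \<phi> E\<^sub>0 = \<phi> C\<^sub>1"
  proof -
    have *: "E\<^sub>0 * E\<^sub>1 = 0" "F\<^sub>0 * F\<^sub>1 = 0" "E\<^sub>0 * F\<^sub>1 = C\<^sub>0" "F\<^sub>0 * E\<^sub>1 = C\<^sub>0" "F\<^sub>1 * E\<^sub>0 = C\<^sub>1"
      by (simp_all add: h1i_eq_iff)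
    show "\<phi> E\<^sub>0 * \<phi> E\<^sub>1 = 0" "\<phi> F\<^sub>0 * \<phi> F\<^sub>1 = 0" "\<phi> E\<^sub>0 * \<phi> F\<^sub>1 = \<phi> C\<^sub>0" "\<phi> F\<^sub>0 * \<phi> E\<^sub>1 = \<phi> C\<^sub>0"
      "\<phi> F\<^sub>1 * \<phi> E\<^sub>0 = \<phi> C\<^sub>1"
      by (simp_all only: simps(5) * flip: simps(4))
  qed
  define p where "p = \<lparr>\<beta> = coE0 (\<phi> e\<^sub>0), \<gamma> = coF0 (\<phi> e\<^sub>0), \<delta> = coE1 (\<phi> e\<^sub>0), \<eta> = coF1 (\<phi> e\<^sub>0),
    lam = coC0 (\<phi> C\<^sub>0), \<mu>\<^sub>0 = coE0 (\<phi> E\<^sub>0), \<nu>\<^sub>0 = coF0 (\<phi> E\<^sub>0), \<sigma>\<^sub>0 = coE0 (\<phi> F\<^sub>0), \<tau>\<^sub>0 = coF0 (\<phi> F\<^sub>0),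
    \<mu>\<^sub>1 = coE1 (\<phi> E\<^sub>1), \<nu>\<^sub>1 = coF1 (\<phi> E\<^sub>1), \<sigma>\<^sub>1 = coE1 (\<phi> F\<^sub>1), \<tau>\<^sub>1 = coF1 (\<phi> F\<^sub>1)\<rparr>"
  have p: "\<beta> p = coE0 (\<phi> e\<^sub>0)" "\<gamma> p = coF0 (\<phi> e\<^sub>0)" "\<delta> p = coE1 (\<phi> e\<^sub>0)" "\<eta> p = coF1 (\<phi> e\<^sub>0)"
    "lam p = coC0 (\<phi> C\<^sub>0)" "\<mu>\<^sub>0 p = coE0 (\<phi> E\<^sub>0)" "\<nu>\<^sub>0 p = coF0 (\<phi> E\<^sub>0)" "\<sigma>\<^sub>0 p = coE0 (\<phi> F\<^sub>0)"
    "\<tau>\<^sub>0 p = coF0 (\<phi> F\<^sub>0)" "\<mu>\<^sub>1 p = coE1 (\<phi> E\<^sub>1)" "\<nu>\<^sub>1 p = coF1 (\<phi> E\<^sub>1)" "\<sigma>\<^sub>1 p = coE1 (\<phi> F\<^sub>1)"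
    "\<tau>\<^sub>1 p = coF1 (\<phi> F\<^sub>1)"
    by (simp_all add: p_def)
  have lam: "lam p = \<mu>\<^sub>0 p * \<tau>\<^sub>1 p + \<nu>\<^sub>0 p * \<sigma>\<^sub>1 p"
    unfolding p by (subst prods(3)[symmetric]) (simp add: E0 F1)
  have C0: "\<phi> C\<^sub>0 = lam p *\<^sub>H C\<^sub>0"
    unfolding lam unfolding p by (subst prods(3)[symmetric]) (simp add: h1i_eq_iff E0 F1)
  \<comment> \<open>The same factor \<open>lam p\<close> appears because
    \<open>F\<^sub>1 * E\<^sub>0\<close> and \<open>E\<^sub>0 * F\<^sub>1\<close> are given by the
    same symmetric pairing.\<close>
  have C1: "\<phi> C\<^sub>1 = lam p *\<^sub>H C\<^sub>1"
    unfolding lam unfolding p by (subst prods(5)[symmetric]) (simp add: h1i_eq_iff E0 F1 mult.commute)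
  have "\<mu>\<^sub>0 p * \<nu>\<^sub>1 p + \<nu>\<^sub>0 p * \<mu>\<^sub>1 p = 0" "\<sigma>\<^sub>0 p * \<tau>\<^sub>1 p + \<tau>\<^sub>0 p * \<sigma>\<^sub>1 p = 0"
    "lam p = \<sigma>\<^sub>0 p * \<nu>\<^sub>1 p + \<tau>\<^sub>0 p * \<mu>\<^sub>1 p"
    unfolding p using prods(1,2) arg_cong[OF prods(4), of coC0]
    by (auto simp: h1i_eq_iff E0 F0 E1 F1)
  \<comment> \<open>Otherwise \<open>\<phi>\<close> would annihilate \<open>C\<^sub>0\<close>,
    against injectivity.\<close>
  moreover have "lam p \<noteq> 0"
    using C0 inj[of C\<^sub>0] by (auto simp: h1i_eq_iff)
  ultimately have "constraints p" using lam by (intro constraintsI)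
  then have "is_type_I p \<phi>"
    unfolding is_type_I_def using A C0 C1
    by (simp add: Aut_H_def sum1)
      (simp add: h1i_eq_iff e p C E0 F0 E1 F1 algebra_simps)
  then show ?thesis by blast
qed

section \<open>Conjugation by the symmetries and the dichotomy of types\<close>

lemma type_I_flip:
  assumes "is_type_I p \<phi>"
  shows "is_type_I (flip_params p) (\<kappa> \<circ> \<phi> \<circ> \<kappa>)"
proof -
  note co = assms[unfolded is_type_I_iff, THEN conjunct2, rule_format]
  have "constraints (flip_params p)"
    using assms[unfolded is_type_I_iff, THEN conjunct1]
    by (auto simp: flip_params_def constraints_iff mult.commute add.commute)
  then show ?thesis
    unfolding is_type_I_iff by (simp add: co flip_params_def) (simp add: algebra_simps)
qed

lemma type_I_swap:
  assumes "is_type_I p \<phi>"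
  shows "is_type_I (swap_params p) (\<epsilon> \<circ> \<phi> \<circ> \<epsilon>)"
proof -
  note co = assms[unfolded is_type_I_iff, THEN conjunct2, rule_format]
  have "constraints (swap_params p)"
    using assms[unfolded is_type_I_iff, THEN conjunct1]
    by (auto simp: swap_params_def constraints_iff mult.commute add.commute)
  then show ?thesis
    unfolding is_type_I_iff by (simp add: co swap_params_def) (simp add: algebra_simps)
qed

text \<open>The right-hand sides of type II are the flipped right-hand sides of type I, so facts
  about type II can be taken over from type I.\<close>

lemma is_type_II_iff: "is_type_II p \<phi> \<longleftrightarrow> is_type_I p (\<kappa> \<circ> \<phi>)"
proof -
  note f = Aut_H_simps[OF flip_Aut_H]
  have [simp]: "\<kappa> (\<kappa> x) = x" for x by (simp add: h1i_eq_iff)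
  have eq: "\<kappa> x = y \<longleftrightarrow> x = \<kappa> y" for x y by auto
  have lin: "Vector_Spaces.linear scaleH scaleH (\<kappa> \<circ> \<phi>) \<longleftrightarrow> Vector_Spaces.linear scaleH scaleH \<phi>"
    by (simp add: linear_H_iff eq f)
  show ?thesis unfolding is_type_I_def is_type_II_def lin by (simp add: eq f flip_basis)
qed

text \<open>\<open>coe0\<close> and \<open>coe1\<close> send idempotents to 0 or 1. Neither
  \<open>e\<^sub>0\<close> nor \<open>e\<^sub>1\<close> is mapped into N, where cubes vanish and so
  no nonzero idempotent exists; as the two images sum to 1, each of them takes the value 1 under
  exactly one of the functionals.\<close>

lemma Aut_H_e0_cases:
  assumes A: "\<phi> \<in> Aut_H"
  shows "coe0 (\<phi> e\<^sub>0) = 1 \<and> coe1 (\<phi> e\<^sub>0) = 0 \<or> coe0 (\<phi> e\<^sub>0) = 0 \<and> coe1 (\<phi> e\<^sub>0) = 1"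
proof -
  note simps = Aut_H_simps[OF A]
  have inj: "\<phi> x = 0 \<Longrightarrow> x = 0" for x
    using A simps(5) by (metis Aut_H_iff bij_is_inj injD)
  have idem: "\<phi> e * \<phi> e = \<phi> e" if "e * e = e" for e
    using that simps(4)[of e e] by simp
  have nonzero: "coe0 (\<phi> e) \<noteq> 0 \<or> coe1 (\<phi> e) \<noteq> 0" if e: "e * e = e" "e \<noteq> 0" for e
  proof (rule ccontr)
    assume "\<not> ?thesis"
    then have "\<phi> e * \<phi> e * \<phi> e = 0" by (simp add: h1i_eq_iff)
    then show False using e inj idem by metis
  qed
  have ee: "e\<^sub>0 * e\<^sub>0 = e\<^sub>0" "e\<^sub>1 * e\<^sub>1 = e\<^sub>1" "e\<^sub>0 \<noteq> 0" "e\<^sub>1 \<noteq> 0" "e\<^sub>1 = 1 - e\<^sub>0"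
    by (simp_all add: h1i_eq_iff)
  have "coe0 (\<phi> e\<^sub>0) * coe0 (\<phi> e\<^sub>0) = coe0 (\<phi> e\<^sub>0)" "coe1 (\<phi> e\<^sub>0) * coe1 (\<phi> e\<^sub>0) = coe1 (\<phi> e\<^sub>0)"
    unfolding co_mult[symmetric] by (simp_all only: idem ee)
  moreover have "coe0 (\<phi> e\<^sub>1) = 1 - coe0 (\<phi> e\<^sub>0)" "coe1 (\<phi> e\<^sub>1) = 1 - coe1 (\<phi> e\<^sub>0)"
    by (simp_all only: ee(5) simps co_diff co_one)
  ultimately show ?thesis
    using nonzero[OF ee(1,3)] nonzero[OF ee(2,4)] by auto
qed

text \<open>A criterion by a single coordinate, from which the group-theoretic properties are read
  off.\<close>

lemma Aut_I_iff: "\<phi> \<in> Aut_I \<longleftrightarrow> \<phi> \<in> Aut_H \<and> coe0 (\<phi> e\<^sub>0) = 1"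
proof
  assume "\<phi> \<in> Aut_I"
  then obtain p where "is_type_I p \<phi>" by (auto simp: Aut_I_def)
  then show "\<phi> \<in> Aut_H \<and> coe0 (\<phi> e\<^sub>0) = 1" using type_I_Aut_H by (auto simp: is_type_I_iff)
next
  assume "\<phi> \<in> Aut_H \<and> coe0 (\<phi> e\<^sub>0) = 1"
  then show "\<phi> \<in> Aut_I"
    using Aut_H_type_I[of \<phi>] Aut_H_e0_cases[of \<phi>] by (auto simp: Aut_I_def)
qed

lemma co_Aut_I:
  assumes "\<phi> \<in> Aut_I"
  shows "coe0 (\<phi> x) = coe0 x" "coe1 (\<phi> x) = coe1 x"
  using assms by (auto simp: Aut_I_def is_type_I_iff)

text \<open>As \<open>\<kappa> e\<^sub>0 = 1 - e\<^sub>0\<close>, composing with the flip exchanges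
  the two cases of \<open>Aut_H_e0_cases\<close>.\<close>

lemma Aut_H_flip_cases:
  assumes "\<phi> \<in> Aut_H"
  shows "\<phi> \<in> Aut_I \<or> \<phi> \<circ> \<kappa> \<in> Aut_I"
proof -
  have "\<kappa> e\<^sub>0 = 1 - e\<^sub>0" by (simp add: h1i_eq_iff)
  then have "coe0 ((\<phi> \<circ> \<kappa>) e\<^sub>0) = 1 - coe0 (\<phi> e\<^sub>0)"
    by (simp add: Aut_H_simps[OF assms])
  then show ?thesis
    using Aut_H_e0_cases[OF assms] Aut_H_comp[OF assms flip_Aut_H] assms by (auto simp: Aut_I_iff)
qed

lemma Aut_I_flip_conj: "\<phi> \<in> Aut_I \<Longrightarrow> \<kappa> \<circ> \<phi> \<circ> \<kappa> \<in> Aut_I"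
  unfolding Aut_I_def using type_I_flip by blast

lemma comp_flip_flip: "\<phi> \<circ> \<kappa> \<circ> \<kappa> = \<phi>" "\<kappa> \<circ> (\<kappa> \<circ> \<phi>) = \<phi>"
  using flip_flip by (metis comp_assoc comp_id, metis comp_assoc id_comp)

text \<open>Left and right multiples by the flip coincide because conjugation by it preserves
  \<open>Aut_I\<close>.\<close>

lemma Aut_II_eq: "Aut_II = {\<kappa> \<circ> \<phi> | \<phi>. \<phi> \<in> Aut_I}"
proof -
  have "\<phi> \<circ> \<kappa> = \<kappa> \<circ> (\<kappa> \<circ> \<phi> \<circ> \<kappa>)" "\<kappa> \<circ> \<phi> = (\<kappa> \<circ> \<phi> \<circ> \<kappa>) \<circ> \<kappa>" for \<phi> :: "h1i \<Rightarrow> h1i"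
    by (simp_all add: comp_flip_flip comp_assoc flip_flip)
  then show ?thesis unfolding Aut_II_def using Aut_I_flip_conj by blast
qed

lemma Aut_II_eq_type_II: "Aut_II = {\<phi>. \<exists>p. is_type_II p \<phi>}"
  unfolding Aut_II_eq is_type_II_iff Aut_I_def
  by (auto simp: comp_flip_flip) (metis comp_flip_flip(2))

lemma Aut_H_eq: "Aut_H = Aut_I \<union> Aut_II"
proof
  show "Aut_I \<union> Aut_II \<subseteq> Aut_H"
    using Aut_H_comp[OF _ flip_Aut_H] by (auto simp: Aut_I_iff Aut_II_def)
  show "Aut_H \<subseteq> Aut_I \<union> Aut_II"
    using Aut_H_flip_cases comp_flip_flip(1) unfolding Aut_II_def by (auto, metis)
qed

section \<open>Subgroups\<close>

lemma Aut_H_group_simps [simp]: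
  "carrier Aut_H_group = Aut_H" "mult Aut_H_group = (\<circ>)" "one Aut_H_group = id"
  by (simp_all add: Aut_H_group_def)

lemma id_Aut_H: "id \<in> Aut_H"
  by (simp add: Aut_H_iff)

lemma inv_into_comp_Aut_H: "\<phi> \<in> Aut_H \<Longrightarrow> inv_into UNIV \<phi> \<circ> \<phi> = id"
  and comp_inv_into_Aut_H: "\<phi> \<in> Aut_H \<Longrightarrow> \<phi> (inv_into UNIV \<phi> x) = x"
  by (simp_all add: Aut_H_iff bij_def surj_f_inv_f)

lemma group_Aut_H: "group Aut_H_group"
  using inv_into_comp_Aut_H Aut_H_inv_into
  by (intro groupI) (auto simp: Aut_H_comp id_Aut_H comp_assoc)

lemma m_inv_Aut_H: "\<phi> \<in> Aut_H \<Longrightarrow> m_inv Aut_H_group \<phi> = inv_into UNIV \<phi>"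
  by (rule group.inv_equality[OF group_Aut_H]) (simp_all add: inv_into_comp_Aut_H Aut_H_inv_into)

text \<open>Automorphisms permute the two characters \<open>coe0\<close> and \<open>coe1\<close>,
  and \<open>Aut_I\<close> consists of those that fix both: it is the kernel of this action.\<close>

lemma normal_Aut_I: "Aut_I \<lhd> Aut_H_group"
  unfolding group.normal_inv_iff[OF group_Aut_H]
proof (intro conjI ballI)
  show "subgroup Aut_I Aut_H_group"
  proof
    show "Aut_I \<subseteq> carrier Aut_H_group" by (auto simp: Aut_I_iff)
    show "\<phi> \<otimes>\<^bsub>Aut_H_group\<^esub> \<psi> \<in> Aut_I" if "\<phi> \<in> Aut_I" "\<psi> \<in> Aut_I" for \<phi> \<psi>
      using that co_Aut_I[OF that(1)] by (auto simp: Aut_I_iff Aut_H_comp)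
    show "\<one>\<^bsub>Aut_H_group\<^esub> \<in> Aut_I" by (simp add: Aut_I_iff id_Aut_H)
    show "inv\<^bsub>Aut_H_group\<^esub> \<phi> \<in> Aut_I" if "\<phi> \<in> Aut_I" for \<phi>
    proof -
      have "\<phi> \<in> Aut_H" using that by (simp add: Aut_I_iff)
      then show ?thesis
        using co_Aut_I(1)[OF that, of "inv_into UNIV \<phi> e\<^sub>0"]
        by (simp add: Aut_I_iff m_inv_Aut_H Aut_H_inv_into comp_inv_into_Aut_H)
    qed
  qed
  fix \<psi> \<phi> assume \<psi>: "\<psi> \<in> carrier Aut_H_group" and \<phi>: "\<phi> \<in> Aut_I"
  define \<theta> where "\<theta> = inv_into UNIV \<psi>"
  have \<psi>\<theta>: "\<psi> (\<theta> x) = x" for x using \<psi> by (simp add: \<theta>_def comp_inv_into_Aut_H)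
  have "\<psi> \<in> Aut_I \<or> \<psi> \<circ> \<kappa> \<in> Aut_I" using Aut_H_flip_cases \<psi> by simp
  \<comment> \<open>Composing \<open>coe0\<close> with \<open>\<psi>\<close> gives
    \<open>coe0\<close> or \<open>coe1\<close>, and \<open>\<phi>\<close> preserves either.\<close>
  then have "coe0 (\<psi> (\<phi> x)) = coe0 (\<psi> x)" for x
  proof
    assume "\<psi> \<in> Aut_I"
    then show ?thesis by (simp add: co_Aut_I \<phi>)
  next
    assume I: "\<psi> \<circ> \<kappa> \<in> Aut_I"
    have "\<psi> y = (\<psi> \<circ> \<kappa>) (\<kappa> y)" for y by (simp add: pointfree_idE[OF flip_flip])
    then show ?thesis using co_Aut_I[OF I] co_Aut_I[OF \<phi>] by (metis co_flip(1))
  qed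
  then have "coe0 (\<psi> (\<phi> (\<theta> e\<^sub>0))) = 1" by (simp add: \<psi>\<theta>)
  moreover have "\<psi> \<circ> \<phi> \<circ> \<theta> \<in> Aut_H"
    using \<psi> \<phi> by (simp add: \<theta>_def Aut_I_iff Aut_H_comp Aut_H_inv_into)
  ultimately show "\<psi> \<otimes>\<^bsub>Aut_H_group\<^esub> \<phi> \<otimes>\<^bsub>Aut_H_group\<^esub> inv\<^bsub>Aut_H_group\<^esub> \<psi> \<in> Aut_I"
    using \<psi> by (simp add: Aut_I_iff m_inv_Aut_H flip: \<theta>_def)
qed

text \<open>The four vanishing parameters are the odd coordinates of
  \<open>\<phi> e\<^sub>0\<close>. As a stabilizer, the set is visibly a subgroup.\<close>

lemma Aut_I_diag_iff: "\<phi> \<in> Aut_I_diag \<longleftrightarrow> \<phi> \<in> Aut_H \<and> \<phi> e\<^sub>0 = e\<^sub>0"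
proof
  assume "\<phi> \<in> Aut_I_diag"
  then obtain p where p: "is_type_I p \<phi>" "\<beta> p = 0" "\<gamma> p = 0" "\<delta> p = 0" "\<eta> p = 0"
    by (auto simp: Aut_I_diag_def)
  then have "\<phi> e\<^sub>0 = e\<^sub>0" by (simp add: is_type_I_def)
  with p show "\<phi> \<in> Aut_H \<and> \<phi> e\<^sub>0 = e\<^sub>0" by (simp add: type_I_Aut_H)
next
  assume e: "\<phi> \<in> Aut_H \<and> \<phi> e\<^sub>0 = e\<^sub>0"
  then have "\<phi> \<in> Aut_I" by (simp add: Aut_I_iff)
  then obtain p where p: "is_type_I p \<phi>" by (auto simp: Aut_I_def)
  then have "\<beta> p = 0 \<and> \<gamma> p = 0 \<and> \<delta> p = 0 \<and> \<eta> p = 0"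
    using e by (auto simp: is_type_I_def h1i_eq_iff)
  with p show "\<phi> \<in> Aut_I_diag" by (auto simp: Aut_I_diag_def)
qed

lemma subgroup_Aut_I_diag: "subgroup Aut_I_diag (Aut_H_group\<lparr>carrier := Aut_I\<rparr>)"
proof (rule group.subgroup_incl[OF group_Aut_H])
  show "subgroup Aut_I Aut_H_group"
    using normal_Aut_I by (rule normal_imp_subgroup)
  show "Aut_I_diag \<subseteq> Aut_I" by (auto simp: Aut_I_diag_def Aut_I_def)
  show "subgroup Aut_I_diag Aut_H_group"
  proof
    show "inv\<^bsub>Aut_H_group\<^esub> \<phi> \<in> Aut_I_diag" if "\<phi> \<in> Aut_I_diag" for \<phi>
      using that inv_into_comp_Aut_H[of \<phi>]
      by (auto simp: Aut_I_diag_iff m_inv_Aut_H Aut_H_inv_into fun_eq_iff) metis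
  qed (auto simp: Aut_I_diag_iff Aut_H_comp id_Aut_H)
qed

section \<open>Matrices\<close>

lemma vector_4:
  "(vector [a, b, c, d] :: 'a::zero ^ 4) $ 1 = a" "(vector [a, b, c, d] :: 'a ^ 4) $ 2 = b"
  "(vector [a, b, c, d] :: 'a ^ 4) $ 3 = c" "(vector [a, b, c, d] :: 'a ^ 4) $ 4 = d"
  unfolding vector_def by simp_all

lemmas matrix_entries = matrix_matrix_mult_def transpose_def sum_4 vector_4 block_matrix_def
  params_matrix_def form_matrix_def mat_def forall_4 vec_eq_iff

lemma aut_matrix_eq: "is_type_I p \<phi> \<Longrightarrow> aut_matrix \<phi> = params_matrix p"
  unfolding aut_matrix_def using is_type_I_unique by (metis (no_types, lifting) theI)

lemma invertible_params_matrix: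
  assumes "constraints p"
  shows "invertible (params_matrix p)"
proof -
  define D where "D = \<mu>\<^sub>0 p * \<tau>\<^sub>0 p - \<nu>\<^sub>0 p * \<sigma>\<^sub>0 p"
  define D' where "D' = \<mu>\<^sub>1 p * \<tau>\<^sub>1 p - \<nu>\<^sub>1 p * \<sigma>\<^sub>1 p"
  \<comment> \<open>The inverse is formed blockwise from the adjugates.\<close>
  define M where "M = block_matrix (\<tau>\<^sub>0 p / D) (- \<nu>\<^sub>0 p / D) (- \<sigma>\<^sub>0 p / D) (\<mu>\<^sub>0 p / D)
    (\<tau>\<^sub>1 p / D') (- \<nu>\<^sub>1 p / D') (- \<sigma>\<^sub>1 p / D') (\<mu>\<^sub>1 p / D')"
  have "D \<noteq> 0" "D' \<noteq> 0" using assms by (simp_all add: constraints_iff D_def D'_def)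
  then have "params_matrix p ** M = mat 1" "M ** params_matrix p = mat 1"
    unfolding M_def by (simp_all add: matrix_entries divide_simps) (simp_all add: D_def D'_def)
  then show ?thesis unfolding invertible_def by blast
qed

lemma invertible_params_matrix_imp_det:
  assumes "invertible (params_matrix p)"
  shows "\<mu>\<^sub>0 p * \<tau>\<^sub>0 p - \<nu>\<^sub>0 p * \<sigma>\<^sub>0 p \<noteq> 0" "\<mu>\<^sub>1 p * \<tau>\<^sub>1 p - \<nu>\<^sub>1 p * \<sigma>\<^sub>1 p \<noteq> 0"
proof -
  obtain M where "params_matrix p ** M = mat 1" using assms unfolding invertible_def by blast
  then have eqs: "\<mu>\<^sub>0 p * M $ 1 $ 1 + \<nu>\<^sub>0 p * M $ 2 $ 1 = 1" "\<mu>\<^sub>0 p * M $ 1 $ 2 + \<nu>\<^sub>0 p * M $ 2 $ 2 = 0"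
    "\<sigma>\<^sub>0 p * M $ 1 $ 1 + \<tau>\<^sub>0 p * M $ 2 $ 1 = 0" "\<sigma>\<^sub>0 p * M $ 1 $ 2 + \<tau>\<^sub>0 p * M $ 2 $ 2 = 1"
    "\<mu>\<^sub>1 p * M $ 3 $ 3 + \<nu>\<^sub>1 p * M $ 4 $ 3 = 1" "\<mu>\<^sub>1 p * M $ 3 $ 4 + \<nu>\<^sub>1 p * M $ 4 $ 4 = 0"
    "\<sigma>\<^sub>1 p * M $ 3 $ 3 + \<tau>\<^sub>1 p * M $ 4 $ 3 = 0" "\<sigma>\<^sub>1 p * M $ 3 $ 4 + \<tau>\<^sub>1 p * M $ 4 $ 4 = 1"
    by (simp_all add: matrix_entries)
  \<comment> \<open>Multiplicativity of the determinant, for each diagonal block and the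
    corresponding block of the inverse.\<close>
  have "(\<mu>\<^sub>0 p * \<tau>\<^sub>0 p - \<nu>\<^sub>0 p * \<sigma>\<^sub>0 p) * (M $ 1 $ 1 * M $ 2 $ 2 - M $ 1 $ 2 * M $ 2 $ 1) = 1"
    "(\<mu>\<^sub>1 p * \<tau>\<^sub>1 p - \<nu>\<^sub>1 p * \<sigma>\<^sub>1 p) * (M $ 3 $ 3 * M $ 4 $ 4 - M $ 3 $ 4 * M $ 4 $ 3) = 1"
    using eqs by algebra+
  then show "\<mu>\<^sub>0 p * \<tau>\<^sub>0 p - \<nu>\<^sub>0 p * \<sigma>\<^sub>0 p \<noteq> 0" "\<mu>\<^sub>1 p * \<tau>\<^sub>1 p - \<nu>\<^sub>1 p * \<sigma>\<^sub>1 p \<noteq> 0"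
    by auto
qed

section \<open>Stable sets of bilinear forms and the matrix description\<close>

lemma special_forms_subset: "special_forms \<subseteq> antitraceless_forms"
  by (auto simp: special_forms_def antitraceless_forms_def form_matrix_def vector_4)

text \<open>With J the matrix of ones on the second diagonal, the sum along the second diagonal of G
  is the trace of JG. The constraints say that J is multiplied by \<open>lam p\<close> under
  \<open>M J M\<^sup>t\<close>, so cyclicity of the trace shows that the sum is multiplied by
  \<open>lam p\<close>.\<close>

lemma leaves_stable_antitraceless:
  assumes "constraints p"
  shows "leaves_stable (params_matrix p) antitraceless_forms"
  unfolding leaves_stable_def
proof
  fix G assume "G \<in> antitraceless_forms"
  then have "G $ 1 $ 4 + G $ 2 $ 3 + G $ 3 $ 2 + G $ 4 $ 1 = 0"
    by (simp add: antitraceless_forms_def)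
  with assms[unfolded constraints_iff]
  show "transpose (params_matrix p) ** G ** params_matrix p \<in> antitraceless_forms"
    unfolding antitraceless_forms_def by (simp add: matrix_entries) algebra
qed

text \<open>The special forms are the symmetric antitraceless forms with zero diagonal blocks;
  congruence by a block diagonal matrix preserves symmetry and the zero blocks.\<close>

lemma leaves_stable_special:
  assumes "constraints p"
  shows "leaves_stable (params_matrix p) special_forms"
  unfolding leaves_stable_def
proof
  fix G assume "G \<in> special_forms"
  then obtain a b d where G: "G = form_matrix a b d" by (auto simp: special_forms_def)
  define N where "N = transpose (params_matrix p) ** G ** params_matrix p"
  have "G \<in> antitraceless_forms" using \<open>G \<in> special_forms\<close> special_forms_subset by blast
  then have "N \<in> antitraceless_forms"
    using leaves_stable_antitraceless[OF assms] by (simp add: leaves_stable_def N_def)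
  then have "N $ 1 $ 4 + N $ 2 $ 3 + N $ 3 $ 2 + N $ 4 $ 1 = 0"
    by (simp add: antitraceless_forms_def)
  moreover have "N $ 3 $ 1 = N $ 1 $ 3" "N $ 4 $ 1 = N $ 1 $ 4" "N $ 3 $ 2 = N $ 2 $ 3" "N $ 4 $ 2 = N $ 2 $ 4"
    "N $ 1 $ 1 = 0" "N $ 1 $ 2 = 0" "N $ 2 $ 1 = 0" "N $ 2 $ 2 = 0"
    "N $ 3 $ 3 = 0" "N $ 3 $ 4 = 0" "N $ 4 $ 3 = 0" "N $ 4 $ 4 = 0"
    unfolding N_def G by (simp_all add: matrix_entries algebra_simps)
  \<comment> \<open>By symmetry the second diagonal reads x, y, y, x, so its vanishing sum gives the
    sign in \<open>form_matrix\<close>.\<close>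
  moreover have "y = - x" if "x + y + y + x = 0" for x y :: complex
    using that by algebra
  ultimately have "N = form_matrix (N $ 1 $ 3) (N $ 1 $ 4) (N $ 2 $ 4)"
    by (simp add: form_matrix_def vec_eq_iff forall_4 vector_4)
  then show "transpose (params_matrix p) ** G ** params_matrix p \<in> special_forms"
    unfolding special_forms_def N_def by blast
qed

text \<open>Testing on the three generators of \<open>special_forms\<close> gives (i), (ii) and the
  equality of the two expressions in (iii), each doubled by symmetry. The stability hypothesis has
  the smaller set as source and the larger as target, so it follows from stability of either
  set.\<close>

lemma stable_imp_constraints:
  assumes inv: "invertible (params_matrix p)"
    and stable: "\<And>G. G \<in> special_forms \<Longrightarrow>
      transpose (params_matrix p) ** G ** params_matrix p \<in> antitraceless_forms"
    and lam: "lam p = \<mu>\<^sub>0 p * \<tau>\<^sub>1 p + \<nu>\<^sub>0 p * \<sigma>\<^sub>1 p"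
  shows "constraints p"
proof -
  note det = invertible_params_matrix_imp_det[OF inv]
  have G: "transpose (params_matrix p) ** form_matrix a b d ** params_matrix p \<in> antitraceless_forms" for a b d
    by (rule stable) (auto simp: special_forms_def)
  have "2 * (\<mu>\<^sub>0 p * \<nu>\<^sub>1 p + \<nu>\<^sub>0 p * \<mu>\<^sub>1 p) = 0"
    using G[of 1 0 0] by (simp add: antitraceless_forms_def matrix_entries algebra_simps)
  then have i: "\<mu>\<^sub>0 p * \<nu>\<^sub>1 p + \<nu>\<^sub>0 p * \<mu>\<^sub>1 p = 0" by (metis mult_eq_0_iff zero_neq_numeral)
  have "2 * (\<sigma>\<^sub>0 p * \<tau>\<^sub>1 p + \<tau>\<^sub>0 p * \<sigma>\<^sub>1 p) = 0"
    using G[of 0 0 1] by (simp add: antitraceless_forms_def matrix_entries algebra_simps)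
  then have ii: "\<sigma>\<^sub>0 p * \<tau>\<^sub>1 p + \<tau>\<^sub>0 p * \<sigma>\<^sub>1 p = 0" by (metis mult_eq_0_iff zero_neq_numeral)
  have "2 * (\<mu>\<^sub>0 p * \<tau>\<^sub>1 p + \<nu>\<^sub>0 p * \<sigma>\<^sub>1 p) = 2 * (\<sigma>\<^sub>0 p * \<nu>\<^sub>1 p + \<tau>\<^sub>0 p * \<mu>\<^sub>1 p)"
    using G[of 0 1 0] by (simp add: antitraceless_forms_def matrix_entries algebra_simps)
  then have iii: "lam p = \<sigma>\<^sub>0 p * \<nu>\<^sub>1 p + \<tau>\<^sub>0 p * \<mu>\<^sub>1 p"
    using lam by (metis mult_left_cancel zero_neq_numeral)
  have "lam p * lam p = (\<mu>\<^sub>0 p * \<tau>\<^sub>0 p - \<nu>\<^sub>0 p * \<sigma>\<^sub>0 p) * (\<mu>\<^sub>1 p * \<tau>\<^sub>1 p - \<nu>\<^sub>1 p * \<sigma>\<^sub>1 p)"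
    using i ii lam iii by (rule lam_squared)
  then have "lam p \<noteq> 0" using det by auto
  with i ii iii lam det show ?thesis unfolding constraints_iff by blast
qed

text \<open>Treating any stable set between the two sets of forms at once covers both readings of
  the stability condition.\<close>

lemma bij_betw_aut_matrix:
  assumes sub: "special_forms \<subseteq> S" "S \<subseteq> antitraceless_forms"
    and stable: "\<And>p. constraints p \<Longrightarrow> leaves_stable (params_matrix p) S"
  shows "bij_betw aut_matrix Aut_I_diag {M \<in> block_matrices. invertible M \<and> leaves_stable M S}"
  unfolding bij_betw_def
proof
  show "inj_on aut_matrix Aut_I_diag"
  proof (rule inj_onI)
    fix \<phi> \<psi> assume "\<phi> \<in> Aut_I_diag" "\<psi> \<in> Aut_I_diag" and eq: "aut_matrix \<phi> = aut_matrix \<psi>"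
    then obtain p q where p: "is_type_I p \<phi>" "\<beta> p = 0" "\<gamma> p = 0" "\<delta> p = 0" "\<eta> p = 0"
      and q: "is_type_I q \<psi>" "\<beta> q = 0" "\<gamma> q = 0" "\<delta> q = 0" "\<eta> q = 0"
      by (auto simp: Aut_I_diag_def)
    have "params_matrix p = params_matrix q" using eq p q by (simp add: aut_matrix_eq)
    then have "\<mu>\<^sub>0 p = \<mu>\<^sub>0 q" "\<nu>\<^sub>0 p = \<nu>\<^sub>0 q" "\<sigma>\<^sub>0 p = \<sigma>\<^sub>0 q" "\<tau>\<^sub>0 p = \<tau>\<^sub>0 q"
      "\<mu>\<^sub>1 p = \<mu>\<^sub>1 q" "\<nu>\<^sub>1 p = \<nu>\<^sub>1 q" "\<sigma>\<^sub>1 p = \<sigma>\<^sub>1 q" "\<tau>\<^sub>1 p = \<tau>\<^sub>1 q"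
      by (simp_all add: matrix_entries)
    \<comment> \<open>The matrix does not display \<open>lam\<close>, but (iii) computes it from the
      entries.\<close>
    moreover from this have "lam p = lam q"
      using p(1) q(1) by (simp add: is_type_I_def constraints_iff)
    ultimately have "p = q" using p q by (intro aut_params.equality) simp_all
    moreover have "constraints p" using p by (simp add: is_type_I_def)
    ultimately show "\<phi> = \<psi>" using ex1_type_I p q by blast
  qed
  show "aut_matrix ` Aut_I_diag = {M \<in> block_matrices. invertible M \<and> leaves_stable M S}"
  proof (intro equalityI subsetI)
    fix M assume "M \<in> aut_matrix ` Aut_I_diag"
    then obtain \<phi> p where p: "is_type_I p \<phi>" and M: "M = params_matrix p"
      by (auto simp: Aut_I_diag_def aut_matrix_eq)
    have "constraints p" using p by (simp add: is_type_I_def)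
    moreover have "M \<in> block_matrices"
      unfolding M params_matrix_def block_matrices_def by blast
    ultimately show "M \<in> {M \<in> block_matrices. invertible M \<and> leaves_stable M S}"
      using M stable invertible_params_matrix by simp
  next
    fix M assume "M \<in> {M \<in> block_matrices. invertible M \<and> leaves_stable M S}"
    then obtain m\<^sub>0 n\<^sub>0 s\<^sub>0 t\<^sub>0 m\<^sub>1 n\<^sub>1 s\<^sub>1 t\<^sub>1 where M: "M = block_matrix m\<^sub>0 n\<^sub>0 s\<^sub>0 t\<^sub>0 m\<^sub>1 n\<^sub>1 s\<^sub>1 t\<^sub>1"
      and "invertible M" "leaves_stable M S"
      by (auto simp: block_matrices_def)
    define p where "p = \<lparr>\<beta> = 0, \<gamma> = 0, \<delta> = 0, \<eta> = 0, lam = m\<^sub>0 * t\<^sub>1 + n\<^sub>0 * s\<^sub>1,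
      \<mu>\<^sub>0 = m\<^sub>0, \<nu>\<^sub>0 = n\<^sub>0, \<sigma>\<^sub>0 = s\<^sub>0, \<tau>\<^sub>0 = t\<^sub>0, \<mu>\<^sub>1 = m\<^sub>1, \<nu>\<^sub>1 = n\<^sub>1, \<sigma>\<^sub>1 = s\<^sub>1, \<tau>\<^sub>1 = t\<^sub>1\<rparr>"
    have Mp: "M = params_matrix p" by (simp add: M p_def params_matrix_def)
    have "constraints p"
    proof (rule stable_imp_constraints)
      show "invertible (params_matrix p)" using \<open>invertible M\<close> Mp by simp
      show "transpose (params_matrix p) ** G ** params_matrix p \<in> antitraceless_forms"
        if "G \<in> special_forms" for G
        using \<open>leaves_stable M S\<close> that sub unfolding leaves_stable_def Mp by blast
    qed (simp add: p_def)
    then obtain \<phi> where "is_type_I p \<phi>" using ex1_type_I by blast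
    moreover from this have "\<phi> \<in> Aut_I_diag" unfolding Aut_I_diag_def by (auto simp: p_def)
    ultimately show "M \<in> aut_matrix ` Aut_I_diag"
      by (intro image_eqI[of _ _ \<phi>]) (simp_all add: aut_matrix_eq Mp)
  qed
qed

section \<open>Automorphisms of the nilradical\<close>

lemma basis_N_H: "E\<^sub>0 \<in> N_H" "E\<^sub>1 \<in> N_H" "F\<^sub>0 \<in> N_H" "F\<^sub>1 \<in> N_H" "C\<^sub>0 \<in> N_H" "C\<^sub>1 \<in> N_H"
  by (simp_all add: nilradical_iff)

lemma zero_N_H: "0 \<in> N_H"
  and add_N_H: "x \<in> N_H \<Longrightarrow> y \<in> N_H \<Longrightarrow> x + y \<in> N_H"
  and diff_N_H: "x \<in> N_H \<Longrightarrow> y \<in> N_H \<Longrightarrow> x - y \<in> N_H"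
  and scale_N_H: "x \<in> N_H \<Longrightarrow> c *\<^sub>H x \<in> N_H"
  and mult_N_H: "x \<in> N_H \<Longrightarrow> y \<in> N_H \<Longrightarrow> x * y \<in> N_H"
  by (simp_all add: nilradical_iff)

lemmas N_H_intros = basis_N_H zero_N_H add_N_H diff_N_H scale_N_H mult_N_H

section \<open>Restriction of automorphisms to N\<close>

lemma Aut_H_N_H_iff:
  assumes "\<phi> \<in> Aut_H"
  shows "\<phi> x \<in> N_H \<longleftrightarrow> x \<in> N_H"
  using Aut_H_flip_cases[OF assms]
proof
  assume "\<phi> \<in> Aut_I"
  then show ?thesis by (simp add: nilradical_iff co_Aut_I)
next
  assume I: "\<phi> \<circ> \<kappa> \<in> Aut_I"
  have "\<phi> x = (\<phi> \<circ> \<kappa>) (\<kappa> x)" by (simp add: pointfree_idE[OF flip_flip])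
  then show ?thesis using co_Aut_I[OF I, of "\<kappa> x"] by (auto simp: nilradical_iff)
qed

lemma Aut_I_commutator_space:
  assumes "\<phi> \<in> Aut_I" "x \<in> commutator_space"
  shows "\<phi> x \<in> commutator_space"
proof -
  obtain p where "is_type_I p \<phi>" using assms by (auto simp: Aut_I_def)
  note co = this[unfolded is_type_I_iff, THEN conjunct2, rule_format]
  \<comment> \<open>Apart from the scaling by \<open>lam p\<close>, all contributions to the
    \<open>C\<close>-part are multiples of \<open>C\<^sub>1 - C\<^sub>0\<close> and cancel in the
    sum.\<close>
  have "coC0 (\<phi> x) + coC1 (\<phi> x) = lam p * (coC0 x + coC1 x)"
    by (simp only: co) (simp add: distrib_left)
  then show ?thesis using assms co by (simp add: commutator_space_iff)
qed

lemma flip_commutator_space: "x \<in> commutator_space \<Longrightarrow> \<kappa> x \<in> commutator_space"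
  by (simp add: commutator_space_iff add.commute)

lemma Aut_H_commutator_space:
  assumes "\<phi> \<in> Aut_H" "x \<in> commutator_space"
  shows "\<phi> x \<in> commutator_space"
  using Aut_H_flip_cases[OF assms(1)]
proof
  assume "\<phi> \<circ> \<kappa> \<in> Aut_I"
  then have "(\<phi> \<circ> \<kappa>) (\<kappa> x) \<in> commutator_space"
    by (rule Aut_I_commutator_space[OF _ flip_commutator_space[OF assms(2)]])
  then show ?thesis by (simp add: pointfree_idE[OF flip_flip])
qed (use Aut_I_commutator_space assms in blast)

lemma commutator_space_subset: "commutator_space \<subseteq> N_H"
  by (auto simp: commutator_space_iff nilradical_iff)

lemma restrict_Aut_N:
  assumes A: "\<phi> \<in> Aut_H"
  shows "restrict \<phi> N_H \<in> Aut_N"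
proof -
  have "bij \<phi>" using A by (simp add: Aut_H_iff)
  then have "\<phi> ` N_H = N_H"
    using Aut_H_N_H_iff[OF A] by (auto simp: image_iff) (metis bij_pointE)
  then have "bij_betw \<phi> N_H N_H"
    using \<open>bij \<phi>\<close> by (auto simp: bij_betw_def intro: inj_on_subset)
  then have "bij_betw (restrict \<phi> N_H) N_H N_H"
    by (simp add: bij_betw_cong[of N_H "restrict \<phi> N_H" \<phi>])
  then show ?thesis
    by (simp add: Aut_N_def N_H_intros Aut_H_simps[OF A])
qed

section \<open>From automorphisms of N back to the algebra\<close>

lemma Aut_NE:
  assumes "\<psi> \<in> Aut_N"
  shows "x \<in> N_H \<Longrightarrow> \<psi> x \<in> N_H" "x \<in> N_H \<Longrightarrow> \<psi> (c *\<^sub>H x) = c *\<^sub>H \<psi> x"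
    "x \<in> N_H \<Longrightarrow> y \<in> N_H \<Longrightarrow> \<psi> (x + y) = \<psi> x + \<psi> y"
    "x \<in> N_H \<Longrightarrow> y \<in> N_H \<Longrightarrow> \<psi> (x * y) = \<psi> x * \<psi> y"
    "\<psi> 0 = 0" "x \<in> N_H \<Longrightarrow> \<psi> x = 0 \<longleftrightarrow> x = 0"
    "y \<in> N_H \<Longrightarrow> \<exists>x\<in>N_H. y = \<psi> x"
    "\<psi> \<in> extensional N_H"
proof -
  note D = assms[unfolded Aut_N_def]
  show "x \<in> N_H \<Longrightarrow> \<psi> x \<in> N_H" using D by (auto simp: bij_betw_def)
  show "x \<in> N_H \<Longrightarrow> \<psi> (c *\<^sub>H x) = c *\<^sub>H \<psi> x"
    "x \<in> N_H \<Longrightarrow> y \<in> N_H \<Longrightarrow> \<psi> (x + y) = \<psi> x + \<psi> y"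
    "x \<in> N_H \<Longrightarrow> y \<in> N_H \<Longrightarrow> \<psi> (x * y) = \<psi> x * \<psi> y" "\<psi> \<in> extensional N_H"
    using D by blast+
  have "\<psi> (0 + 0) = \<psi> 0 + \<psi> 0" using D zero_N_H by blast
  then show z: "\<psi> 0 = 0" by simp
  show "x \<in> N_H \<Longrightarrow> \<psi> x = 0 \<longleftrightarrow> x = 0"
    using D z zero_N_H inj_on_eq_iff[of \<psi> N_H x 0] by (simp add: bij_betw_def)
  show "y \<in> N_H \<Longrightarrow> \<exists>x\<in>N_H. y = \<psi> x" using D by (auto simp: bij_betw_def)
qed

lemma Aut_N_expand:
  assumes "\<psi> \<in> Aut_N" "x \<in> N_H"
  shows "\<psi> x = coE0 x *\<^sub>H \<psi> E\<^sub>0 + coE1 x *\<^sub>H \<psi> E\<^sub>1 + coF0 x *\<^sub>H \<psi> F\<^sub>0 + coF1 x *\<^sub>H \<psi> F\<^sub>1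
    + coC0 x *\<^sub>H \<psi> C\<^sub>0 + coC1 x *\<^sub>H \<psi> C\<^sub>1"
proof -
  have "x = coE0 x *\<^sub>H E\<^sub>0 + coE1 x *\<^sub>H E\<^sub>1 + coF0 x *\<^sub>H F\<^sub>0 + coF1 x *\<^sub>H F\<^sub>1
      + coC0 x *\<^sub>H C\<^sub>0 + coC1 x *\<^sub>H C\<^sub>1"
    using assms(2) by (simp add: h1i_eq_iff nilradical_iff)
  then have "\<psi> x = \<psi> \<dots>" by simp
  also have "\<dots> = coE0 x *\<^sub>H \<psi> E\<^sub>0 + coE1 x *\<^sub>H \<psi> E\<^sub>1 + coF0 x *\<^sub>H \<psi> F\<^sub>0 + coF1 x *\<^sub>H \<psi> F\<^sub>1
      + coC0 x *\<^sub>H \<psi> C\<^sub>0 + coC1 x *\<^sub>H \<psi> C\<^sub>1"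
    by (simp only: Aut_NE(2,3)[OF assms(1)] N_H_intros)
  finally show ?thesis .
qed

text \<open>Reduces automorphisms exchanging the two odd planes to those preserving them;
  restriction keeps the composite extensional.\<close>

lemma restrict_flip_Aut_N:
  assumes "\<psi> \<in> Aut_N"
  shows "restrict (\<kappa> \<circ> \<psi>) N_H \<in> Aut_N"
proof -
  have "bij_betw \<kappa> N_H N_H"
    using restrict_Aut_N[OF flip_Aut_H]
    by (simp add: Aut_N_def bij_betw_cong[of N_H "restrict \<kappa> N_H" \<kappa>])
  then have "bij_betw (\<kappa> \<circ> \<psi>) N_H N_H"
    using assms by (intro bij_betw_trans) (auto simp: Aut_N_def)
  then have "bij_betw (restrict (\<kappa> \<circ> \<psi>) N_H) N_H N_H"
    by (simp add: bij_betw_cong[of N_H "restrict (\<kappa> \<circ> \<psi>) N_H" "\<kappa> \<circ> \<psi>"])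
  then show ?thesis
    by (simp add: Aut_N_def N_H_intros Aut_NE(2-4)[OF assms] Aut_H_simps[OF flip_Aut_H])
qed

text \<open>An element \<open>x\<close> of \<open>N\<close> whose multiples \<open>xN\<close> span at most a line lies in
  \<open>\<langle>E\<^sub>0, F\<^sub>0\<rangle> + N\<^sup>2\<close> or in \<open>\<langle>E\<^sub>1, F\<^sub>1\<rangle> + N\<^sup>2\<close>, and the hypothesis is invariant under automorphisms of \<open>N\<close>.\<close>

lemma Aut_N_homogeneous:
  assumes A: "\<psi> \<in> Aut_N" and x: "x \<in> N_H" and c: "c \<in> N_H" "\<And>y. y \<in> N_H \<Longrightarrow> \<exists>k. x * y = k *\<^sub>H c"
  shows "coE1 (\<psi> x) = 0 \<and> coF1 (\<psi> x) = 0 \<or> coE0 (\<psi> x) = 0 \<and> coF0 (\<psi> x) = 0"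
proof -
  note e = Aut_NE[OF A]
  have "\<exists>k. \<psi> x * z = k *\<^sub>H \<psi> c" if z: "z \<in> N_H" for z
  proof -
    obtain y where y: "y \<in> N_H" "z = \<psi> y" using e(7)[OF z] by blast
    moreover obtain k where "x * y = k *\<^sub>H c" using c(2)[OF y(1)] by blast
    ultimately have "\<psi> x * z = k *\<^sub>H \<psi> c" using e(4)[OF x y(1)] e(2)[OF c(1)] by simp
    then show ?thesis ..
  qed
  from this[OF basis_N_H(1)] this[OF basis_N_H(2)] this[OF basis_N_H(3)] this[OF basis_N_H(4)]
  obtain k\<^sub>1 k\<^sub>2 k\<^sub>3 k\<^sub>4 where k: "\<psi> x * E\<^sub>0 = k\<^sub>1 *\<^sub>H \<psi> c" "\<psi> x * E\<^sub>1 = k\<^sub>2 *\<^sub>H \<psi> c"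
    "\<psi> x * F\<^sub>0 = k\<^sub>3 *\<^sub>H \<psi> c" "\<psi> x * F\<^sub>1 = k\<^sub>4 *\<^sub>H \<psi> c" by blast
  note * = k[THEN arg_cong[of _ _ coC0]] k[THEN arg_cong[of _ _ coC1]]
  \<comment> \<open>Multiplying by \<open>E\<^sub>0\<close> and \<open>F\<^sub>0\<close> exhibits
    the odd coordinates of \<open>\<psi> x\<close> of index 1 as multiples of
    \<open>C\<^sub>1\<close>; \<open>E\<^sub>1\<close> and \<open>F\<^sub>1\<close> exhibit those of
    index 0 as multiples of \<open>C\<^sub>0\<close>. The line through \<open>\<psi> c\<close>
    cannot contain nonzero multiples of both.\<close>
  show ?thesis
  proof (cases "coC0 (\<psi> c) = 0")
    case True
    then show ?thesis using * by simp
  next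
    case False
    then show ?thesis using * by simp
  qed
qed

text \<open>Once \<open>E\<^sub>0\<close> stays in its plane modulo the square of N, nonzero
  products force the other generators into theirs, and the multiplication table then gives
  (i)-(iii).\<close>

lemma Aut_N_even:
  assumes A: "\<psi> \<in> Aut_N" and even: "coE1 (\<psi> E\<^sub>0) = 0" "coF1 (\<psi> E\<^sub>0) = 0"
  shows "coE1 (\<psi> F\<^sub>0) = 0" "coF1 (\<psi> F\<^sub>0) = 0" "coE0 (\<psi> E\<^sub>1) = 0" "coF0 (\<psi> E\<^sub>1) = 0"
    "coE0 (\<psi> F\<^sub>1) = 0" "coF0 (\<psi> F\<^sub>1) = 0"
    "\<psi> C\<^sub>0 = (coE0 (\<psi> E\<^sub>0) * coF1 (\<psi> F\<^sub>1) + coF0 (\<psi> E\<^sub>0) * coE1 (\<psi> F\<^sub>1)) *\<^sub>H C\<^sub>0"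
    "\<psi> C\<^sub>0 = (coE0 (\<psi> F\<^sub>0) * coF1 (\<psi> E\<^sub>1) + coF0 (\<psi> F\<^sub>0) * coE1 (\<psi> E\<^sub>1)) *\<^sub>H C\<^sub>0"
    "\<psi> C\<^sub>1 = (coE0 (\<psi> E\<^sub>0) * coF1 (\<psi> F\<^sub>1) + coF0 (\<psi> E\<^sub>0) * coE1 (\<psi> F\<^sub>1)) *\<^sub>H C\<^sub>1"
    "coE0 (\<psi> E\<^sub>0) * coF1 (\<psi> E\<^sub>1) + coF0 (\<psi> E\<^sub>0) * coE1 (\<psi> E\<^sub>1) = 0"
    "coE0 (\<psi> F\<^sub>0) * coF1 (\<psi> F\<^sub>1) + coF0 (\<psi> F\<^sub>0) * coE1 (\<psi> F\<^sub>1) = 0"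
proof -
  note e = Aut_NE[OF A]
  have *: "E\<^sub>0 * F\<^sub>1 = C\<^sub>0" "F\<^sub>0 * E\<^sub>1 = C\<^sub>0" "F\<^sub>1 * E\<^sub>0 = C\<^sub>1" "E\<^sub>0 * E\<^sub>1 = 0" "F\<^sub>0 * F\<^sub>1 = 0"
    by (simp_all add: h1i_eq_iff)
  have prods: "\<psi> E\<^sub>0 * \<psi> F\<^sub>1 = \<psi> C\<^sub>0" "\<psi> F\<^sub>0 * \<psi> E\<^sub>1 = \<psi> C\<^sub>0" "\<psi> F\<^sub>1 * \<psi> E\<^sub>0 = \<psi> C\<^sub>1"
    "\<psi> E\<^sub>0 * \<psi> E\<^sub>1 = 0" "\<psi> F\<^sub>0 * \<psi> F\<^sub>1 = 0"
    by (simp_all only: e(4)[symmetric] e(5) basis_N_H *)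
  have C0: "\<psi> C\<^sub>0 \<noteq> 0" using e(6)[OF basis_N_H(5)] by (simp add: h1i_eq_iff)
  have N: "coe0 (\<psi> x) = 0" "coe1 (\<psi> x) = 0" if "x \<in> N_H" for x
    using e(1)[OF that] by (simp_all add: nilradical_iff)
  note N = N[OF basis_N_H(1)] N[OF basis_N_H(2)] N[OF basis_N_H(3)] N[OF basis_N_H(4)]
  have hom0: "coE1 (\<psi> x) = 0 \<and> coF1 (\<psi> x) = 0 \<or> coE0 (\<psi> x) = 0 \<and> coF0 (\<psi> x) = 0"
    if "x = a *\<^sub>H E\<^sub>0 + b *\<^sub>H F\<^sub>0" for a b x
  proof (rule Aut_N_homogeneous[OF A _ basis_N_H(5)])
    show "x \<in> N_H" using that by (simp add: N_H_intros)
    show "\<exists>k. x * y = k *\<^sub>H C\<^sub>0" if "y \<in> N_H" for y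
      using that by (intro exI[of _ "a * coF1 y + b * coE1 y"])
        (simp add: \<open>x = _\<close> h1i_eq_iff nilradical_iff)
  qed
  have hom1: "coE1 (\<psi> x) = 0 \<and> coF1 (\<psi> x) = 0 \<or> coE0 (\<psi> x) = 0 \<and> coF0 (\<psi> x) = 0"
    if "x = a *\<^sub>H E\<^sub>1 + b *\<^sub>H F\<^sub>1" for a b x
  proof (rule Aut_N_homogeneous[OF A _ basis_N_H(6)])
    show "x \<in> N_H" using that by (simp add: N_H_intros)
    show "\<exists>k. x * y = k *\<^sub>H C\<^sub>1" if "y \<in> N_H" for y
      using that by (intro exI[of _ "a * coF0 y + b * coE0 y"])
        (simp add: \<open>x = _\<close> h1i_eq_iff nilradical_iff)
  qed
  have hF0: "coE1 (\<psi> F\<^sub>0) = 0 \<and> coF1 (\<psi> F\<^sub>0) = 0 \<or> coE0 (\<psi> F\<^sub>0) = 0 \<and> coF0 (\<psi> F\<^sub>0) = 0"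
    by (rule hom0[of _ 0 1]) simp
  have hE1: "coE1 (\<psi> E\<^sub>1) = 0 \<and> coF1 (\<psi> E\<^sub>1) = 0 \<or> coE0 (\<psi> E\<^sub>1) = 0 \<and> coF0 (\<psi> E\<^sub>1) = 0"
    by (rule hom1[of _ 1 0]) simp
  have hF1: "coE1 (\<psi> F\<^sub>1) = 0 \<and> coF1 (\<psi> F\<^sub>1) = 0 \<or> coE0 (\<psi> F\<^sub>1) = 0 \<and> coF0 (\<psi> F\<^sub>1) = 0"
    by (rule hom1[of _ 0 1]) simp
  \<comment> \<open>A nonzero product needs factors of opposite index, so
    \<open>\<psi> C\<^sub>0 \<noteq> 0\<close> places the image of \<open>F\<^sub>1\<close> opposite
    to that of \<open>E\<^sub>0\<close>.\<close>
  have nF1: "\<not> (coE1 (\<psi> F\<^sub>1) = 0 \<and> coF1 (\<psi> F\<^sub>1) = 0)" and nE0: "\<not> (coE0 (\<psi> E\<^sub>0) = 0 \<and> coF0 (\<psi> E\<^sub>0) = 0)"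
    using prods(1) C0 N even by (auto simp: h1i_eq_iff)
  show F1: "coE0 (\<psi> F\<^sub>1) = 0" "coF0 (\<psi> F\<^sub>1) = 0" using hF1 nF1 by auto
  have nF0: "\<not> (coE0 (\<psi> F\<^sub>0) = 0 \<and> coF0 (\<psi> F\<^sub>0) = 0 \<and> coE1 (\<psi> F\<^sub>0) = 0 \<and> coF1 (\<psi> F\<^sub>0) = 0)"
    using prods(2) C0 N by (auto simp: h1i_eq_iff)
  \<comment> \<open>If \<open>\<psi> F\<^sub>0\<close> had index 1, the image of this sum would have
    nonzero odd coordinates of both indices, against homogeneity.\<close>
  have "\<psi> (E\<^sub>0 + F\<^sub>0) = \<psi> E\<^sub>0 + \<psi> F\<^sub>0" using e(3) basis_N_H by blast
  moreover have "coE1 (\<psi> (E\<^sub>0 + F\<^sub>0)) = 0 \<and> coF1 (\<psi> (E\<^sub>0 + F\<^sub>0)) = 0 \<or>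
      coE0 (\<psi> (E\<^sub>0 + F\<^sub>0)) = 0 \<and> coF0 (\<psi> (E\<^sub>0 + F\<^sub>0)) = 0"
    by (rule hom0[of _ 1 1]) simp
  ultimately show F0: "coE1 (\<psi> F\<^sub>0) = 0" "coF1 (\<psi> F\<^sub>0) = 0"
    using even nE0 hF0 nF0 by auto
  have nE1: "\<not> (coE1 (\<psi> E\<^sub>1) = 0 \<and> coF1 (\<psi> E\<^sub>1) = 0)"
    using prods(2) C0 N F0 by (auto simp: h1i_eq_iff)
  then show E1: "coE0 (\<psi> E\<^sub>1) = 0" "coF0 (\<psi> E\<^sub>1) = 0" using hE1 by auto
  show "\<psi> C\<^sub>0 = (coE0 (\<psi> E\<^sub>0) * coF1 (\<psi> F\<^sub>1) + coF0 (\<psi> E\<^sub>0) * coE1 (\<psi> F\<^sub>1)) *\<^sub>H C\<^sub>0"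
    by (subst prods(1)[symmetric]) (simp add: h1i_eq_iff N even F1)
  show "\<psi> C\<^sub>0 = (coE0 (\<psi> F\<^sub>0) * coF1 (\<psi> E\<^sub>1) + coF0 (\<psi> F\<^sub>0) * coE1 (\<psi> E\<^sub>1)) *\<^sub>H C\<^sub>0"
    by (subst prods(2)[symmetric]) (simp add: h1i_eq_iff N E1 F0)
  show "\<psi> C\<^sub>1 = (coE0 (\<psi> E\<^sub>0) * coF1 (\<psi> F\<^sub>1) + coF0 (\<psi> E\<^sub>0) * coE1 (\<psi> F\<^sub>1)) *\<^sub>H C\<^sub>1"
    by (subst prods(3)[symmetric]) (simp add: h1i_eq_iff N even F1)
  show "coE0 (\<psi> E\<^sub>0) * coF1 (\<psi> E\<^sub>1) + coF0 (\<psi> E\<^sub>0) * coE1 (\<psi> E\<^sub>1) = 0"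
    using prods(4) by (simp add: h1i_eq_iff N)
  show "coE0 (\<psi> F\<^sub>0) * coF1 (\<psi> F\<^sub>1) + coF0 (\<psi> F\<^sub>0) * coE1 (\<psi> F\<^sub>1) = 0"
    using prods(5) by (simp add: h1i_eq_iff N)
qed

text \<open>On \<open>N\<close> modulo \<open>N\<^sup>2\<close>, a type I automorphism does not depend on \<open>\<beta>\<close>, \<open>\<gamma>\<close>, \<open>\<delta>\<close>, \<open>\<eta>\<close>, so their values
  \<open>b\<close>, \<open>c\<close>, \<open>d\<close>, \<open>h\<close> can be prescribed.\<close>

lemma Aut_N_even_params:
  fixes b c d h :: complex
  assumes A: "\<psi> \<in> Aut_N" and even: "coE1 (\<psi> E\<^sub>0) = 0" "coF1 (\<psi> E\<^sub>0) = 0"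
  obtains p \<phi> where "is_type_I p \<phi>" "\<beta> p = b" "\<gamma> p = c" "\<delta> p = d" "\<eta> p = h"
    "\<mu>\<^sub>0 p = coE0 (\<psi> E\<^sub>0)" "\<nu>\<^sub>0 p = coF0 (\<psi> E\<^sub>0)" "\<sigma>\<^sub>0 p = coE0 (\<psi> F\<^sub>0)" "\<tau>\<^sub>0 p = coF0 (\<psi> F\<^sub>0)"
    "\<mu>\<^sub>1 p = coE1 (\<psi> E\<^sub>1)" "\<nu>\<^sub>1 p = coF1 (\<psi> E\<^sub>1)" "\<sigma>\<^sub>1 p = coE1 (\<psi> F\<^sub>1)" "\<tau>\<^sub>1 p = coF1 (\<psi> F\<^sub>1)"
    "\<psi> C\<^sub>0 = lam p *\<^sub>H C\<^sub>0" "\<psi> C\<^sub>1 = lam p *\<^sub>H C\<^sub>1"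
proof -
  note ev = Aut_N_even[OF A even]
  define p where "p = \<lparr>\<beta> = b, \<gamma> = c, \<delta> = d, \<eta> = h,
    lam = coE0 (\<psi> E\<^sub>0) * coF1 (\<psi> F\<^sub>1) + coF0 (\<psi> E\<^sub>0) * coE1 (\<psi> F\<^sub>1),
    \<mu>\<^sub>0 = coE0 (\<psi> E\<^sub>0), \<nu>\<^sub>0 = coF0 (\<psi> E\<^sub>0), \<sigma>\<^sub>0 = coE0 (\<psi> F\<^sub>0), \<tau>\<^sub>0 = coF0 (\<psi> F\<^sub>0),
    \<mu>\<^sub>1 = coE1 (\<psi> E\<^sub>1), \<nu>\<^sub>1 = coF1 (\<psi> E\<^sub>1), \<sigma>\<^sub>1 = coE1 (\<psi> F\<^sub>1), \<tau>\<^sub>1 = coF1 (\<psi> F\<^sub>1)\<rparr>"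
  have C: "\<psi> C\<^sub>0 = lam p *\<^sub>H C\<^sub>0" "\<psi> C\<^sub>1 = lam p *\<^sub>H C\<^sub>1"
    using ev(7,9) by (simp_all add: p_def)
  have "lam p = \<sigma>\<^sub>0 p * \<nu>\<^sub>1 p + \<tau>\<^sub>0 p * \<mu>\<^sub>1 p"
    using ev(8) C(1) by (simp add: h1i_eq_iff) (simp add: p_def)
  moreover have "\<psi> C\<^sub>0 \<noteq> 0" using Aut_NE(6)[OF A basis_N_H(5)] by (simp add: h1i_eq_iff)
  then have "lam p \<noteq> 0" using C(1) by auto
  ultimately have "constraints p"
    using ev(10,11) by (intro constraintsI) (simp_all add: p_def)
  then obtain \<phi> where "is_type_I p \<phi>" using ex1_type_I by blast
  then show thesis using C by (intro that[of p \<phi>]) (simp_all add: p_def)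
qed

lemma Aut_N_even_mod_squared:
  assumes A: "\<psi> \<in> Aut_N" and even: "coE1 (\<psi> E\<^sub>0) = 0" "coF1 (\<psi> E\<^sub>0) = 0"
  shows "\<exists>\<phi>\<in>Aut_H. \<forall>x\<in>N_H. \<psi> x - \<phi> x \<in> N_H_squared"
proof -
  \<comment> \<open>The values of \<open>\<beta>\<close>, \<open>\<gamma>\<close>,
    \<open>\<delta>\<close>, \<open>\<eta>\<close> are left open: on N they affect only the
    \<open>C\<close>-coordinates.\<close>
  obtain p \<phi> where I: "is_type_I p \<phi>" and p: 
    "\<mu>\<^sub>0 p = coE0 (\<psi> E\<^sub>0)" "\<nu>\<^sub>0 p = coF0 (\<psi> E\<^sub>0)" "\<sigma>\<^sub>0 p = coE0 (\<psi> F\<^sub>0)" "\<tau>\<^sub>0 p = coF0 (\<psi> F\<^sub>0)"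
    "\<mu>\<^sub>1 p = coE1 (\<psi> E\<^sub>1)" "\<nu>\<^sub>1 p = coF1 (\<psi> E\<^sub>1)" "\<sigma>\<^sub>1 p = coE1 (\<psi> F\<^sub>1)" "\<tau>\<^sub>1 p = coF1 (\<psi> F\<^sub>1)"
    and C: "\<psi> C\<^sub>0 = lam p *\<^sub>H C\<^sub>0" "\<psi> C\<^sub>1 = lam p *\<^sub>H C\<^sub>1"
    by (rule Aut_N_even_params[OF A even])
  note co = I[unfolded is_type_I_iff, THEN conjunct2, rule_format]
  have "\<psi> x - \<phi> x \<in> N_H_squared" if x: "x \<in> N_H" for x
  proof -
    have "coe0 (\<psi> x) = 0" "coe1 (\<psi> x) = 0" using Aut_NE(1)[OF A x] by (simp_all add: nilradical_iff)
    moreover have "coE0 (\<psi> x) = coE0 (\<phi> x)" "coE1 (\<psi> x) = coE1 (\<phi> x)"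
      "coF0 (\<psi> x) = coF0 (\<phi> x)" "coF1 (\<psi> x) = coF1 (\<phi> x)"
      unfolding Aut_N_expand[OF A x] using x
      by (simp_all add: co nilradical_iff Aut_N_even[OF A even] even C p)
    ultimately show ?thesis using x by (simp add: N_H_squared_iff nilradical_iff co[THEN conjunct1]
          co[THEN conjunct2, THEN conjunct1])
  qed
  then show ?thesis using type_I_Aut_H[OF I] by blast
qed

text \<open>The \<open>C\<^sub>1\<close>-coordinates of the images of the odd basis elements give
  two linear systems, for \<open>\<delta>\<close>, \<open>\<eta>\<close> and for
  \<open>\<beta>\<close>, \<open>\<gamma>\<close>; preservation of the commutator space then makes
  the \<open>C\<^sub>0\<close>-coordinates agree as well.\<close>

lemma Aut_N_even_restrict:
  assumes A: "\<psi> \<in> Aut_N" and even: "coE1 (\<psi> E\<^sub>0) = 0" "coF1 (\<psi> E\<^sub>0) = 0"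
    and comm: "\<psi> ` commutator_space \<subseteq> commutator_space"
  shows "\<exists>\<phi>\<in>Aut_H. \<forall>x\<in>N_H. \<psi> x = \<phi> x"
proof -
  \<comment> \<open>This preliminary choice supplies (iv) and (v), the nonzero determinants of the
    two systems; \<open>p\<close> is chosen after solving them.\<close>
  obtain p\<^sub>0 \<phi>\<^sub>0 where I0: "is_type_I p\<^sub>0 \<phi>\<^sub>0" and p0:
    "\<mu>\<^sub>0 p\<^sub>0 = coE0 (\<psi> E\<^sub>0)" "\<nu>\<^sub>0 p\<^sub>0 = coF0 (\<psi> E\<^sub>0)" "\<sigma>\<^sub>0 p\<^sub>0 = coE0 (\<psi> F\<^sub>0)" "\<tau>\<^sub>0 p\<^sub>0 = coF0 (\<psi> F\<^sub>0)"
    "\<mu>\<^sub>1 p\<^sub>0 = coE1 (\<psi> E\<^sub>1)" "\<nu>\<^sub>1 p\<^sub>0 = coF1 (\<psi> E\<^sub>1)" "\<sigma>\<^sub>1 p\<^sub>0 = coE1 (\<psi> F\<^sub>1)" "\<tau>\<^sub>1 p\<^sub>0 = coF1 (\<psi> F\<^sub>1)"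
    by (rule Aut_N_even_params[OF A even])
  then have det: "coF0 (\<psi> E\<^sub>0) * coE0 (\<psi> F\<^sub>0) - coE0 (\<psi> E\<^sub>0) * coF0 (\<psi> F\<^sub>0) \<noteq> 0"
    "coF1 (\<psi> E\<^sub>1) * coE1 (\<psi> F\<^sub>1) - coE1 (\<psi> E\<^sub>1) * coF1 (\<psi> F\<^sub>1) \<noteq> 0"
    by (auto simp: is_type_I_def constraints_iff)
  obtain d h where dh: "coF0 (\<psi> E\<^sub>0) * d + coE0 (\<psi> E\<^sub>0) * h = coC1 (\<psi> E\<^sub>0)"
    "coF0 (\<psi> F\<^sub>0) * d + coE0 (\<psi> F\<^sub>0) * h = coC1 (\<psi> F\<^sub>0)"
    by (rule cramer_ex[OF det(1)])
  obtain b c where bc: "coF1 (\<psi> E\<^sub>1) * b + coE1 (\<psi> E\<^sub>1) * c = coC1 (\<psi> E\<^sub>1)"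
    "coF1 (\<psi> F\<^sub>1) * b + coE1 (\<psi> F\<^sub>1) * c = coC1 (\<psi> F\<^sub>1)"
    by (rule cramer_ex[OF det(2)])
  obtain p \<phi> where I: "is_type_I p \<phi>" and p: "\<beta> p = b" "\<gamma> p = c" "\<delta> p = d" "\<eta> p = h"
    "\<mu>\<^sub>0 p = coE0 (\<psi> E\<^sub>0)" "\<nu>\<^sub>0 p = coF0 (\<psi> E\<^sub>0)" "\<sigma>\<^sub>0 p = coE0 (\<psi> F\<^sub>0)" "\<tau>\<^sub>0 p = coF0 (\<psi> F\<^sub>0)"
    "\<mu>\<^sub>1 p = coE1 (\<psi> E\<^sub>1)" "\<nu>\<^sub>1 p = coF1 (\<psi> E\<^sub>1)" "\<sigma>\<^sub>1 p = coE1 (\<psi> F\<^sub>1)" "\<tau>\<^sub>1 p = coF1 (\<psi> F\<^sub>1)"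
    and C: "\<psi> C\<^sub>0 = lam p *\<^sub>H C\<^sub>0" "\<psi> C\<^sub>1 = lam p *\<^sub>H C\<^sub>1"
    by (rule Aut_N_even_params[OF A even])
  have "\<psi> x \<in> commutator_space" if "x \<in> commutator_space" for x
    using comm that by blast
  from this[of E\<^sub>0] this[of E\<^sub>1] this[of F\<^sub>0] this[of F\<^sub>1]
  have anti: "coC0 (\<psi> E\<^sub>0) = - coC1 (\<psi> E\<^sub>0)" "coC0 (\<psi> E\<^sub>1) = - coC1 (\<psi> E\<^sub>1)"
    "coC0 (\<psi> F\<^sub>0) = - coC1 (\<psi> F\<^sub>0)" "coC0 (\<psi> F\<^sub>1) = - coC1 (\<psi> F\<^sub>1)"
    by (simp_all add: commutator_space_iff eq_neg_iff_add_eq_0)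
  have N: "coe0 (\<psi> x) = 0" "coe1 (\<psi> x) = 0" if "x \<in> N_H" for x
    using Aut_NE(1)[OF A that] by (simp_all add: nilradical_iff)
  note defs = I[unfolded is_type_I_def]
  have "\<psi> E\<^sub>0 = \<phi> E\<^sub>0" "\<psi> F\<^sub>0 = \<phi> F\<^sub>0" "\<psi> E\<^sub>1 = \<phi> E\<^sub>1" "\<psi> F\<^sub>1 = \<phi> F\<^sub>1"
    by (simp_all only: defs) (simp_all add: h1i_eq_iff N basis_N_H Aut_N_even[OF A even] even anti p dh[symmetric] bc[symmetric] algebra_simps)
  moreover have "\<psi> C\<^sub>0 = \<phi> C\<^sub>0" "\<psi> C\<^sub>1 = \<phi> C\<^sub>1" using C defs by simp_all
  ultimately have "\<psi> x = \<phi> x" if x: "x \<in> N_H" for x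
    using x linear_H_expand[of \<phi> x] defs unfolding Aut_N_expand[OF A x]
    by (simp add: nilradical_iff)
  then show ?thesis using type_I_Aut_H[OF I] by blast
qed

text \<open>The multiples of \<open>E\<^sub>0\<close> by N lie on the line of
  \<open>C\<^sub>0\<close>, so its image is homogeneous, and the flip moves index 1 to index
  0.\<close>

lemma Aut_N_even_cases:
  assumes A: "\<psi> \<in> Aut_N"
  defines "\<psi>' \<equiv> restrict (\<kappa> \<circ> \<psi>) N_H"
  shows "coE1 (\<psi> E\<^sub>0) = 0 \<and> coF1 (\<psi> E\<^sub>0) = 0 \<or> coE1 (\<psi>' E\<^sub>0) = 0 \<and> coF1 (\<psi>' E\<^sub>0) = 0"
proof -
  have "coE1 (\<psi> E\<^sub>0) = 0 \<and> coF1 (\<psi> E\<^sub>0) = 0 \<or> coE0 (\<psi> E\<^sub>0) = 0 \<and> coF0 (\<psi> E\<^sub>0) = 0"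
  proof (rule Aut_N_homogeneous[OF A basis_N_H(1) basis_N_H(5)])
    show "\<exists>k. E\<^sub>0 * y = k *\<^sub>H C\<^sub>0" if "y \<in> N_H" for y
      using that by (intro exI[of _ "coF1 y"]) (simp add: h1i_eq_iff nilradical_iff)
  qed
  then show ?thesis by (simp add: \<psi>'_def basis_N_H)
qed

lemma Aut_N_mod_squared:
  assumes A: "\<psi> \<in> Aut_N"
  shows "\<exists>\<phi>\<in>Aut_H. \<forall>x\<in>N_H. \<psi> x - \<phi> x \<in> N_H_squared"
  using Aut_N_even_cases[OF A]
proof
  assume "coE1 (\<psi> E\<^sub>0) = 0 \<and> coF1 (\<psi> E\<^sub>0) = 0"
  then show ?thesis using Aut_N_even_mod_squared[OF A] by blast
next
  assume "coE1 (restrict (\<kappa> \<circ> \<psi>) N_H E\<^sub>0) = 0 \<and> coF1 (restrict (\<kappa> \<circ> \<psi>) N_H E\<^sub>0) = 0"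
  then obtain \<phi> where \<phi>: "\<phi> \<in> Aut_H" "\<forall>x\<in>N_H. restrict (\<kappa> \<circ> \<psi>) N_H x - \<phi> x \<in> N_H_squared"
    using Aut_N_even_mod_squared[OF restrict_flip_Aut_N[OF A]] by blast
  then have "\<forall>x\<in>N_H. \<psi> x - (\<kappa> \<circ> \<phi>) x \<in> N_H_squared"
    by (simp add: N_H_squared_iff)
  then show ?thesis using Aut_H_comp[OF flip_Aut_H \<phi>(1)] by blast
qed

lemma Aut_N_restrict:
  assumes A: "\<psi> \<in> Aut_N" and comm: "\<psi> ` commutator_space \<subseteq> commutator_space"
  shows "\<exists>\<phi>\<in>Aut_H. \<forall>x\<in>N_H. \<psi> x = \<phi> x"
  using Aut_N_even_cases[OF A]
proof
  assume "coE1 (\<psi> E\<^sub>0) = 0 \<and> coF1 (\<psi> E\<^sub>0) = 0"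
  then show ?thesis using Aut_N_even_restrict[OF A _ _ comm] by blast
next
  assume "coE1 (restrict (\<kappa> \<circ> \<psi>) N_H E\<^sub>0) = 0 \<and> coF1 (restrict (\<kappa> \<circ> \<psi>) N_H E\<^sub>0) = 0"
  moreover have "restrict (\<kappa> \<circ> \<psi>) N_H ` commutator_space \<subseteq> commutator_space"
    using comm commutator_space_subset by (auto intro!: flip_commutator_space)
  ultimately obtain \<phi> where \<phi>: "\<phi> \<in> Aut_H" "\<forall>x\<in>N_H. restrict (\<kappa> \<circ> \<psi>) N_H x = \<phi> x"
    using Aut_N_even_restrict[OF restrict_flip_Aut_N[OF A]] by blast
  then have "\<forall>x\<in>N_H. \<psi> x = (\<kappa> \<circ> \<phi>) x"
    by (simp add: h1i_eq_iff)
  then show ?thesis using Aut_H_comp[OF flip_Aut_H \<phi>(1)] by blast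
qed

section \<open>Bijectivity of the restriction map\<close>

text \<open>The products of \<open>\<theta> e\<^sub>0\<close> with the odd basis elements determine
  it up to its \<open>C\<close>-part, and idempotency removes that part. So \<open>K\<close> is
  fixed, while \<open>E\<close> and \<open>F\<close> lie in N.\<close>

lemma Aut_H_id_on_N:
  assumes A: "\<theta> \<in> Aut_H" and N: "\<And>x. x \<in> N_H \<Longrightarrow> \<theta> x = x"
  shows "\<theta> = id"
proof -
  define x where "x = \<theta> e\<^sub>0"
  have "e\<^sub>0 * E\<^sub>0 = E\<^sub>0" "e\<^sub>0 * F\<^sub>0 = F\<^sub>0" "e\<^sub>0 * E\<^sub>1 = 0" "e\<^sub>0 * F\<^sub>1 = 0" "e\<^sub>0 * e\<^sub>0 = e\<^sub>0"
    by (simp_all add: h1i_eq_iff)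
  then have "x * E\<^sub>0 = E\<^sub>0" "x * F\<^sub>0 = F\<^sub>0" "x * E\<^sub>1 = 0" "x * F\<^sub>1 = 0" "x * x = x"
    using Aut_H_simps(4)[OF A] N basis_N_H zero_N_H unfolding x_def by metis+
  then have e0: "\<theta> e\<^sub>0 = e\<^sub>0"
    unfolding x_def[symmetric] by (simp add: h1i_eq_iff)
  show ?thesis
  proof (rule Aut_H_eqI[OF A id_Aut_H])
    have K: "genK = 2 *\<^sub>H e\<^sub>0 - 1" by (simp add: h1i_eq_iff)
    show "\<theta> genK = id genK" unfolding K by (simp add: Aut_H_simps[OF A] e0)
    show "\<theta> genE = id genE" "\<theta> genF = id genF" using N by (simp_all add: nilradical_iff)
  qed
qed

text \<open>Two automorphisms that agree on N differ by one that is the identity there, hence by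
  \<open>id\<close>; surjectivity is \<open>Aut_N_restrict\<close>.\<close>

lemma bij_betw_restrict_Aut_H:
  "bij_betw (\<lambda>\<phi>. restrict \<phi> N_H) Aut_H {\<psi> \<in> Aut_N. \<psi> ` commutator_space \<subseteq> commutator_space}"
  unfolding bij_betw_def
proof
  show "inj_on (\<lambda>\<phi>. restrict \<phi> N_H) Aut_H"
  proof (rule inj_onI)
    fix \<phi> \<psi> assume A: "\<phi> \<in> Aut_H" "\<psi> \<in> Aut_H" and "restrict \<phi> N_H = restrict \<psi> N_H"
    then have eq: "\<phi> x = \<psi> x" if "x \<in> N_H" for x using that by (metis restrict_apply')
    have "inv_into UNIV \<psi> \<circ> \<phi> = id"
    proof (rule Aut_H_id_on_N)
      show "inv_into UNIV \<psi> \<circ> \<phi> \<in> Aut_H" using A by (simp add: Aut_H_comp Aut_H_inv_into)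
      show "(inv_into UNIV \<psi> \<circ> \<phi>) x = x" if "x \<in> N_H" for x
        using eq[OF that] pointfree_idE[OF inv_into_comp_Aut_H[OF A(2)], of x] by simp
    qed
    then show "\<phi> = \<psi>"
      using comp_inv_into_Aut_H[OF A(2)] by (metis pointfree_idE ext)
  qed
  show "(\<lambda>\<phi>. restrict \<phi> N_H) ` Aut_H = {\<psi> \<in> Aut_N. \<psi> ` commutator_space \<subseteq> commutator_space}"
  proof (intro equalityI subsetI)
    fix \<psi> assume "\<psi> \<in> (\<lambda>\<phi>. restrict \<phi> N_H) ` Aut_H"
    then show "\<psi> \<in> {\<psi> \<in> Aut_N. \<psi> ` commutator_space \<subseteq> commutator_space}"
      using restrict_Aut_N Aut_H_commutator_space commutator_space_subset by auto
  next
    fix \<psi> assume \<psi>: "\<psi> \<in> {\<psi> \<in> Aut_N. \<psi> ` commutator_space \<subseteq> commutator_space}"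
    then obtain \<phi> where \<phi>: "\<phi> \<in> Aut_H" "\<forall>x\<in>N_H. \<psi> x = \<phi> x" using Aut_N_restrict by blast
    have "\<psi> = restrict \<phi> N_H"
      using \<phi>(2) \<psi> Aut_NE(8) by (intro extensionalityI[of _ N_H]) auto
    with \<phi>(1) show "\<psi> \<in> (\<lambda>\<phi>. restrict \<phi> N_H) ` Aut_H" by blast
  qed
qed

section \<open>The two symmetries\<close>

lemma constr_flip_params:
  "constr_i (flip_params p) \<longleftrightarrow> constr_i p" "constr_ii (flip_params p) \<longleftrightarrow> constr_ii p"
  "constr_iii_a (flip_params p) \<longleftrightarrow> constr_iii_b p" "constr_iii_b (flip_params p) \<longleftrightarrow> constr_iii_a p"
  "constr_iv (flip_params p) \<longleftrightarrow> constr_v p" "constr_v (flip_params p) \<longleftrightarrow> constr_iv p"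
  "constr_vi (flip_params p) \<longleftrightarrow> constr_vi p"
  "relation_\<nu>\<tau> (flip_params p) \<longleftrightarrow> relation_\<nu>\<tau> p" "relation_\<mu>\<sigma> (flip_params p) \<longleftrightarrow> relation_\<mu>\<sigma> p"
  by (simp_all add: flip_params_def constr_i_def constr_ii_def constr_iii_a_def constr_iii_b_def
      constr_iv_def constr_v_def constr_vi_def relation_\<nu>\<tau>_def relation_\<mu>\<sigma>_def
      mult.commute add.commute)

lemma constr_swap_params:
  "constr_i (swap_params p) \<longleftrightarrow> constr_ii p" "constr_ii (swap_params p) \<longleftrightarrow> constr_i p"
  "constr_iii_a (swap_params p) \<longleftrightarrow> constr_iii_b p" "constr_iii_b (swap_params p) \<longleftrightarrow> constr_iii_a p"
  "constr_iv (swap_params p) \<longleftrightarrow> constr_iv p" "constr_v (swap_params p) \<longleftrightarrow> constr_v p"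
  "constr_vi (swap_params p) \<longleftrightarrow> constr_vi p"
  "relation_\<nu>\<tau> (swap_params p) \<longleftrightarrow> relation_\<mu>\<sigma> p" "relation_\<mu>\<sigma> (swap_params p) \<longleftrightarrow> relation_\<nu>\<tau> p"
  by (simp_all add: swap_params_def constr_i_def constr_ii_def constr_iii_a_def constr_iii_b_def
      constr_iv_def constr_v_def constr_vi_def relation_\<nu>\<tau>_def relation_\<mu>\<sigma>_def
      mult.commute add.commute)

lemma constraints_flip_params: "constraints (flip_params p) \<longleftrightarrow> constraints p"
  unfolding constraints_def constr_flip_params by blast

lemma flip_params_flip_params: "flip_params (flip_params p) = p"
  and swap_params_swap_params: "swap_params (swap_params p) = p"
  by (simp_all add: flip_params_def swap_params_def)

text \<open>Both the conjugation and \<open>flip_params\<close> are involutions, so the converse is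
  a second application of \<open>type_I_flip\<close>.\<close>

lemma type_I_flip_iff: "is_type_I (flip_params p) (\<kappa> \<circ> \<phi> \<circ> \<kappa>) \<longleftrightarrow> is_type_I p \<phi>"
proof
  assume "is_type_I (flip_params p) (\<kappa> \<circ> \<phi> \<circ> \<kappa>)"
  from type_I_flip[OF this] show "is_type_I p \<phi>"
    by (simp add: flip_params_flip_params comp_def pointfree_idE[OF flip_flip])
qed (rule type_I_flip)

lemma type_I_swap_iff: "is_type_I (swap_params p) (\<epsilon> \<circ> \<phi> \<circ> \<epsilon>) \<longleftrightarrow> is_type_I p \<phi>"
proof
  assume "is_type_I (swap_params p) (\<epsilon> \<circ> \<phi> \<circ> \<epsilon>)"
  from type_I_swap[OF this] show "is_type_I p \<phi>"
    by (simp add: swap_params_swap_params comp_def pointfree_idE[OF swap_EF_swap_EF])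
qed (rule type_I_swap)

theorem proposition5p2:
  shows
    \<comment> \<open>1)\<close>
   "(Aut_H = Aut_I \<union> Aut_II \<and>
     (\<forall>p. constraints p \<longrightarrow> (\<exists>!\<phi>. is_type_I p \<phi>) \<and> (\<exists>!\<phi>. is_type_II p \<phi>)) \<and>
     (\<forall>\<phi>\<in>Aut_I. \<exists>!p. is_type_I p \<phi>) \<and>
     Aut_II = {\<kappa> \<circ> \<phi> | \<phi>. \<phi> \<in> Aut_I} \<and>
     Aut_II = {\<phi>. \<exists>p. is_type_II p \<phi>} \<and>
     bij_betw (\<lambda>\<phi>. restrict \<phi> N_H) Aut_H {\<psi> \<in> Aut_N. \<psi> ` commutator_space \<subseteq> commutator_space} \<and>
     (\<forall>\<psi>\<in>Aut_N. \<exists>\<phi>\<in>Aut_H. \<forall>x\<in>N_H. \<psi> x - \<phi> x \<in> N_H_squared) \<and>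
     \<kappa> \<in> Aut_H \<and> \<kappa> genK = - genK \<and> \<kappa> genE = genE \<and> \<kappa> genF = genF \<and>
     \<kappa> e\<^sub>0 = e\<^sub>1 \<and> \<kappa> e\<^sub>1 = e\<^sub>0 \<and> \<kappa> E\<^sub>0 = E\<^sub>1 \<and> \<kappa> E\<^sub>1 = E\<^sub>0 \<and>
     \<kappa> F\<^sub>0 = F\<^sub>1 \<and> \<kappa> F\<^sub>1 = F\<^sub>0 \<and> \<kappa> C\<^sub>0 = C\<^sub>1 \<and> \<kappa> C\<^sub>1 = C\<^sub>0 \<and>
     (\<forall>p. constraints (flip_params p) \<longleftrightarrow> constraints p))
    \<and> \<comment> \<open>2)\<close>
    (Aut_I \<lhd> Aut_H_group)
    \<and> \<comment> \<open>3)\<close>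
    (subgroup Aut_I_diag (Aut_H_group\<lparr>carrier := Aut_I\<rparr>) \<and>
     bij_betw aut_matrix Aut_I_diag
       {M \<in> block_matrices. invertible M \<and> leaves_stable M antitraceless_forms} \<and>
     bij_betw aut_matrix Aut_I_diag
       {M \<in> block_matrices. invertible M \<and> leaves_stable M special_forms})
    \<and> \<comment> \<open>4)\<close>
    (\<forall>p. constraints p \<longrightarrow> relation_\<nu>\<tau> p \<and> relation_\<mu>\<sigma> p)
    \<and> \<comment> \<open>the two symmetries\<close>
    (\<forall>p. (constr_i (flip_params p) \<longleftrightarrow> constr_i p) \<and>
         (constr_ii (flip_params p) \<longleftrightarrow> constr_ii p) \<and>
         (constr_iii_a (flip_params p) \<longleftrightarrow> constr_iii_b p) \<and>
         (constr_iii_b (flip_params p) \<longleftrightarrow> constr_iii_a p) \<and>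
         (constr_iv (flip_params p) \<longleftrightarrow> constr_v p) \<and>
         (constr_v (flip_params p) \<longleftrightarrow> constr_iv p) \<and>
         (constr_vi (flip_params p) \<longleftrightarrow> constr_vi p) \<and>
         (relation_\<nu>\<tau> (flip_params p) \<longleftrightarrow> relation_\<nu>\<tau> p) \<and>
         (relation_\<mu>\<sigma> (flip_params p) \<longleftrightarrow> relation_\<mu>\<sigma> p) \<and>
         (\<forall>\<phi>. is_type_I (flip_params p) (\<kappa> \<circ> \<phi> \<circ> \<kappa>) \<longleftrightarrow> is_type_I p \<phi>))
    \<and>
    (\<epsilon> \<in> Aut_H \<and> \<epsilon> genK = genK \<and> \<epsilon> genE = genF \<and> \<epsilon> genF = genE \<and>
     (\<forall>p. (constr_i (swap_params p) \<longleftrightarrow> constr_ii p) \<and>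
          (constr_ii (swap_params p) \<longleftrightarrow> constr_i p) \<and>
          (constr_iii_a (swap_params p) \<longleftrightarrow> constr_iii_b p) \<and>
          (constr_iii_b (swap_params p) \<longleftrightarrow> constr_iii_a p) \<and>
          (constr_iv (swap_params p) \<longleftrightarrow> constr_iv p) \<and>
          (constr_v (swap_params p) \<longleftrightarrow> constr_v p) \<and>
          (constr_vi (swap_params p) \<longleftrightarrow> constr_vi p) \<and>
          (relation_\<nu>\<tau> (swap_params p) \<longleftrightarrow> relation_\<mu>\<sigma> p) \<and>
          (relation_\<mu>\<sigma> (swap_params p) \<longleftrightarrow> relation_\<nu>\<tau> p) \<and>
          (\<forall>\<phi>. is_type_I (swap_params p) (\<epsilon> \<circ> \<phi> \<circ> \<epsilon>) \<longleftrightarrow> is_type_I p \<phi>)))"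
proof (intro conjI allI ballI impI)
  show "\<exists>!p. is_type_I p \<phi>" if "\<phi> \<in> Aut_I" for \<phi>
    using that is_type_I_unique by (auto simp: Aut_I_def)
qed (simp_all only: Aut_H_eq[symmetric] ex1_type_I ex1_type_II Aut_II_eq[symmetric] Aut_II_eq_type_II[symmetric]
    bij_betw_restrict_Aut_H Aut_N_mod_squared flip_Aut_H flip_gen flip_basis constraints_flip_params
    normal_Aut_I subgroup_Aut_I_diag bij_betw_aut_matrix[OF special_forms_subset subset_refl leaves_stable_antitraceless]
    bij_betw_aut_matrix[OF subset_refl special_forms_subset leaves_stable_special]
    constraints_imp_relations constr_flip_params type_I_flip_iff
    swap_EF_Aut_H swap_EF_gen constr_swap_params type_I_swap_iff)

end
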